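(* Suppose $\Re\mu\ge0$, and let $W_2(u,z)$ $(u>0)$ be a family of solutions of $$w''(z)=\frac1z w'(z)+\left(u^2+\frac{\mu^2-1}{z^2}+f(z)\right)w(z)$$ having Olver's asymptotic expansion (property (P2) of the context) in the sector $|\arg z|\le\frac32\pi-\delta_0$. Then the expansion holds without restriction on $\arg z$: for every $N=1,2,3,\dots$ there are functions $g_2(u,z),h_2(u,z)$ and positive constants $K_2,u_2$ (independent of $u,z$) such that, for all $u\ge u_2$ and all $z$ on the Riemann surface of the logarithm with $0<|z|\le R$, $$W_2(u,z)=zK_\mu(uz)\left(\sum_{s=0}^{N-1} \frac{A_s(z)}{u^{2s}}+g_2(u,z)\right)-\frac{z}{u}K_{\mu+1}(uz)\left(\sum_{s=0}^{N-1} \frac{B_s(z)}{u^{2s}}+z\,h_2(u,z)\right)$$ and $$|g_2(u,z)|+|h_2(u,z)|\le \frac{K_2}{u^{2N}}.$$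
   Context: Setting: $\mu\in\mathbb{C}$ is fixed, $0<R<R_0$, and $f(z)$ is an even analytic function in $\{z:|z|<R_0\}$. Solutions of the differential equation are considered on the Riemann surface of the logarithm over $0<|z|<R_0$; $K_\nu$ is the modified Bessel function of the second kind, also on the Riemann surface of the logarithm, with $\arg(uz)=\arg z$ for $u>0$. The functions $A_s(z)=A_s(\mu,z)$ (even) and $B_s(z)=B_s(\mu,z)$ (odd), analytic in $|z|<R_0$, are uniquely determined by $A_0(z)=1$, $A_s(0)=0$ for $s\ge1$, and for $s\ge 0$ $$2B_s(z) = -A_s'(z)+\int_0^z\left(f(t)A_s(t)-\frac{2\mu+1}{t} A_s'(t)\right) dt,$$ $$2A_{s+1}(z) = \frac{2\mu+1}{z} B_s(z)- B_s'(z)+\int f(z)B_s(z)\, dz,$$ where the last integral denotes an antiderivative, its constant being fixed by $A_{s+1}(0)=0$. Property (P2), with a fixed $\delta_0\in(0,\frac12\pi)$: for each $u>0$, $W_2(u,\cdot)$ is a solution of the differential equation, and for every $N\ge1$ there are functions $g_2,h_2$ and positive constants $K_2,u_2$ (depending on $N$ but not on $u,z$) such that $$W_2(u,z)=zK_\mu(uz)\left(\sum_{s=0}^{N-1} \frac{A_s(z)}{u^{2s}}+g_2(u,z)\right)-\frac{z}{u}K_{\mu+1}(uz)\left(\sum_{s=0}^{N-1} \frac{B_s(z)}{u^{2s}}+z\,h_2(u,z)\right),$$ $$|g_2(u,z)|+|h_2(u,z)|\le \frac{K_2}{u^{2N}}\quad\text{for } 0<|z|\le R,\ |\arg z|\le\tfrac32\pi-\delta_0,\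 u\ge u_2.$$ The family $W_2$ itself does not depend on $N$. For $\Re\mu\ge0$ such a family exists by a theorem of Olver (1956). *)

theory Defs
  imports "HOL-Complex_Analysis.Complex_Analysis"
begin

text \<open>
  Points of the Riemann surface of the logarithm are given in its global chart: a complex number
  \<open>\<zeta>\<close> stands for the point \<open>z\<close> with \<open>log z = \<zeta>\<close>.  So \<open>exp \<zeta>\<close> is the projection of \<open>z\<close> to
  the punctured plane, \<open>|z| = norm (exp \<zeta>)\<close>, \<open>arg z = Im \<zeta>\<close> (unrestricted), the power \<open>z\<close> to
  the \<open>a\<close> is \<open>exp (a * \<zeta>)\<close>, and for \<open>u > 0\<close> the point \<open>u z\<close> with \<open>arg (u z) = arg z\<close> is
  \<open>ln u + \<zeta>\<close>.
\<close>

definition surface_disc :: "real \<Rightarrow> complex set" where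
  "surface_disc R0 = {\<zeta>. norm (exp \<zeta>) < R0}"

definition surface_cdisc :: "real \<Rightarrow> complex set" where
  "surface_cdisc R = {\<zeta>. norm (exp \<zeta>) \<le> R}"

definition surface_sector :: "real \<Rightarrow> real \<Rightarrow> complex set" where
  "surface_sector R \<alpha> = {\<zeta>. norm (exp \<zeta>) \<le> R \<and> \<bar>Im \<zeta>\<bar> \<le> \<alpha>}"

text \<open>The derivative with respect to \<open>z = exp \<zeta>\<close>, by the chain rule.\<close>

definition deriv_z :: "(complex \<Rightarrow> complex) \<Rightarrow> complex \<Rightarrow> complex" where
  "deriv_z w \<zeta> = deriv w \<zeta> / exp \<zeta>"

definition bessel_I :: "complex \<Rightarrow> complex \<Rightarrow> complex" where
  "bessel_I \<nu> \<zeta> =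
     (\<Sum>k. exp ((\<nu> + 2 * of_nat k) * (\<zeta> - of_real (ln 2))) * rGamma (\<nu> + of_nat k + 1) / fact k)"

text \<open>
  The modified Bessel function of the second kind; for integer order the limiting value with
  respect to the order is taken, as usual.
\<close>

definition bessel_K :: "complex \<Rightarrow> complex \<Rightarrow> complex" where
  "bessel_K \<nu> \<zeta> =
     (let q = (\<lambda>\<kappa>. of_real (pi / 2) * (bessel_I (- \<kappa>) \<zeta> - bessel_I \<kappa> \<zeta>) / sin (\<kappa> * of_real pi))
      in if \<nu> \<in> \<int> then Lim (at \<nu>) q else q \<nu>)"

definition ode_solution ::
  "complex \<Rightarrow> (complex \<Rightarrow> complex) \<Rightarrow> real \<Rightarrow> real \<Rightarrow> (complex \<Rightarrow> complex) \<Rightarrow> bool" where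
  "ode_solution \<mu> f R0 u w \<longleftrightarrow>
     w holomorphic_on surface_disc R0 \<and>
     (\<forall>\<zeta>\<in>surface_disc R0.
        deriv_z (deriv_z w) \<zeta> =
          1 / exp \<zeta> * deriv_z w \<zeta>
          + ((of_real u)\<^sup>2 + (\<mu>\<^sup>2 - 1) / (exp \<zeta>)\<^sup>2 + f (exp \<zeta>)) * w \<zeta>)"

text \<open>
  The integrand of the first recurrence has a removable singularity at \<open>0\<close> because \<open>A s\<close> is
  even; its value there does not affect the integral.
\<close>

definition olver_coefficients ::
  "complex \<Rightarrow> (complex \<Rightarrow> complex) \<Rightarrow> real \<Rightarrow>
   (nat \<Rightarrow> complex \<Rightarrow> complex) \<Rightarrow> (nat \<Rightarrow> complex \<Rightarrow> complex) \<Rightarrow> bool" where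
  "olver_coefficients \<mu> f R0 A B \<longleftrightarrow>
     (\<forall>s. A s analytic_on ball 0 R0 \<and> (\<forall>z\<in>ball 0 R0. A s (- z) = A s z)) \<and>
     (\<forall>s. B s analytic_on ball 0 R0 \<and> (\<forall>z\<in>ball 0 R0. B s (- z) = - B s z)) \<and>
     (\<forall>z\<in>ball 0 R0. A 0 z = 1) \<and>
     (\<forall>s\<ge>1. A s 0 = 0) \<and>
     (\<forall>s. \<forall>z\<in>ball 0 R0.
        2 * B s z = - deriv (A s) z
          + contour_integral (linepath 0 z) (\<lambda>t. f t * A s t - (2 * \<mu> + 1) / t * deriv (A s) t)) \<and>
     (\<forall>s. \<exists>F. (\<forall>z\<in>ball 0 R0. (F has_field_derivative f z * B s z) (at z)) \<and>
        (\<forall>z\<in>ball 0 R0 - {0}.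
           2 * A (Suc s) z = (2 * \<mu> + 1) / z * B s z - deriv (B s) z + F z))"

definition olver_expansion_on ::
  "complex set \<Rightarrow> complex \<Rightarrow> (nat \<Rightarrow> complex \<Rightarrow> complex) \<Rightarrow> (nat \<Rightarrow> complex \<Rightarrow> complex) \<Rightarrow>
   (real \<Rightarrow> complex \<Rightarrow> complex) \<Rightarrow> bool" where
  "olver_expansion_on S \<mu> A B W \<longleftrightarrow>
     (\<forall>N\<ge>1. \<exists>(g :: real \<Rightarrow> complex \<Rightarrow> complex) (h :: real \<Rightarrow> complex \<Rightarrow> complex) (K :: real) (u0 :: real).
        K > 0 \<and> u0 > 0 \<and>
        (\<forall>u\<ge>u0. \<forall>\<zeta>\<in>S.
           W u \<zeta> =
             exp \<zeta> * bessel_K \<mu> (of_real (ln u) + \<zeta>) *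
               ((\<Sum>s<N. A s (exp \<zeta>) / of_real u ^ (2 * s)) + g u \<zeta>)
             - exp \<zeta> / of_real u * bessel_K (\<mu> + 1) (of_real (ln u) + \<zeta>) *
               ((\<Sum>s<N. B s (exp \<zeta>) / of_real u ^ (2 * s)) + exp \<zeta> * h u \<zeta>) \<and>
           norm (g u \<zeta>) + norm (h u \<zeta>) \<le> K / u ^ (2 * N)))"

end

theory Submission
  imports Defs
begin

text \<open>
  Write \<open>V = W/z\<close> and work in the logarithmic chart, where half a turn is the shift by \<open>\<i> \<pi>\<close>.  As \<open>f\<close> is
  even, the shift maps solutions of the equation to solutions.  A Wronskian argument with the recessive
  Frobenius solution \<open>v\<close> (exponent \<open>\<mu>\<close>, eigenfunction of the shift) shows that
  \<open>V(z exp(\<i>\<pi>)) - exp(-\<i>\<pi>\<mu>) V(z)\<close> is a multiple of \<open>v\<close> (\<open>solution_defect_recessive\<close>).  The functions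
  \<open>K\<^sub>\<mu>(u z)\<close> and \<open>z K\<^sub>\<mu>\<^sub>+\<^sub>1(u z)\<close> have the same kind of monodromy, with \<open>I\<close>-functions in the place of \<open>v\<close>.  As the
  \<open>A\<^sub>s\<close> are even and the \<open>B\<^sub>s\<close> are odd, the error \<open>e\<close> of the truncated expansion inherits it: after \<open>m\<close>
  half-turns \<open>e\<close> becomes \<open>exp(-\<i>\<pi>\<mu>m) e + U\<^sub>m j\<close>, where the defect \<open>j\<close> is again an eigenfunction of the shift
  and the same \<open>U\<^sub>m\<close> occurs in the continuation of \<open>K\<^sub>\<mu>\<close>.

  The point is to bound this by the size of \<open>K\<close> at the rotated point with a constant independent of \<open>m\<close>, for
  complex \<open>\<mu>\<close> as well, where \<open>U\<^sub>m\<close> may grow exponentially or be small.  Since the vectors of \<open>K\<close>- and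
  \<open>I\<close>-functions have a constant Wronskian, cross products express \<open>exp(-\<i>\<pi>\<mu>m)\<close> and \<open>U\<^sub>m\<close> through \<open>K\<close> at the rotated point
  (\<open>monodromy_multiplier\<close>), and what remains is to bound products of sizes of \<open>K\<close> and \<open>I\<close> on the base sheet
  \<open>\<bar>arg z\<bar> \<le> \<pi>/2\<close>.  For large \<open>u z\<close> the exponentials cancel up to a power of \<open>u\<close> (\<open>bessel_K_decay\<close>,
  \<open>bessel_I_growth\<close>).  For small \<open>u z\<close> the powers \<open>z\<^sup>-\<^sup>\<mu>\<close> and \<open>z\<^sup>\<mu>\<close> cancel, provided that \<open>j\<close> is of order
  \<open>z\<^sup>\<mu>\<close>; this follows from the maximum principle on a circle \<open>\<bar>u z\<bar> = const\<close>
  (\<open>periodic_half_plane_maximum\<close>), because \<open>j z\<^sup>-\<^sup>\<mu>\<close> is single-valued and bounded.  For \<open>\<mu> = 0\<close>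
  the logarithm is followed explicitly.

  The outcome is \<open>connection_estimate\<close>: all sheets are reached at the cost of a fixed power of \<open>u\<close>.  Taking
  correspondingly more terms of the given expansion, and moving the surplus terms into the remainder,
  recovers the stated order.

  The decay of \<open>K\<close> is not accessible from its definition by series.  It comes from the integral of
  \<open>exp (- z cosh t - \<nu> t)\<close>, which is identified with \<open>K\<close> by recurrences in the order; integer orders are
  limits of non-integer ones.
\<close>

section \<open>The entire functions behind the Bessel functions\<close>

text \<open>
  Up to normalisation this is the regularised hypergeometric function \<open>\<^sub>0F\<^sub>1\<close>: the function \<open>I\<^sub>\<nu>(z)\<close> is
  \<open>(z/2)\<^sup>\<nu> Phi \<nu> (z\<^sup>2/4)\<close>.  It is entire in both variables, and holomorphy in the order is what
  gives access to integer orders.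
\<close>

definition Phi :: "complex \<Rightarrow> complex \<Rightarrow> complex" where
  "Phi \<nu> y = (\<Sum>k. rGamma (\<nu> + of_nat k + 1) / fact k * y ^ k)"

text \<open>
  As soon as \<open>k\<close> exceeds \<open>B + 1\<close>, a further step divides by a number of modulus at least \<open>1\<close>; the
  remaining shifts stay in a compact disc.
\<close>

lemma rGamma_shift_bounded:
  fixes B :: real
  shows "\<exists>C>0. \<forall>(\<nu>::complex) k. norm \<nu> \<le> B \<longrightarrow> norm (rGamma (\<nu> + of_nat k + 1)) \<le> C"
proof (cases "B \<ge> 0")
  case False
  then show ?thesis by (intro exI[of _ 1]) (auto dest: order_trans[OF norm_ge_zero])
next
  case True
  have "compact ((rGamma :: complex \<Rightarrow> complex) ` cball 0 (2 * B + 2))"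
    by (intro compact_continuous_image continuous_intros compact_cball)
  then obtain C where C: "C > 0" "\<And>w::complex. norm w \<le> 2 * B + 2 \<Longrightarrow> norm (rGamma w) \<le> C"
    using bounded_pos[of "(rGamma :: complex \<Rightarrow> complex) ` cball 0 (2 * B + 2)"] compact_imp_bounded
    by (metis image_eqI mem_cball_0)
  have "norm (rGamma (\<nu> + of_nat k + 1)) \<le> C" if "norm \<nu> \<le> B" for \<nu> :: complex and k
  proof (induction k)
    case 0
    have "norm (\<nu> + 1) \<le> norm \<nu> + 1" by (metis norm_triangle_ineq norm_one)
    then show ?case using that True by (auto intro!: C(2))
  next
    case (Suc k)
    show ?case
    proof (cases "real (Suc k) \<le> B + 1")
      case True
      have "norm (\<nu> + of_nat (Suc k) + 1) \<le> norm \<nu> + norm (of_nat (Suc k) :: complex) + norm (1::complex)"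
        using norm_triangle_ineq[of "\<nu> + of_nat (Suc k)" 1] norm_triangle_ineq[of \<nu> "of_nat (Suc k)"]
        by linarith
      also have "\<dots> \<le> 2 * B + 2" using that True by (simp del: of_nat_Suc)
      finally show ?thesis by (rule C(2))
    next
      case False
      let ?w = "\<nu> + of_nat k + 1"
      have eq: "?w = of_nat (Suc k) - (- \<nu>)" by simp
      have "norm (of_nat (Suc k) :: complex) - norm (- \<nu>) \<le> norm ?w"
        unfolding eq by (rule norm_triangle_ineq2)
      then have 1: "norm ?w \<ge> 1" using False that by (simp del: of_nat_Suc)
      have "norm (rGamma (?w + 1)) * norm ?w \<le> C"
        using Suc unfolding norm_mult[symmetric] by (simp only: rGamma_plus1 mult.commute[of _ ?w])
      moreover have "norm (rGamma (?w + 1)) * 1 \<le> norm (rGamma (?w + 1)) * norm ?w"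
        by (intro mult_left_mono 1) simp
      ultimately have "norm (rGamma (?w + 1)) \<le> C" by linarith
      then show ?thesis by (simp add: add_ac)
    qed
  qed
  with C(1) show ?thesis by blast
qed

lemma Phi_coeff_bound:
  fixes B :: real
  shows "\<exists>C>0. \<forall>(\<nu>::complex) k y. norm \<nu> \<le> B \<longrightarrow>
    norm (rGamma (\<nu> + of_nat k + 1) / fact k * y ^ k) \<le> C / fact k * norm y ^ k"
proof -
  obtain C where C: "C > 0" "\<And>(\<nu>::complex) k. norm \<nu> \<le> B \<Longrightarrow> norm (rGamma (\<nu> + of_nat k + 1)) \<le> C"
    using rGamma_shift_bounded[of B] by blast
  have "norm (rGamma (\<nu> + of_nat k + 1) / fact k * y ^ k) \<le> C / fact k * norm y ^ k"
    if "norm \<nu> \<le> B" for \<nu> y :: complex and k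
    unfolding norm_mult norm_power norm_divide norm_fact
    by (intro mult_right_mono divide_right_mono C that) auto
  with C(1) show ?thesis by blast
qed

lemma summable_exp_real: "summable (\<lambda>k. C / fact k * (r::real) ^ k)"
  using summable_mult[OF summable_exp[of r], of C] by (simp add: field_simps)

lemma summable_norm_Phi: "summable (\<lambda>k. norm (rGamma (\<nu> + of_nat k + 1) / fact k * (y::complex) ^ k))"
proof -
  obtain C where C: "\<And>(\<nu>'::complex) k y. norm \<nu>' \<le> norm \<nu> \<Longrightarrow> norm (rGamma (\<nu>' + of_nat k + 1) / fact k * y ^ k) \<le> C / fact k * norm y ^ k"
    using Phi_coeff_bound[of "norm \<nu>"] by blast
  show ?thesis
    by (rule summable_comparison_test'[OF summable_exp_real[of C "norm y"], of 0])
       (simp only: real_norm_def abs_norm_cancel, rule C, rule order_refl)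
qed

lemma sums_Phi: "(\<lambda>k. rGamma (\<nu> + of_nat k + 1) / fact k * y ^ k) sums Phi \<nu> y"
  unfolding Phi_def using summable_norm_cancel[OF summable_norm_Phi] by (rule summable_sums)

lemma Phi_bound:
  fixes B :: real
  shows "\<exists>C>0. \<forall>\<nu> y. norm \<nu> \<le> B \<longrightarrow> norm (Phi \<nu> y) \<le> C * exp (norm y)"
proof -
  obtain C where C: "C > 0" "\<And>(\<nu>::complex) k y. norm \<nu> \<le> B \<Longrightarrow> norm (rGamma (\<nu> + of_nat k + 1) / fact k * y ^ k) \<le> C / fact k * norm y ^ k"
    using Phi_coeff_bound[of B] by blast
  have "norm (Phi \<nu> y) \<le> C * exp (norm y)" if "norm \<nu> \<le> B" for \<nu> y
  proof -
    have "norm (Phi \<nu> y) \<le> (\<Sum>k. norm (rGamma (\<nu> + of_nat k + 1) / fact k * y ^ k))"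
      unfolding Phi_def by (rule summable_norm[OF summable_norm_Phi])
    also have "\<dots> \<le> (\<Sum>k. C / fact k * norm y ^ k)"
      by (rule suminf_le[OF _ summable_norm_Phi summable_exp_real])
         (rule C(2)[OF that])
    also have "\<dots> = (\<Sum>k. C * (norm y ^ k /\<^sub>R fact k))" by (simp add: field_simps)
    also have "\<dots> = C * exp (norm y)"
      unfolding exp_def by (rule suminf_mult[symmetric, OF summable_exp_generic, symmetric])
    finally show ?thesis .
  qed
  with C(1) show ?thesis by blast
qed

lemma Phi_0: "Phi \<nu> 0 = rGamma (\<nu> + 1)"
  unfolding Phi_def by (subst suminf_finite[where N="{0}"]) auto

lemma Phi_recurrence: "Phi (\<nu> - 1) y = \<nu> * Phi \<nu> y + y * Phi (\<nu> + 1) y"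
proof -
  have 1: "(\<lambda>k. y * (rGamma (\<nu> + 1 + of_nat k + 1) / fact k * y ^ k)) sums (y * Phi (\<nu> + 1) y)"
    by (intro sums_mult sums_Phi)
  let ?g = "\<lambda>k. of_nat k * rGamma (\<nu> + of_nat k + 1) / fact k * y ^ k"
  have "(\<lambda>k. ?g (Suc k)) sums (y * Phi (\<nu> + 1) y)"
    using 1 by (rule sums_cong[THEN iffD1, rotated])
       (simp add: field_simps fact_Suc del: of_nat_Suc, simp add: add_ac)
  then have 2: "?g sums (y * Phi (\<nu> + 1) y)"
    by (subst (asm) sums_Suc_iff) simp
  have "(\<lambda>k. \<nu> * (rGamma (\<nu> + of_nat k + 1) / fact k * y ^ k) + ?g k) sums (\<nu> * Phi \<nu> y + y * Phi (\<nu> + 1) y)"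
    by (intro sums_add sums_mult sums_Phi 2)
  moreover have "\<nu> * (rGamma (\<nu> + of_nat k + 1) / fact k * y ^ k) + ?g k
      = rGamma (\<nu> - 1 + of_nat k + 1) / fact k * y ^ k" for k
  proof -
    have "rGamma (\<nu> + of_nat k) = (\<nu> + of_nat k) * rGamma (\<nu> + of_nat k + 1)"
      by (rule rGamma_plus1[symmetric])
    then show ?thesis by (simp add: field_simps)
  qed
  ultimately show ?thesis using sums_Phi[of "\<nu> - 1" y] sums_unique2 by fastforce
qed

lemma Phi_deriv: "(Phi \<nu> has_field_derivative Phi (\<nu> + 1) y) (at y)"
proof -
  let ?c = "\<lambda>k. rGamma (\<nu> + of_nat k + 1) / fact k :: complex"
  have "((\<lambda>y. \<Sum>k. ?c k * y ^ k) has_field_derivative (\<Sum>k. diffs ?c k * y ^ k)) (at y)"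
    by (rule termdiffs_strong_converges_everywhere) (rule summable_norm_cancel[OF summable_norm_Phi])
  moreover have "diffs ?c = (\<lambda>k. rGamma (\<nu> + 1 + of_nat k + 1) / fact k)"
    by (auto simp: diffs_def fun_eq_iff fact_Suc field_simps simp del: of_nat_Suc) (simp add: add_ac)
  ultimately show ?thesis unfolding Phi_def[abs_def] by simp
qed

lemma Phi_deriv' [derivative_intros]:
  "(g has_field_derivative g') (at x within S) \<Longrightarrow>
    ((\<lambda>x. Phi \<nu> (g x)) has_field_derivative Phi (\<nu> + 1) (g x) * g') (at x within S)"
  using DERIV_chain2[OF Phi_deriv] by blast

lemma Phi_holomorphic_order: "(\<lambda>\<nu>. Phi \<nu> y) holomorphic_on UNIV"
proof (rule holomorphic_uniform_sequence[where f = "\<lambda>n \<nu>. \<Sum>k<n. rGamma (\<nu> + of_nat k + 1) / fact k * y ^ k"])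
  fix x :: complex
  obtain C where C: "C > 0" "\<And>(\<nu>::complex) k y. norm \<nu> \<le> norm x + 1 \<Longrightarrow> norm (rGamma (\<nu> + of_nat k + 1) / fact k * y ^ k) \<le> C / fact k * norm y ^ k"
    using Phi_coeff_bound[of "norm x + 1"] by blast
  have "uniform_limit (cball x 1) (\<lambda>n \<nu>. \<Sum>k<n. rGamma (\<nu> + of_nat k + 1) / fact k * y ^ k) (\<lambda>\<nu>. Phi \<nu> y) sequentially"
    unfolding Phi_def
  proof (rule Weierstrass_m_test[where M="\<lambda>k. C / fact k * norm y ^ k"])
    fix n \<nu> assume "\<nu> \<in> cball x 1"
    then have "norm \<nu> \<le> norm x + 1"
      by (metis add.commute dist_commute dist_norm mem_cball norm_triangle_sub order_trans add_left_mono)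
    then show "norm (rGamma (\<nu> + of_nat n + 1) / fact n * y ^ n) \<le> C / fact n * norm y ^ n"
      by (rule C(2))
  qed (rule summable_exp_real)
  then show "\<exists>d>0. cball x d \<subseteq> UNIV \<and> uniform_limit (cball x d)
      (\<lambda>n \<nu>. \<Sum>k<n. rGamma (\<nu> + of_nat k + 1) / fact k * y ^ k) (\<lambda>\<nu>. Phi \<nu> y) sequentially"
    by (intro exI[of _ 1]) auto
qed (auto intro!: holomorphic_intros)

text \<open>
  The \<open>y\<close>-derivative of the left-hand side cancels by the recurrence, so its value is the one at
  \<open>y = 0\<close>, a product of two reciprocal Gamma values covered by the reflection formula.
\<close>

lemma Phi_wronskian:
  "Phi \<nu> y * Phi (- \<nu> - 1) y - y * Phi (\<nu> + 1) y * Phi (- \<nu>) y = - sin (of_real pi * \<nu>) / of_real pi"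
proof -
  let ?D = "\<lambda>y. Phi \<nu> y * Phi (- \<nu> - 1) y - y * Phi (\<nu> + 1) y * Phi (- \<nu>) y"
  have "(?D has_field_derivative 0) (at y)" for y
  proof -
    have r1: "y * Phi (\<nu> + 2) y = Phi \<nu> y - (\<nu> + 1) * Phi (\<nu> + 1) y"
      using Phi_recurrence[of "\<nu> + 1" y] by (simp add: algebra_simps)
    have r2: "y * Phi (1 - \<nu>) y = Phi (- \<nu> - 1) y + \<nu> * Phi (- \<nu>) y"
      using Phi_recurrence[of "- \<nu>" y] by (simp add: algebra_simps)
    have "(?D has_field_derivative
        (Phi (\<nu> + 1) y * Phi (- \<nu> - 1) y + Phi \<nu> y * Phi (- \<nu>) y
         - Phi (\<nu> + 1) y * Phi (- \<nu>) y - (y * Phi (\<nu> + 2) y) * Phi (- \<nu>) y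
         - Phi (\<nu> + 1) y * (y * Phi (1 - \<nu>) y))) (at y)"
      by (auto intro!: derivative_eq_intros simp: algebra_simps add.commute[of 2]) 
    also have "(Phi (\<nu> + 1) y * Phi (- \<nu> - 1) y + Phi \<nu> y * Phi (- \<nu>) y
         - Phi (\<nu> + 1) y * Phi (- \<nu>) y - (y * Phi (\<nu> + 2) y) * Phi (- \<nu>) y
         - Phi (\<nu> + 1) y * (y * Phi (1 - \<nu>) y)) = 0"
      unfolding r1 r2 by (simp add: algebra_simps)
    finally show ?thesis .
  qed
  then obtain c where c: "\<And>y. ?D y = c"
    using has_field_derivative_zero_constant[of UNIV ?D] by auto
  have "c = rGamma (\<nu> + 1) * rGamma (- \<nu>)" using c[of 0] by (simp add: Phi_0)
  also have "\<dots> = - sin (of_real pi * \<nu>) / of_real pi"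
    using rGamma_reflection_complex[of "\<nu> + 1"]
    by (simp add: algebra_simps sin_add)
  finally show ?thesis using c by simp
qed

text \<open>
  The reason why \<open>I\<^sub>-\<^sub>n = I\<^sub>n\<close>, which makes the numerator in the definition of \<open>K\<close> vanish at integers.
\<close>

lemma Phi_minus_int: "Phi (- of_nat n) y = y ^ n * Phi (of_nat n) y"
proof (induction n rule: induct_nat_012)
  case 1
  show ?case using Phi_recurrence[of 0 y] by simp
next
  case (ge2 n)
  have "Phi (- of_nat (Suc (Suc n))) y = - of_nat (Suc n) * Phi (- of_nat (Suc n)) y + y * Phi (- of_nat n) y"
    using Phi_recurrence[of "- of_nat (Suc n)" y] by (simp add: algebra_simps)
  also have "\<dots> = y ^ Suc n * (Phi (of_nat n) y - of_nat (Suc n) * Phi (of_nat (Suc n)) y)"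
    using ge2 by (simp add: algebra_simps)
  also have "Phi (of_nat n) y - of_nat (Suc n) * Phi (of_nat (Suc n)) y = y * Phi (of_nat (Suc (Suc n))) y"
    using Phi_recurrence[of "of_nat (Suc n)" y] by (simp add: algebra_simps)
  finally show ?case by (simp add: algebra_simps)
qed simp

section \<open>Modified Bessel functions on the logarithmic chart\<close>

lemma exp_ln2_chart: "exp (2 * (s - of_real (ln 2))) = (exp s)\<^sup>2 / (4::complex)"
proof -
  have "exp (of_real (ln 2) :: complex) = 2" by (simp add: exp_of_real)
  then show ?thesis by (simp add: exp_diff exp_double power_divide)
qed

lemma bessel_I_Phi: "bessel_I \<nu> s = exp (\<nu> * (s - of_real (ln 2))) * Phi \<nu> ((exp s)\<^sup>2 / 4)"
proof -
  let ?t = "s - of_real (ln 2)"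
  have "exp ((\<nu> + 2 * of_nat k) * ?t) = exp (\<nu> * ?t) * exp (2 * ?t) ^ k" for k
    unfolding exp_of_nat_mult[symmetric] exp_add[symmetric] by (simp add: algebra_simps)
  then show ?thesis
    unfolding bessel_I_def Phi_def exp_ln2_chart[symmetric]
    by (subst suminf_mult[symmetric, OF sums_summable[OF sums_Phi]]) (simp add: mult_ac)
qed

lemma exp_mult_add_one:
  "exp ((\<nu> + 1) * (s - of_real (ln 2))) = exp (\<nu> * (s - of_real (ln 2))) * (exp s / 2 :: complex)"
proof -
  have "exp (of_real (ln 2) :: complex) = 2" by (simp add: exp_of_real)
  then have "exp (s - of_real (ln 2)) = exp s / (2 :: complex)" by (simp add: exp_diff)
  then show ?thesis by (simp add: distrib_right exp_add)
qed

lemma bessel_I_recurrence: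
  "exp s * (bessel_I (\<nu> - 1) s - bessel_I (\<nu> + 1) s) = 2 * \<nu> * bessel_I \<nu> s"
proof -
  have 1: "exp (\<nu> * (s - of_real (ln 2))) = exp ((\<nu> - 1) * (s - of_real (ln 2))) * (exp s / 2)"
    using exp_mult_add_one[of "\<nu> - 1" s] by simp
  show ?thesis
    unfolding bessel_I_Phi Phi_recurrence[of \<nu>] exp_mult_add_one 1
    by (simp add: algebra_simps power2_eq_square)
qed

lemma bessel_I_deriv:
  "(bessel_I \<nu> has_field_derivative exp s * bessel_I (\<nu> + 1) s + \<nu> * bessel_I \<nu> s) (at s)"
  unfolding bessel_I_Phi[abs_def] exp_mult_add_one
  by (auto intro!: derivative_eq_intros simp: algebra_simps power2_eq_square)

lemma bessel_I_Suc_deriv: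
  "(bessel_I (\<nu> + 1) has_field_derivative exp s * bessel_I \<nu> s - (\<nu> + 1) * bessel_I (\<nu> + 1) s) (at s)"
  using bessel_I_deriv[of "\<nu> + 1" s] bessel_I_recurrence[of s "\<nu> + 1"]
  by (simp add: algebra_simps)

lemma bessel_I_shift: "bessel_I \<nu> (s + \<i> * of_real pi) = exp (\<i> * of_real pi * \<nu>) * bessel_I \<nu> s"
proof -
  have "exp (\<nu> * (s + \<i> * of_real pi - of_real (ln 2)))
      = exp (\<i> * of_real pi * \<nu>) * exp (\<nu> * (s - of_real (ln 2)))"
    by (simp add: exp_add[symmetric] algebra_simps)
  moreover have "exp (s + \<i> * of_real pi) = - exp s" by (simp add: exp_add)
  ultimately show ?thesis by (simp add: bessel_I_Phi)
qed

lemma bessel_I_wronskian: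
  "exp s * (bessel_I \<nu> s * bessel_I (- \<nu> - 1) s - bessel_I (\<nu> + 1) s * bessel_I (- \<nu>) s)
    = - 2 * sin (of_real pi * \<nu>) / of_real pi"
proof -
  let ?y = "(exp s)\<^sup>2 / 4"
  have 1: "exp (- \<nu> * (s - of_real (ln 2))) = exp ((- \<nu> - 1) * (s - of_real (ln 2))) * (exp s / 2)"
    using exp_mult_add_one[of "- \<nu> - 1" s] by simp
  have 2: "exp (\<nu> * (s - of_real (ln 2))) * exp (- \<nu> * (s - of_real (ln 2))) = 1"
    by (simp add: exp_add[symmetric])
  have "exp s * (bessel_I \<nu> s * bessel_I (- \<nu> - 1) s - bessel_I (\<nu> + 1) s * bessel_I (- \<nu>) s)
     = 2 * (exp (\<nu> * (s - of_real (ln 2))) * exp (- \<nu> * (s - of_real (ln 2)))) *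
        (Phi \<nu> ?y * Phi (- \<nu> - 1) ?y - ?y * Phi (\<nu> + 1) ?y * Phi (- \<nu>) ?y)"
    unfolding bessel_I_Phi exp_mult_add_one 1 by (simp add: algebra_simps power2_eq_square)
  also have "\<dots> = - 2 * sin (of_real pi * \<nu>) / of_real pi"
    unfolding 2 Phi_wronskian by simp
  finally show ?thesis .
qed

lemma bessel_I_minus_int: assumes "\<nu> \<in> \<int>" shows "bessel_I (- \<nu>) s = bessel_I \<nu> s"
proof -
  have *: "bessel_I (- of_nat n) s = bessel_I (of_nat n) s" for n
  proof -
    have "exp (of_nat n * (s - of_real (ln 2))) = exp (- of_nat n * (s - of_real (ln 2))) * ((exp s)\<^sup>2 / 4) ^ n"
    proof -
      define t where "t = s - of_real (ln 2)"
      have "exp (of_nat n * t) = exp (- of_nat n * t) * exp (2 * t) ^ n"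
        unfolding exp_of_nat_mult[symmetric] exp_add[symmetric] by (simp add: algebra_simps)
      then show ?thesis unfolding exp_ln2_chart[symmetric] t_def .
    qed
    then show ?thesis unfolding bessel_I_Phi Phi_minus_int by simp
  qed
  from assms obtain k where k: "\<nu> = of_int k" by (rule Ints_cases)
  show ?thesis using *[of "nat k"] *[of "nat (- k)"] k by (cases "k \<ge> 0") auto
qed

lemma bessel_I_holomorphic_order: "(\<lambda>\<nu>. bessel_I \<nu> s) holomorphic_on UNIV"
  unfolding bessel_I_Phi by (intro holomorphic_intros Phi_holomorphic_order)

lemma bessel_I_holomorphic_order' [holomorphic_intros]:
  "g holomorphic_on S \<Longrightarrow> (\<lambda>\<nu>. bessel_I (g \<nu>) s) holomorphic_on S"
  using holomorphic_on_compose_gen[OF _ bessel_I_holomorphic_order, of g S] by (auto simp: o_def)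

lemma tendsto_bessel_I_order [tendsto_intros]:
  assumes "(g \<longlongrightarrow> \<nu>) F" shows "((\<lambda>x. bessel_I (g x) s) \<longlongrightarrow> bessel_I \<nu> s) F"
proof -
  have "continuous_on UNIV (\<lambda>\<nu>. bessel_I \<nu> s)"
    by (intro holomorphic_on_imp_continuous_on bessel_I_holomorphic_order)
  then have "isCont (\<lambda>\<nu>. bessel_I \<nu> s) \<nu>" by (simp add: continuous_on_eq_continuous_at)
  then show ?thesis using assms by (rule isCont_tendsto_compose)
qed

lemma bessel_I_holomorphic [holomorphic_intros]:
  "g holomorphic_on S \<Longrightarrow> (\<lambda>x. bessel_I \<nu> (g x)) holomorphic_on S"
  using holomorphic_on_compose_gen[of g S "bessel_I \<nu>" UNIV] bessel_I_deriv[of \<nu>]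
  by (auto simp: o_def holomorphic_on_def field_differentiable_def)

lemma sin_pi_eq_0_Ints: "sin (\<kappa> * of_real pi) = 0 \<longleftrightarrow> (\<kappa>::complex) \<in> \<int>"
proof -
  have "of_real (of_int n * pi) = of_int n * (of_real pi :: complex)" for n by simp
  then have "sin (\<kappa> * of_real pi) = 0 \<longleftrightarrow> (\<exists>n. \<kappa> * of_real pi = of_int n * of_real pi)"
    by (simp only: sin_eq_0)
  also have "\<dots> \<longleftrightarrow> \<kappa> \<in> \<int>" by (simp add: Ints_def image_iff)
  finally show ?thesis .
qed

lemma bessel_K_nonint:
  assumes "\<nu> \<notin> \<int>"
  shows "bessel_K \<nu> s = of_real (pi / 2) * (bessel_I (- \<nu>) s - bessel_I \<nu> s) / sin (\<nu> * of_real pi)"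
  using assms by (simp add: bessel_K_def)

lemma eventually_nonint: "\<forall>\<^sub>F \<kappa> in at (\<nu>::complex). \<kappa> \<notin> \<int>"
proof (cases "\<nu> \<in> \<int>")
  case True
  have "\<kappa> \<notin> \<int>" if "dist \<kappa> \<nu> < 1" "\<kappa> \<noteq> \<nu>" for \<kappa>
  proof
    assume "\<kappa> \<in> \<int>"
    then obtain k where "\<kappa> - \<nu> = of_int k" using True by (metis Ints_cases Ints_diff)
    then have "\<bar>k\<bar> < 1" using that(1) by (simp add: dist_norm)
    then show False using \<open>\<kappa> - \<nu> = of_int k\<close> that(2) by simp
  qed
  then show ?thesis by (auto simp: eventually_at intro!: exI[of _ 1])
next
  case False
  have "open (- (\<int> :: complex set))" by (simp add: closed_Ints open_Compl)
  then show ?thesis using False by (intro eventually_at_in_open'[THEN eventually_mono]) auto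
qed

text \<open>
  At an integer order the defining quotient is \<open>0/0\<close> with a simple zero below, so the limit in the
  definition of \<open>bessel_K\<close> exists.  Consequently every identity, and every non-strict inequality with
  locally uniform constants, carries over from non-integer to integer orders.
\<close>

lemma bessel_K_isCont_order: "isCont (\<lambda>\<kappa>. bessel_K \<kappa> s) \<nu>"
proof -
  let ?q = "\<lambda>\<kappa>. of_real (pi / 2) * (bessel_I (- \<kappa>) s - bessel_I \<kappa> s) / sin (\<kappa> * of_real pi) :: complex"
  have ev: "\<forall>\<^sub>F \<kappa> in at \<nu>. bessel_K \<kappa> s = ?q \<kappa>"
    using eventually_nonint by eventually_elim (rule bessel_K_nonint)
  have "(?q \<longlongrightarrow> bessel_K \<nu> s) (at \<nu>)"
  proof (cases "\<nu> \<in> \<int>")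
    case False
    then have "sin (\<nu> * of_real pi) \<noteq> 0" by (simp add: sin_pi_eq_0_Ints)
    then have "(?q \<longlongrightarrow> ?q \<nu>) (at \<nu>)" by (intro tendsto_intros)
    then show ?thesis using False by (simp add: bessel_K_nonint)
  next
    case True
    let ?N = "\<lambda>\<kappa>. of_real (pi / 2) * (bessel_I (- \<kappa>) s - bessel_I \<kappa> s)"
    have "?N holomorphic_on UNIV" by (intro holomorphic_intros)
    then have 1: "(?N has_field_derivative deriv ?N \<nu>) (at \<nu>)"
      by (rule holomorphic_derivI) auto
    have 2: "((\<lambda>\<kappa>. sin (\<kappa> * of_real pi)) has_field_derivative cos (\<nu> * of_real pi) * of_real pi) (at \<nu>)"
      by (auto intro!: derivative_eq_intros)
    have "sin (\<nu> * of_real pi) = 0" using True by (simp add: sin_pi_eq_0_Ints)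
    then have "cos (\<nu> * of_real pi) \<noteq> 0" 
      using sin_cos_squared_add[of "\<nu> * of_real pi"] by auto
    then have "(?q \<longlongrightarrow> deriv ?N \<nu> / (cos (\<nu> * of_real pi) * of_real pi)) (at \<nu>)"
      using True \<open>sin (\<nu> * of_real pi) = 0\<close>
      by (intro lhopital_complex_simple[OF 1 2]) (auto simp: bessel_I_minus_int)
    moreover from this have "bessel_K \<nu> s = deriv ?N \<nu> / (cos (\<nu> * of_real pi) * of_real pi)"
      using True by (auto simp: bessel_K_def intro!: tendsto_Lim)
    ultimately show ?thesis by simp
  qed
  then show ?thesis unfolding isCont_def using ev by (rule Lim_transform_eventually[OF _ eventually_mono]) auto
qed

lemma tendsto_bessel_K_order [tendsto_intros]:
  "(g \<longlongrightarrow> \<nu>) F \<Longrightarrow> ((\<lambda>x. bessel_K (g x) s) \<longlongrightarrow> bessel_K \<nu> s) F"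
  by (rule isCont_tendsto_compose[OF bessel_K_isCont_order])

lemma order_identity:
  fixes F G :: "complex \<Rightarrow> complex"
  assumes "(F \<longlongrightarrow> F \<nu>) (at \<nu>)" "(G \<longlongrightarrow> G \<nu>) (at \<nu>)" "\<And>\<kappa>. \<kappa> \<notin> \<int> \<Longrightarrow> F \<kappa> = G \<kappa>"
  shows "F \<nu> = G \<nu>"
proof (rule tendsto_unique[OF _ assms(1)])
  show "(F \<longlongrightarrow> G \<nu>) (at \<nu>)"
    by (rule Lim_transform_eventually[OF assms(2)]) (use eventually_nonint in eventually_elim, simp add: assms(3))
qed simp

lemma nonint_add_one: "(\<nu>::complex) \<notin> \<int> \<Longrightarrow> \<nu> + 1 \<notin> \<int>"
  by (metis Ints_1 Ints_diff add_diff_cancel_right')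

lemma nonint_diff_one: "(\<nu>::complex) \<notin> \<int> \<Longrightarrow> \<nu> - 1 \<notin> \<int>"
  by (metis Ints_1 Ints_add diff_add_cancel)

lemma sin_add_one_pi: "sin ((\<nu> + 1) * of_real pi) = - sin (\<nu> * of_real pi :: complex)"
  by (simp add: distrib_right sin_add)

lemma sin_diff_one_pi: "sin ((\<nu> - 1) * of_real pi) = - sin (\<nu> * of_real pi :: complex)"
  by (simp add: left_diff_distrib sin_diff)

text \<open>
  Half a turn multiplies \<open>I\<^sub>\<nu>\<close> by \<open>exp (\<i> \<pi> \<nu>)\<close> and \<open>I\<^sub>-\<^sub>\<nu>\<close> by the inverse factor; the mismatch of the two
  produces the term with \<open>I\<^sub>\<nu>\<close>.
\<close>

lemma bessel_K_shift:
  "bessel_K \<nu> (s + \<i> * of_real pi)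
    = exp (- (\<i> * of_real pi * \<nu>)) * bessel_K \<nu> s - \<i> * of_real pi * bessel_I \<nu> s"
proof (rule order_identity[where F="\<lambda>\<nu>. bessel_K \<nu> (s + \<i> * of_real pi)"])
  fix \<kappa> :: complex assume k: "\<kappa> \<notin> \<int>"
  then have nz: "sin (\<kappa> * of_real pi) \<noteq> 0" by (simp add: sin_pi_eq_0_Ints)
  have e: "2 * \<i> * sin (\<kappa> * of_real pi) = exp (\<i> * of_real pi * \<kappa>) - exp (- (\<i> * of_real pi * \<kappa>))"
    unfolding sin_exp_eq by (simp add: field_simps)
  show "bessel_K \<kappa> (s + \<i> * of_real pi)
    = exp (- (\<i> * of_real pi * \<kappa>)) * bessel_K \<kappa> s - \<i> * of_real pi * bessel_I \<kappa> s"
  proof -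
    have "(2 * \<i> * sin (\<kappa> * of_real pi)) * (bessel_I \<kappa> s * of_real pi)
      = (exp (\<i> * of_real pi * \<kappa>) - exp (- (\<i> * of_real pi * \<kappa>))) * (bessel_I \<kappa> s * of_real pi)" 
      by (simp only: e)
    then show ?thesis
      unfolding bessel_K_nonint[OF k] bessel_I_shift using nz by (simp add: field_simps)
  qed
qed (intro tendsto_intros)+

lemma bessel_KI_wronskian: "exp s * (bessel_K \<nu> s * bessel_I (\<nu> + 1) s + bessel_K (\<nu> + 1) s * bessel_I \<nu> s) = 1"
proof (rule order_identity[where G="\<lambda>_. 1" and \<nu>=\<nu> and
      F="\<lambda>\<nu>. exp s * (bessel_K \<nu> s * bessel_I (\<nu> + 1) s + bessel_K (\<nu> + 1) s * bessel_I \<nu> s)"])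
  fix \<kappa> :: complex assume k: "\<kappa> \<notin> \<int>"
  then have nz: "sin (\<kappa> * of_real pi) \<noteq> 0" by (simp add: sin_pi_eq_0_Ints)
  have eq: "- (\<kappa> + 1) = - \<kappa> - 1" by simp
  show "exp s * (bessel_K \<kappa> s * bessel_I (\<kappa> + 1) s + bessel_K (\<kappa> + 1) s * bessel_I \<kappa> s) = 1"
    unfolding bessel_K_nonint[OF k] bessel_K_nonint[OF nonint_add_one[OF k], unfolded eq] sin_add_one_pi
    using bessel_I_wronskian[of s \<kappa>] nz by (simp add: field_simps)
qed (intro tendsto_intros)+

lemma bessel_K_recurrence:
  "exp s * (bessel_K (\<nu> + 1) s - bessel_K (\<nu> - 1) s) = 2 * \<nu> * bessel_K \<nu> s"
proof (rule order_identity[where G="\<lambda>\<nu>. 2 * \<nu> * bessel_K \<nu> s" and \<nu>=\<nu> and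
      F="\<lambda>\<nu>. exp s * (bessel_K (\<nu> + 1) s - bessel_K (\<nu> - 1) s)"])
  fix \<kappa> :: complex assume k: "\<kappa> \<notin> \<int>"
  then have nz: "sin (\<kappa> * of_real pi) \<noteq> 0" by (simp add: sin_pi_eq_0_Ints)
  show "exp s * (bessel_K (\<kappa> + 1) s - bessel_K (\<kappa> - 1) s) = 2 * \<kappa> * bessel_K \<kappa> s"
  proof -
    have eq: "- (\<kappa> + 1) = - \<kappa> - 1" "- (\<kappa> - 1) = - \<kappa> + 1" by simp_all
    have "exp s * (bessel_K (\<kappa> + 1) s - bessel_K (\<kappa> - 1) s)
      = of_real (pi / 2) / sin (\<kappa> * of_real pi) *
         (exp s * (bessel_I (\<kappa> + 1) s - bessel_I (\<kappa> - 1) s) - exp s * (bessel_I (- \<kappa> - 1) s - bessel_I (- \<kappa> + 1) s))"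
      unfolding bessel_K_nonint[OF nonint_add_one[OF k], unfolded eq]
        bessel_K_nonint[OF nonint_diff_one[OF k], unfolded eq] sin_add_one_pi sin_diff_one_pi
      using nz by (simp add: field_simps)
    also have "exp s * (bessel_I (\<kappa> + 1) s - bessel_I (\<kappa> - 1) s) = - 2 * \<kappa> * bessel_I \<kappa> s"
      using bessel_I_recurrence[of s \<kappa>] by (simp add: algebra_simps)
    also note bessel_I_recurrence[of s "- \<kappa>"]
    finally show ?thesis
      unfolding bessel_K_nonint[OF k] using nz by (simp add: field_simps)
  qed
qed (intro tendsto_intros)+

lemma bessel_K_minus_order: "bessel_K (- \<nu>) s = bessel_K \<nu> s"
proof (rule order_identity[where F="\<lambda>\<nu>. bessel_K (- \<nu>) s" and G="\<lambda>\<nu>. bessel_K \<nu> s" and \<nu>=\<nu>])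
  fix \<kappa> :: complex assume k: "\<kappa> \<notin> \<int>"
  then have k': "- \<kappa> \<notin> \<int>" by simp
  show "bessel_K (- \<kappa>) s = bessel_K \<kappa> s"
    unfolding bessel_K_nonint[OF k] bessel_K_nonint[OF k'] using k sin_pi_eq_0_Ints[of \<kappa>] by (simp add: divide_simps algebra_simps)
qed (intro tendsto_intros)+

lemma bessel_K_deriv:
  assumes "\<nu> \<notin> \<int>"
  shows "(bessel_K \<nu> has_field_derivative \<nu> * bessel_K \<nu> s - exp s * bessel_K (\<nu> + 1) s) (at s)"
proof -
  note n = nonint_add_one[OF assms]
  have nz: "sin (\<nu> * of_real pi) \<noteq> 0" using assms by (simp add: sin_pi_eq_0_Ints)
  have "(bessel_K \<nu> has_field_derivative of_real (pi / 2) *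
      ((exp s * bessel_I (- \<nu> + 1) s + (- \<nu>) * bessel_I (- \<nu>) s)
      - (exp s * bessel_I (\<nu> + 1) s + \<nu> * bessel_I \<nu> s)) / sin (\<nu> * of_real pi)) (at s)"
    unfolding bessel_K_nonint[OF assms, abs_def]
    by (intro DERIV_cdivide DERIV_cmult DERIV_diff bessel_I_deriv)
  also have "of_real (pi / 2) *
      ((exp s * bessel_I (- \<nu> + 1) s + (- \<nu>) * bessel_I (- \<nu>) s)
      - (exp s * bessel_I (\<nu> + 1) s + \<nu> * bessel_I \<nu> s)) / sin (\<nu> * of_real pi)
    = \<nu> * bessel_K \<nu> s - exp s * bessel_K (\<nu> + 1) s"
  proof -
    have eq: "- (\<nu> + 1) = - \<nu> - 1" by simp
    have "exp s * bessel_I (- \<nu> + 1) s = exp s * bessel_I (- \<nu> - 1) s + 2 * \<nu> * bessel_I (- \<nu>) s"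
      using bessel_I_recurrence[of s "- \<nu>"] by (simp add: algebra_simps)
    then show ?thesis
      unfolding bessel_K_nonint[OF assms] bessel_K_nonint[OF n, unfolded eq] sin_add_one_pi
      using nz by (simp add: field_simps)
  qed
  finally show ?thesis .
qed

lemma bessel_K_Suc_deriv:
  assumes "\<nu> \<notin> \<int>"
  shows "(bessel_K (\<nu> + 1) has_field_derivative - exp s * bessel_K \<nu> s - (\<nu> + 1) * bessel_K (\<nu> + 1) s) (at s)"
proof -
  have "(\<nu> + 1) * bessel_K (\<nu> + 1) s - exp s * bessel_K (\<nu> + 1 + 1) s
     = - exp s * bessel_K \<nu> s - (\<nu> + 1) * bessel_K (\<nu> + 1) s"
    using bessel_K_recurrence[of s "\<nu> + 1"] by (simp add: algebra_simps)
  then show ?thesis using bessel_K_deriv[OF nonint_add_one[OF assms], of s] by (simp only:)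
qed

section \<open>The integral representation of the Macdonald function\<close>

text \<open>
  The classical integral over the real line for \<open>K\<^sub>\<nu>(z)\<close>, \<open>Re z > 0\<close>.  It exhibits the exponential
  decay of \<open>K\<^sub>\<nu>\<close>, which is invisible in the series.
\<close>

definition KI :: "complex \<Rightarrow> complex \<Rightarrow> complex" where
  "KI \<nu> z = (LINT t|lborel. exp (- z * of_real (cosh t) - \<nu> * of_real t)) / 2"

lemma integrable_exp_minus_abs: "integrable lborel (\<lambda>t::real. exp (- \<bar>t\<bar>))"
proof -
  have "(\<lambda>t::real. exp (- 1 * t)) absolutely_integrable_on {0..}"
    using has_integral_exp_minus_to_infinity[of 1 0]
    by (intro nonnegative_absolutely_integrable_1) (auto simp: integrable_on_def)
  then have "integrable lebesgue (\<lambda>t::real. indicator {0..} t * exp (- t))"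
    by (simp add: set_integrable_def)
  then have 1: "integrable lborel (\<lambda>t::real. indicator {0..} t * exp (- t))"
    by (subst (asm) integrable_completion) auto
  have 2: "integrable lborel (\<lambda>t::real. indicator {0..} (- t) * exp t)"
    using lborel_integrable_real_affine[OF 1, of "-1" 0] by simp
  show ?thesis
    by (rule Bochner_Integration.integrable_bound[OF Bochner_Integration.integrable_add[OF 1 2]])
       (auto simp: indicator_def)
qed

lemma cosh_ge_quadratic: "cosh t \<ge> 1 + t\<^sup>2 / 4" for t :: real
proof -
  have *: "cosh t \<ge> 1 + t\<^sup>2 / 4" if "t \<ge> 0" for t :: real
  proof -
    have "exp t \<ge> 1 + t + t\<^sup>2 / 2" using exp_lower_Taylor_quadratic[OF that] by simp
    moreover have "exp (- t) \<ge> 1 + (- t)" by (rule exp_ge_add_one_self)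
    ultimately show ?thesis by (simp add: cosh_field_def)
  qed
  show ?thesis using *[of t] *[of "- t"] by (cases "t \<ge> 0") auto
qed

text \<open>
  The inequality \<open>cosh t \<ge> 1 + t\<^sup>2/4\<close> provides the factor \<open>exp (- Re z)\<close> and a Gaussian, and the
  Gaussian absorbs both \<open>exp (b \<bar>t\<bar>)\<close> and the extra \<open>exp \<bar>t\<bar>\<close> that is kept for integrability.
\<close>

lemma KI_integrand_bound:
  assumes "0 < c" "c \<le> Re z" "\<bar>Re \<nu>\<bar> \<le> b"
  shows "norm (exp (- z * of_real (cosh t) - \<nu> * of_real t))
    \<le> exp (- Re z) * exp ((b + 1)\<^sup>2 / c) * exp (- \<bar>t\<bar>)"
proof -
  have 1: "Re z * cosh t \<ge> Re z + c * (t\<^sup>2 / 4)"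
  proof -
    have "Re z * cosh t \<ge> Re z * (1 + t\<^sup>2 / 4)"
      using assms cosh_ge_quadratic[of t] by (intro mult_left_mono) auto
    moreover have "Re z * (t\<^sup>2 / 4) \<ge> c * (t\<^sup>2 / 4)" using assms by (intro mult_right_mono) auto
    ultimately show ?thesis by (simp add: algebra_simps)
  qed
  have 2: "(b + 1) * \<bar>t\<bar> \<le> (b + 1)\<^sup>2 / c + c * (t\<^sup>2 / 4)"
  proof -
    have "0 \<le> (c * \<bar>t\<bar> / 2 - (b + 1))\<^sup>2" by simp
    then have "c * ((b + 1) * \<bar>t\<bar>) \<le> (b + 1)\<^sup>2 + c * (c * (t\<^sup>2 / 4))"
      by (simp add: power2_eq_square algebra_simps)
    then show ?thesis using assms by (simp add: field_simps)
  qed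
  have "- (Re \<nu> * t) \<le> \<bar>Re \<nu>\<bar> * \<bar>t\<bar>" by (metis abs_ge_minus_self abs_mult)
  also have "\<dots> \<le> b * \<bar>t\<bar>" using assms by (intro mult_right_mono) auto
  finally have 3: "- (Re \<nu> * t) \<le> b * \<bar>t\<bar>" .
  show ?thesis using 1 2 3 by (simp add: exp_add[symmetric] algebra_simps)
qed

lemma KI_integrand_measurable: "(\<lambda>t::real. exp (- z * of_real (cosh t) - \<nu> * of_real t :: complex)) \<in> borel_measurable borel"
  by (intro borel_measurable_continuous_onI continuous_intros)

lemma KI_integrable:
  assumes "0 < Re z"
  shows "integrable lborel (\<lambda>t. exp (- z * of_real (cosh t) - \<nu> * of_real t))"
proof (rule Bochner_Integration.integrable_bound)
  show "integrable lborel (\<lambda>t. exp (- Re z) * exp ((\<bar>Re \<nu>\<bar> + 1)\<^sup>2 / Re z) * exp (- \<bar>t\<bar>))"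
    by (intro integrable_mult_right integrable_exp_minus_abs)
  show "AE t in lborel. norm (exp (- z * of_real (cosh t) - \<nu> * of_real t)) \<le>
      norm (exp (- Re z) * exp ((\<bar>Re \<nu>\<bar> + 1)\<^sup>2 / Re z) * exp (- \<bar>t\<bar>))"
    using KI_integrand_bound[OF assms order_refl order_refl, where \<nu>=\<nu>] by (intro AE_I2) simp
qed (use KI_integrand_measurable in simp)

lemma KI_bound:
  assumes "0 < c"
  shows "\<exists>C>0. \<forall>z \<nu>. c \<le> Re z \<longrightarrow> \<bar>Re \<nu>\<bar> \<le> b \<longrightarrow> norm (KI \<nu> z) \<le> C * exp (- Re z)"
proof -
  let ?E = "LINT t|lborel. exp (- \<bar>t::real\<bar>)"
  have "norm (KI \<nu> z) \<le> (exp ((b + 1)\<^sup>2 / c) * (1 + ?E)) * exp (- Re z)" if "c \<le> Re z" "\<bar>Re \<nu>\<bar> \<le> b" for z \<nu>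
  proof -
    have "norm (LINT t|lborel. exp (- z * of_real (cosh t) - \<nu> * of_real t))
       \<le> (LINT t|lborel. norm (exp (- z * of_real (cosh t) - \<nu> * of_real t)))"
      by (rule integral_norm_bound)
    also have "\<dots> \<le> (LINT t|lborel. exp (- Re z) * exp ((b + 1)\<^sup>2 / c) * exp (- \<bar>t\<bar>))"
      using assms that
      by (intro integral_mono integrable_norm KI_integrable integrable_mult_right integrable_exp_minus_abs
          KI_integrand_bound) auto
    also have "\<dots> = exp (- Re z) * exp ((b + 1)\<^sup>2 / c) * ?E" by simp
    finally have "norm (KI \<nu> z) \<le> exp (- Re z) * exp ((b + 1)\<^sup>2 / c) * ?E / 2"
      by (simp add: KI_def norm_divide)
    also have "\<dots> \<le> exp (- Re z) * exp ((b + 1)\<^sup>2 / c) * (1 + ?E)"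
      using integral_nonneg_AE[where M=lborel and f="\<lambda>t. exp (- \<bar>t::real\<bar>)"]
      by (simp add: field_simps)
    finally show ?thesis by (simp add: mult_ac)
  qed
  moreover have "exp ((b + 1)\<^sup>2 / c) * (1 + ?E) > 0"
    using integral_nonneg_AE[where M=lborel and f="\<lambda>t. exp (- \<bar>t::real\<bar>)"] by (intro mult_pos_pos add_pos_nonneg) auto
  ultimately show ?thesis by blast
qed

lemma KI_minus_order: "KI (- \<nu>) z = KI \<nu> z"
  unfolding KI_def by (subst lborel_integral_real_affine[of "-1" _ 0]) auto

lemma exp_minus_abs_at_top: "((\<lambda>t::real. C * exp (- \<bar>t\<bar>)) \<longlongrightarrow> 0) at_top"
  by (intro tendsto_mult_right_zero filterlim_compose[OF exp_at_bot]
      filterlim_compose[OF filterlim_uminus_at_bot_at_top] filterlim_abs_real)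

lemma exp_minus_abs_at_bot: "((\<lambda>t::real. C * exp (- \<bar>t\<bar>)) \<longlongrightarrow> 0) at_bot"
  using exp_minus_abs_at_top[of C] by (simp add: filterlim_at_bot_mirror)

lemma integral_derivative_eq_0:
  fixes f F :: "real \<Rightarrow> complex"
  assumes "\<And>t. (F has_vector_derivative f t) (at t)" "\<And>t. isCont f t" "integrable lborel f"
    and F: "\<And>t. norm (F t) \<le> C * exp (- \<bar>t\<bar>)"
  shows "(LINT t|lborel. f t) = 0"
proof -
  have "(F \<longlongrightarrow> 0) at_top"
    by (rule Lim_null_comparison[OF _ exp_minus_abs_at_top[of C]]) (use F in auto)
  moreover have "(F \<longlongrightarrow> 0) at_bot"
    by (rule Lim_null_comparison[OF _ exp_minus_abs_at_bot[of C]]) (use F in auto)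
  ultimately have "(LBINT x=-\<infinity>..\<infinity>. f x) = 0 - 0"
    using assms by (intro interval_integral_FTC_integrable)
      (auto simp: set_integrable_def ereal_tendsto_simps)
  then show ?thesis
    by (simp add: interval_lebesgue_integral_def set_lebesgue_integral_def)
qed

text \<open>
  Integrating the derivative of \<open>exp (- z cosh t - \<nu> t)\<close> over the real line gives \<open>0\<close>.
\<close>

lemma KI_recurrence:
  assumes "0 < Re z"
  shows "z * (KI (\<nu> + 1) z - KI (\<nu> - 1) z) = 2 * \<nu> * KI \<nu> z"
proof -
  let ?F = "\<lambda>\<nu> t. exp (- z * of_real (cosh t) - \<nu> * of_real t)"
  let ?f = "\<lambda>t. (- z * of_real (sinh t) - \<nu>) * ?F \<nu> t"
  have eq: "2 * ?f t = z * (?F (\<nu> + 1) t - ?F (\<nu> - 1) t) - 2 * \<nu> * ?F \<nu> t" for t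
  proof -
    have "- z * of_real (cosh t) - (\<nu> + 1) * of_real t = (- z * of_real (cosh t) - \<nu> * of_real t) + of_real (- t)"
      "- z * of_real (cosh t) - (\<nu> - 1) * of_real t = (- z * of_real (cosh t) - \<nu> * of_real t) + of_real t"
      by (simp_all add: algebra_simps)
    then have F: "?F (\<nu> + 1) t = ?F \<nu> t * of_real (exp (- t))" "?F (\<nu> - 1) t = ?F \<nu> t * of_real (exp t)"
      by (simp_all only: exp_add exp_of_real)
    have S: "of_real (sinh t) = (of_real (exp t) - of_real (exp (- t))) / (2 :: complex)"
      by (simp add: sinh_field_def)
    show ?thesis unfolding F S by (simp add: field_simps)
  qed
  have int: "integrable lborel (\<lambda>t. z * (?F (\<nu> + 1) t - ?F (\<nu> - 1) t) - 2 * \<nu> * ?F \<nu> t)"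
    by (intro Bochner_Integration.integrable_diff integrable_mult_right KI_integrable assms)
  have "(LINT t|lborel. 2 * ?f t) = 0"
  proof (rule integral_derivative_eq_0[where F="\<lambda>t. 2 * ?F \<nu> t"])
    show "((\<lambda>t. 2 * ?F \<nu> t) has_vector_derivative 2 * ?f t) (at t)" for t
    proof -
      have "(cosh has_real_derivative sinh t) (at t)" by (auto intro!: derivative_eq_intros)
      then have "((\<lambda>t. of_real (cosh t) :: complex) has_vector_derivative of_real (sinh t)) (at t)"
        by (rule has_vector_derivative_of_real)
      then have "((\<lambda>t. - z * of_real (cosh t) - \<nu> * of_real t) has_vector_derivative (- z * of_real (sinh t) - \<nu>)) (at t)"
        by (auto intro!: derivative_eq_intros)
      then have "(exp \<circ> (\<lambda>t. - z * of_real (cosh t) - \<nu> * of_real t) has_vector_derivative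
          (- z * of_real (sinh t) - \<nu>) * ?F \<nu> t) (at t)"
        by (rule field_vector_diff_chain_at) (rule DERIV_exp)
      then show ?thesis by (auto intro!: derivative_eq_intros simp: o_def)
    qed
    show "norm (2 * ?F \<nu> t) \<le> (2 * (exp (- Re z) * exp ((\<bar>Re \<nu>\<bar> + 1)\<^sup>2 / Re z))) * exp (- \<bar>t\<bar>)" for t
      using KI_integrand_bound[OF assms order_refl order_refl, where \<nu>=\<nu> and t=t] by (simp add: norm_mult)
    have "continuous_on UNIV (\<lambda>t. 2 * ?f t)" by (intro continuous_intros)
    then show "isCont (\<lambda>t. 2 * ?f t) t" for t by (simp add: continuous_on_eq_continuous_at)
    show "integrable lborel (\<lambda>t. 2 * ?f t)" unfolding eq by (rule int)
  qed
  then have "(LINT t|lborel. z * (?F (\<nu> + 1) t - ?F (\<nu> - 1) t) - 2 * \<nu> * ?F \<nu> t) = 0"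
    unfolding eq .
  moreover have "(LINT t|lborel. z * (?F (\<nu> + 1) t - ?F (\<nu> - 1) t) - 2 * \<nu> * ?F \<nu> t)
    = (LINT t|lborel. z * (?F (\<nu> + 1) t - ?F (\<nu> - 1) t)) - (LINT t|lborel. 2 * \<nu> * ?F \<nu> t)"
    by (intro Bochner_Integration.integral_diff Bochner_Integration.integrable_diff integrable_mult_right
        KI_integrable assms)
  moreover have "(LINT t|lborel. z * (?F (\<nu> + 1) t - ?F (\<nu> - 1) t)) = z * (2 * KI (\<nu> + 1) z - 2 * KI (\<nu> - 1) z)"
    unfolding KI_def integral_mult_right_zero
    by (subst Bochner_Integration.integral_diff[OF KI_integrable[OF assms] KI_integrable[OF assms]]) simp
  moreover have "(LINT t|lborel. 2 * \<nu> * ?F \<nu> t) = 2 * \<nu> * (2 * KI \<nu> z)"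
    unfolding KI_def integral_mult_right_zero by simp
  ultimately have "2 * (z * (KI (\<nu> + 1) z - KI (\<nu> - 1) z)) = 2 * (2 * \<nu> * KI \<nu> z)"
    by (simp only: algebra_simps) (simp add: algebra_simps)
  then show ?thesis by simp
qed

text \<open>
  The integrals over \<open>[-n, n]\<close> are holomorphic and converge locally uniformly.
\<close>

lemma KI_holomorphic: "KI \<nu> holomorphic_on {z. 0 < Re z}"
proof (rule holomorphic_uniform_sequence)
  let ?F = "\<lambda>z t. exp (- z * of_real (cosh t) - \<nu> * of_real t) :: complex"
  let ?f = "\<lambda>n z. integral (cbox (- real n) (real n)) (?F z) / 2"
  show "?f n holomorphic_on {z. 0 < Re z}" for n
    by (intro holomorphic_on_divide leibniz_rule_holomorphic[where fx="\<lambda>z t. ?F z t * (- of_real (cosh t))"])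
       (auto intro!: derivative_eq_intros integrable_continuous_interval continuous_intros
         simp: convex_halfspace_Re_gt split_beta)
  fix z0 :: complex assume z0: "z0 \<in> {z. 0 < Re z}"
  define c where "c = Re z0 / 2"
  have c: "c > 0" using z0 by (simp add: c_def)
  have Re: "c \<le> Re z" if "z \<in> cball z0 c" for z
    using that abs_Re_le_cmod[of "z0 - z"] by (simp add: c_def dist_norm)
  define M where "M = exp ((\<bar>Re \<nu>\<bar> + 1)\<^sup>2 / c)"
  define e where "e n = (LINT t|lborel. indicat_real (- {- real n..real n}) t * (M * exp (- \<bar>t\<bar>)))" for n
  have e0: "e \<longlonglongrightarrow> 0"
  proof -
    have "e \<longlonglongrightarrow> (LINT t::real|lborel. (0::real))" unfolding e_def
    proof (rule integral_dominated_convergence[where w="\<lambda>t. M * exp (- \<bar>t\<bar>)"])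
      show "AE t in lborel. (\<lambda>n. indicat_real (- {- real n..real n}) t * (M * exp (- \<bar>t\<bar>))) \<longlonglongrightarrow> 0"
      proof (rule AE_I2)
        fix t :: real
        have "\<forall>\<^sub>F n in sequentially. \<bar>t\<bar> \<le> real n"
          using filterlim_real_sequentially unfolding filterlim_at_top by auto
        then have "\<forall>\<^sub>F n in sequentially. indicat_real (- {- real n..real n}) t * (M * exp (- \<bar>t\<bar>)) = 0"
          by eventually_elim (auto simp: indicator_def)
        then show "(\<lambda>n. indicat_real (- {- real n..real n}) t * (M * exp (- \<bar>t\<bar>))) \<longlonglongrightarrow> 0"
          by (rule tendsto_eventually)
      qed
      show "integrable lborel (\<lambda>t. M * exp (- \<bar>t\<bar>))"
        by (intro integrable_mult_right integrable_exp_minus_abs)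
    qed (auto simp: indicator_def M_def)
    then show ?thesis by simp
  qed
  have diff: "dist (?f n z) (KI \<nu> z) \<le> e n" if "z \<in> cball z0 c" for z n
  proof -
    have z: "0 < Re z" using Re[OF that] c by simp
    let ?A = "{- real n..real n}"
    have si: "set_integrable lborel ?A (?F z)"
      unfolding set_integrable_def by (intro integrable_mult_indicator KI_integrable z) auto
    have "integral (cbox (- real n) (real n)) (?F z) = (LINT t:?A|lborel. ?F z t)"
      using set_borel_integral_eq_integral(2)[OF si] by simp
    then have "KI \<nu> z - ?f n z = ((LINT t|lborel. ?F z t) - (LINT t|lborel. indicator ?A t *\<^sub>R ?F z t)) / 2"
      by (simp add: KI_def set_lebesgue_integral_def diff_divide_distrib)
    also have "\<dots> = (LINT t|lborel. ?F z t - indicator ?A t *\<^sub>R ?F z t) / 2"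
      by (subst Bochner_Integration.integral_diff[OF KI_integrable[OF z] si[unfolded set_integrable_def]]) (rule refl)
    finally have "norm (KI \<nu> z - ?f n z) \<le> norm (LINT t|lborel. ?F z t - indicator ?A t *\<^sub>R ?F z t)"
      by (simp only: norm_divide) simp
    also have "\<dots> \<le> (LINT t|lborel. norm (?F z t - indicator ?A t *\<^sub>R ?F z t))"
      by (rule integral_norm_bound)
    also have "\<dots> \<le> e n" unfolding e_def
    proof (rule integral_mono)
      show "integrable lborel (\<lambda>t. norm (?F z t - indicator ?A t *\<^sub>R ?F z t))"
        by (intro integrable_norm Bochner_Integration.integrable_diff KI_integrable[OF z] si[unfolded set_integrable_def])
      have "integrable lborel (\<lambda>t. indicat_real (- ?A) t *\<^sub>R (M * exp (- \<bar>t\<bar>)))"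
        by (intro integrable_mult_indicator integrable_mult_right integrable_exp_minus_abs) auto
      then show "integrable lborel (\<lambda>t. indicat_real (- ?A) t * (M * exp (- \<bar>t\<bar>)))" by simp
      fix t
      have "norm (?F z t) \<le> exp (- Re z) * M * exp (- \<bar>t\<bar>)"
        unfolding M_def by (rule KI_integrand_bound[OF c Re[OF that]]) simp
      also have "\<dots> \<le> 1 * M * exp (- \<bar>t\<bar>)" using z by (intro mult_right_mono) (auto simp: M_def)
      finally show "norm (?F z t - indicator ?A t *\<^sub>R ?F z t) \<le> indicat_real (- ?A) t * (M * exp (- \<bar>t\<bar>))"
        by (auto simp: indicator_def)
    qed
    finally show ?thesis by (simp add: dist_norm norm_minus_commute)
  qed
  have "uniform_limit (cball z0 c) ?f (KI \<nu>) sequentially"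
  proof (rule uniform_limitI)
    fix r :: real assume "r > 0"
    then have "\<forall>\<^sub>F n in sequentially. e n < r" using order_tendstoD(2)[OF e0] by auto
    then show "\<forall>\<^sub>F n in sequentially. \<forall>z\<in>cball z0 c. dist (?f n z) (KI \<nu> z) < r"
      by eventually_elim (blast intro: le_less_trans diff)
  qed
  then show "\<exists>d>0. cball z0 d \<subseteq> {z. 0 < Re z} \<and> uniform_limit (cball z0 d) ?f (KI \<nu>) sequentially"
    using c Re by (intro exI[of _ c]) force
qed (auto simp: open_halfspace_Re_gt)

section \<open>Identification of the integral with the Macdonald function\<close>

text \<open>
  The quantity \<open>x (KI\<^sub>\<nu> I\<^sub>\<nu>\<^sub>+\<^sub>1 + KI\<^sub>\<nu>\<^sub>+\<^sub>1 I\<^sub>\<nu>)\<close> has period \<open>1\<close> in \<open>\<nu>\<close>, because \<open>KI\<close> and \<open>I\<close> satisfy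
  the same recurrence up to sign.  For real \<open>x\<close> it tends to \<open>1\<close> along \<open>\<nu> + n\<close>, where both
  factors are governed by the Gamma function; hence it equals \<open>1\<close>.  As \<open>KI\<close> is even in the order,
  the same relation at \<open>- \<nu> - 1\<close> is a second linear equation for \<open>KI\<^sub>\<nu>\<close> and \<open>KI\<^sub>\<nu>\<^sub>+\<^sub>1\<close>, and for
  non-integer \<open>\<nu>\<close> the two equations determine \<open>KI\<^sub>\<nu>\<close>.
\<close>

lemma Gamma_mult_Phi_bound:
  assumes "Re a \<ge> 0"
  shows "norm (Gamma (a + 1) * Phi a y - 1) \<le> exp (norm y) / norm (a + 1)"
proof -
  have na: "norm (a + of_nat (Suc k)) \<ge> 1" for k
    using complex_Re_le_cmod[of "a + of_nat (Suc k)"] assms by simp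
  have nz: "rGamma (a + 1) \<noteq> 0" "Gamma (a + 1) * rGamma (a + 1) = 1"
  proof -
    have "a + 1 \<notin> \<int>\<^sub>\<le>\<^sub>0" using assms by (auto elim!: nonpos_Ints_cases simp: complex_eq_iff)
    then show "rGamma (a + 1) \<noteq> 0" "Gamma (a + 1) * rGamma (a + 1) = 1"
      by (auto simp: rGamma_eq_zero_iff Gamma_def)
  qed
  have co: "norm (Gamma (a + 1) * rGamma (a + of_nat (Suc k) + 1)) \<le> 1 / norm (a + 1)" for k
  proof (induction k)
    case 0
    have "Gamma (a + 1) * ((a + 1) * rGamma (a + 1 + 1)) = 1" unfolding rGamma_plus1 by (rule nz)
    then have "Gamma (a + 1) * rGamma (a + 1 + 1) * (a + 1) = 1" by (simp only: mult_ac)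
    then have "norm (Gamma (a + 1) * rGamma (a + 1 + 1)) * norm (a + 1) = 1"
      by (metis norm_mult norm_one)
    moreover have "norm (a + 1) \<noteq> 0" using na[of 0] by auto
    ultimately have "norm (Gamma (a + 1) * rGamma (a + 1 + 1)) = 1 / norm (a + 1)"
      by (intro eq_divide_imp)
    then show ?case by (simp only: of_nat_Suc of_nat_0 add_0_right order_refl)
  next
    case (Suc k)
    let ?w = "a + of_nat (Suc k) + 1"
    have w: "norm ?w \<ge> 1" using na[of "Suc k"] by (simp add: add_ac)
    have "?w * rGamma (?w + 1) = rGamma ?w" by (rule rGamma_plus1)
    then have "norm (Gamma (a + 1) * rGamma ?w) = norm (Gamma (a + 1) * rGamma (?w + 1)) * norm ?w"
      by (metis norm_mult mult.commute mult.assoc)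
    moreover have "norm (Gamma (a + 1) * rGamma (?w + 1)) * 1 \<le> norm (Gamma (a + 1) * rGamma (?w + 1)) * norm ?w"
      by (intro mult_left_mono w) simp
    ultimately have "norm (Gamma (a + 1) * rGamma (?w + 1)) \<le> 1 / norm (a + 1)" using Suc by linarith
    moreover have "?w + 1 = a + of_nat (Suc (Suc k)) + 1" by simp
    ultimately show ?case by (simp only:)
  qed
  let ?f = "\<lambda>k. Gamma (a + 1) * (rGamma (a + of_nat k + 1) / fact k * y ^ k)"
  have s: "?f sums (Gamma (a + 1) * Phi a y)" by (intro sums_mult sums_Phi)
  have "?f 0 = 1" using nz by simp
  with s have s': "(\<lambda>k. ?f (Suc k)) sums (Gamma (a + 1) * Phi a y - 1)"
    using sums_Suc_iff[of ?f "Gamma (a + 1) * Phi a y - 1"] by (simp only: diff_add_cancel)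
  have se: "(\<lambda>k. norm y ^ Suc k / fact (Suc k)) sums (exp (norm y) - 1)"
    using exp_converges[of "norm y"] sums_Suc_iff[of "\<lambda>k. norm y ^ k / fact k" "exp (norm y) - 1"]
    by (simp add: field_simps)
  have "norm (Gamma (a + 1) * Phi a y - 1) = norm (\<Sum>k. ?f (Suc k))" using s' by (simp add: sums_iff)
  also have "\<dots> \<le> (\<Sum>k. 1 / norm (a + 1) * (norm y ^ Suc k / fact (Suc k)))"
  proof (rule norm_suminf_le)
    show "summable (\<lambda>k. 1 / norm (a + 1) * (norm y ^ Suc k / fact (Suc k)))"
      by (intro summable_mult sums_summable[OF se])
    fix k
    have "norm (?f (Suc k)) = norm (Gamma (a + 1) * rGamma (a + of_nat (Suc k) + 1)) * (norm y ^ Suc k / fact (Suc k))"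
      by (simp only: norm_mult norm_divide norm_power norm_fact) (simp add: field_simps)
    also have "\<dots> \<le> 1 / norm (a + 1) * (norm y ^ Suc k / fact (Suc k))"
      by (intro mult_right_mono co) simp
    finally show "norm (?f (Suc k)) \<le> 1 / norm (a + 1) * (norm y ^ Suc k / fact (Suc k))" .
  qed
  also have "\<dots> = 1 / norm (a + 1) * (exp (norm y) - 1)"
    using sums_mult[OF se, of "1 / norm (a + 1)"] by (simp only: sums_iff)
  also have "\<dots> \<le> exp (norm y) / norm (a + 1)" by (simp add: divide_right_mono)
  finally show ?thesis .
qed

text \<open>
  Each step to the right multiplies \<open>\<bar>\<Gamma>(a + k)\<bar>\<close> by \<open>\<bar>a + k\<bar> \<ge> Re a + k\<close>, the factor gained by the real
  Gamma function.  So large complex orders can be compared with real ones.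
\<close>

lemma norm_Gamma_ratio:
  fixes a :: complex
  assumes "Re a > 0"
  shows "norm (Gamma (a + of_nat n)) * Gamma (Re a) \<ge> norm (Gamma a) * Gamma (Re a + real n)"
proof (induction n)
  case (Suc n)
  let ?w = "a + of_nat n"
  have "?w \<noteq> 0" "Re a + real n \<noteq> 0" using assms by (auto simp: complex_eq_iff)
  have "?w \<notin> \<int>\<^sub>\<le>\<^sub>0" using assms by (auto elim!: nonpos_Ints_cases simp: complex_eq_iff)
  then have 1: "Gamma (a + of_nat (Suc n)) = ?w * Gamma ?w"
    using Gamma_plus1[of ?w] \<open>?w \<noteq> 0\<close> by (simp add: add_ac)
  have "Re a + real n \<notin> \<int>\<^sub>\<le>\<^sub>0" using assms by (auto elim!: nonpos_Ints_cases)
  then have 2: "Gamma (Re a + real (Suc n)) = (Re a + real n) * Gamma (Re a + real n)"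
    using Gamma_plus1[of "Re a + real n"] by (simp add: add_ac)
  have 3: "Re a + real n \<le> norm ?w" using complex_Re_le_cmod[of ?w] by simp
  have "norm (Gamma a) * Gamma (Re a + real (Suc n)) = (Re a + real n) * (norm (Gamma a) * Gamma (Re a + real n))"
    by (simp only: 2 mult_ac)
  also have "\<dots> \<le> (Re a + real n) * (norm (Gamma ?w) * Gamma (Re a))"
    using Suc assms by (intro mult_left_mono) auto
  also have "\<dots> \<le> norm ?w * (norm (Gamma ?w) * Gamma (Re a))"
    using assms 3 by (intro mult_right_mono mult_nonneg_nonneg) (auto intro: less_imp_le Gamma_real_pos)
  also have "\<dots> = norm (Gamma (a + of_nat (Suc n))) * Gamma (Re a)" by (simp only: 1 norm_mult mult.assoc)
  finally show ?case .
qed simp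

text \<open>
  Euler's integral after the substitution \<open>exp t\<close>, which puts it on the real line next to \<open>KI\<close>.
\<close>

lemma Gamma_exp_integral:
  assumes "Re a > 0"
  shows "integrable lborel (\<lambda>t. exp (a * of_real t - of_real (exp t)))"
    and "(LINT t|lborel. exp (a * of_real t - of_real (exp t))) = Gamma a"
proof -
  let ?f = "\<lambda>t. complex_of_real t powr (a - 1) / of_real (exp t)"
  have *: "\<bar>exp t\<bar> *\<^sub>R ?f (exp t) = exp (a * of_real t - of_real (exp t))" for t :: real
  proof -
    have "complex_of_real (exp t) powr (a - 1) = exp ((a - 1) * of_real t)"
      by (simp add: powr_def Ln_of_real)
    moreover have "complex_of_real (exp (exp t)) = exp (of_real (exp t))" by (simp add: exp_of_real)
    moreover have "complex_of_real (exp t) = exp (of_real t)" by (simp add: exp_of_real)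
    ultimately have "\<bar>exp t\<bar> *\<^sub>R ?f (exp t) = exp (of_real t) * (exp ((a - 1) * of_real t) / exp (exp (of_real t)))"
      by (simp add: scaleR_conv_of_real)
    also have "\<dots> = exp (a * of_real t - exp (of_real t))"
      by (simp add: exp_add[symmetric] exp_diff[symmetric] algebra_simps)
    finally show ?thesis by (simp add: exp_of_real)
  qed
  have abs: "?f absolutely_integrable_on {0<..}" and int: "(?f has_integral Gamma a) {0<..}"
    using absolutely_integrable_Gamma_integral'[OF assms] Gamma_integral_complex'[OF assms] by auto
  have rng: "range (exp :: real \<Rightarrow> real) = {0<..}"
    by (auto simp: image_iff intro: exp_ln[symmetric])
  have P: "(\<lambda>t. P (exp (a * of_real t - of_real (exp t)))) absolutely_integrable_on UNIV \<and>
      integral UNIV (\<lambda>t. P (exp (a * of_real t - of_real (exp t)))) = P (Gamma a)"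
    if "P = Re \<or> P = Im" for P
  proof -
    have bl: "bounded_linear P" using that bounded_linear_Re bounded_linear_Im by auto
    have "(\<lambda>t. P (?f t)) absolutely_integrable_on {0<..}"
      using absolutely_integrable_linear[OF abs bl] by (simp add: o_def)
    moreover have "integral {0<..} (\<lambda>t. P (?f t)) = P (Gamma a)"
      using has_integral_linear[OF int bl] by (simp add: o_def integral_unique)
    ultimately have "(\<lambda>t. \<bar>exp t\<bar> * P (?f (exp t))) absolutely_integrable_on UNIV \<and>
        integral UNIV (\<lambda>t. \<bar>exp t\<bar> * P (?f (exp t))) = P (Gamma a)"
      by (subst has_absolute_integral_change_of_variables_1'[where g=exp and f="\<lambda>t. P (?f t)"])
         (auto simp: rng inj_on_def intro!: derivative_eq_intros)
    moreover have "\<bar>exp t\<bar> * P (?f (exp t)) = P (exp (a * of_real t - of_real (exp t)))" for t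
      using that unfolding *[symmetric] by auto
    ultimately show ?thesis by simp
  qed
  have meas: "(\<lambda>t::real. exp (a * of_real t - of_real (exp t)) :: complex) \<in> borel_measurable borel"
    by (intro borel_measurable_continuous_onI continuous_intros)
  have "integrable lborel (\<lambda>t. P (exp (a * of_real t - of_real (exp t)))) \<and>
      (LINT t|lborel. P (exp (a * of_real t - of_real (exp t)))) = P (Gamma a)"
    if "P = Re \<or> P = Im" for P
  proof -
    have m: "(\<lambda>t::real. P (exp (a * of_real t - of_real (exp t)))) \<in> borel_measurable borel"
      using that meas by auto
    have i: "integrable lborel (\<lambda>t. P (exp (a * of_real t - of_real (exp t))))"
      using P[OF that] m by (auto simp: set_integrable_def integrable_completion)
    then show ?thesis using P[OF that] integral_lborel[OF i] by simp
  qed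
  note PI = this
  show I: "integrable lborel (\<lambda>t. exp (a * of_real t - of_real (exp t)))"
  proof -
    let ?h = "\<lambda>t. exp (a * of_real t - of_real (exp t)) :: complex"
    have "integrable lborel (\<lambda>t. of_real (Re (?h t)) + \<i> * of_real (Im (?h t)))"
      using PI[of Re] PI[of Im]
      by (intro Bochner_Integration.integrable_add integrable_mult_right) (auto simp: complex_of_real_integrable_eq)
    then show ?thesis by (simp add: complex_eq[symmetric])
  qed
  show "(LINT t|lborel. exp (a * of_real t - of_real (exp t))) = Gamma a"
    using PI[of Re] PI[of Im] I by (simp add: complex_eq_iff integral_Re integral_Im)
qed

text \<open>
  Up to an elementary factor, the integral behind \<open>KI\<close> for real \<open>x\<close>, translated by \<open>ln (x/2)\<close>, with \<open>y = x\<^sup>2/4\<close>.  At \<open>y = 0\<close> it is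
  \<open>\<Gamma>(a)\<close>.
\<close>

definition GI :: "real \<Rightarrow> complex \<Rightarrow> complex" where
  "GI y a = (LINT t|lborel. exp (a * of_real t - of_real (exp t) - of_real (y * exp (- t))))"

lemma KI_eq_GI:
  assumes "0 < x"
  shows "2 * KI a (of_real x) = exp (- a * of_real (ln (x / 2))) * GI (x\<^sup>2 / 4) a"
proof -
  have "2 * KI a (of_real x) = 2 * KI (- a) (of_real x)" by (simp add: KI_minus_order)
  also have "\<dots> = (LINT t|lborel. exp (- of_real x * of_real (cosh (- ln (x / 2) + t)) + a * of_real (- ln (x / 2) + t)))"
    unfolding KI_def by (subst lborel_integral_real_affine[of 1 _ "- ln (x / 2)"]) auto
  also have "\<dots> = (LINT t|lborel. exp (- a * of_real (ln (x / 2))) *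
      exp (a * of_real t - of_real (exp t) - of_real (x\<^sup>2 / 4 * exp (- t))))"
  proof (rule Bochner_Integration.integral_cong[OF refl])
    fix t :: real
    have "x * cosh (- ln (x / 2) + t) = exp t + x\<^sup>2 / 4 * exp (- t)"
      using assms by (simp add: cosh_field_def exp_add exp_diff exp_minus field_simps power2_eq_square)
    then have "of_real x * of_real (cosh (- ln (x / 2) + t)) = (of_real (exp t) + of_real (x\<^sup>2 / 4 * exp (- t)) :: complex)"
      by (metis of_real_mult of_real_add)
    then show "exp (- of_real x * of_real (cosh (- ln (x / 2) + t)) + a * of_real (- ln (x / 2) + t))
      = exp (- a * of_real (ln (x / 2))) * exp (a * of_real t - of_real (exp t) - of_real (x\<^sup>2 / 4 * exp (- t)))"
      by (simp add: exp_add[symmetric] algebra_simps)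
  qed
  also have "\<dots> = exp (- a * of_real (ln (x / 2))) * GI (x\<^sup>2 / 4) a"
    unfolding GI_def by simp
  finally show ?thesis .
qed

text \<open>
  By \<open>1 - exp (- w) \<le> w\<close> the difference is dominated by the integral with the order lowered by one.
\<close>

lemma GI_minus_Gamma:
  assumes "Re a > 1" "y \<ge> 0"
  shows "norm (GI y a - Gamma a) \<le> y * Gamma (Re a - 1)"
proof -
  let ?g = "\<lambda>a t. exp (a * of_real t - of_real (exp t)) :: complex"
  let ?d = "\<lambda>t. exp (a * of_real t - of_real (exp t) - of_real (y * exp (- t))) :: complex"
  have a: "Re a > 0" using assms by simp
  note G = Gamma_exp_integral[OF a]
  have dg: "?d t = ?g a t * of_real (exp (- (y * exp (- t))))" for t
    by (simp add: exp_of_real[symmetric] exp_add[symmetric])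
  have int_d: "integrable lborel ?d"
  proof (rule Bochner_Integration.integrable_bound[OF G(1)])
    have "?d \<in> borel_measurable borel"
      by (intro borel_measurable_continuous_onI continuous_intros)
    then show "?d \<in> borel_measurable lborel" by simp
    show "AE t in lborel. norm (?d t) \<le> norm (?g a t)"
      using assms by (intro AE_I2) simp
  qed
  have m1: "Re (of_real (Re a - 1)) > 0" using assms by simp
  have nm: "norm (?g (of_real (Re a - 1)) t) = exp ((Re a - 1) * t - exp t)" for t by simp
  have int_m: "integrable lborel (\<lambda>t. exp ((Re a - 1) * t - exp t))"
    using integrable_norm[OF Gamma_exp_integral(1)[OF m1]] unfolding nm .
  have val_m: "(LINT t|lborel. exp ((Re a - 1) * t - exp t)) = Gamma (Re a - 1)"
  proof -
    have "complex_of_real (LINT t|lborel. exp ((Re a - 1) * t - exp t)) = (LINT t|lborel. of_real (exp ((Re a - 1) * t - exp t)))"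
      by (rule integral_complex_of_real[symmetric])
    also have "\<dots> = (LINT t|lborel. ?g (of_real (Re a - 1)) t)"
      by (simp add: exp_of_real[symmetric])
    also have "\<dots> = Gamma (of_real (Re a - 1))" by (rule Gamma_exp_integral(2)[OF m1])
    also have "\<dots> = of_real (Gamma (Re a - 1))" by (rule Gamma_complex_of_real)
    finally show ?thesis by (simp only: of_real_eq_iff)
  qed
  have "GI y a - Gamma a = (LINT t|lborel. ?d t - ?g a t)"
    unfolding GI_def G(2)[symmetric] by (intro Bochner_Integration.integral_diff[symmetric] int_d G(1))
  then have "norm (GI y a - Gamma a) \<le> (LINT t|lborel. norm (?d t - ?g a t))"
    by (simp only: integral_norm_bound)
  also have "\<dots> \<le> (LINT t|lborel. y * exp ((Re a - 1) * t - exp t))"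
  proof (rule integral_mono)
    show "integrable lborel (\<lambda>t. norm (?d t - ?g a t))"
      by (intro integrable_norm Bochner_Integration.integrable_diff int_d G(1))
    show "integrable lborel (\<lambda>t. y * exp ((Re a - 1) * t - exp t))" by (intro integrable_mult_right int_m)
    fix t :: real
    have "?d t - ?g a t = ?g a t * of_real (exp (- (y * exp (- t))) - 1)"
      unfolding dg by (simp add: algebra_simps)
    then have "norm (?d t - ?g a t) = exp (Re a * t - exp t) * \<bar>exp (- (y * exp (- t))) - 1\<bar>"
      by (simp add: norm_mult del: of_real_diff of_real_1)
    also have "\<bar>exp (- (y * exp (- t))) - 1\<bar> \<le> y * exp (- t)"
      using exp_ge_add_one_self[of "- (y * exp (- t))"] assms by simp
    finally have "norm (?d t - ?g a t) \<le> exp (Re a * t - exp t) * (y * exp (- t))" by simp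
    also have "\<dots> = y * exp ((Re a - 1) * t - exp t)"
    proof -
      have "(Re a - 1) * t - exp t = (Re a * t - exp t) + - t" by (simp add: algebra_simps)
      then show ?thesis by (simp only: exp_add)  (simp add: mult_ac)
    qed
    finally show "norm (?d t - ?g a t) \<le> y * exp ((Re a - 1) * t - exp t)" .
  qed
  also have "\<dots> = y * Gamma (Re a - 1)" using val_m by simp
  finally show ?thesis .
qed

lemma Gamma_notin: "Re a > 0 \<Longrightarrow> (a::complex) \<notin> \<int>\<^sub>\<le>\<^sub>0"
  by (auto elim!: nonpos_Ints_cases simp: complex_eq_iff)

lemma GI_over_Gamma:
  assumes "Re a > 1" "y \<ge> 0"
  shows "(\<lambda>n. GI y (a + of_nat n) / Gamma (a + of_nat n)) \<longlonglongrightarrow> 1"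
proof -
  define c where "c = y * (Gamma (Re a) / norm (Gamma a))"
  have Ga: "norm (Gamma a) > 0" using Gamma_notin[of a] assms by (simp add: Gamma_eq_zero_iff)
  have "norm (GI y (a + of_nat n) / Gamma (a + of_nat n) - 1) \<le> c / (Re a + real n - 1)" for n
  proof -
    let ?a = "a + of_nat n"
    have p: "Re a + real n - 1 > 0" using assms by simp
    have Gn: "norm (Gamma ?a) > 0" using Gamma_notin[of ?a] assms by (simp add: Gamma_eq_zero_iff)
    have "Re a + real n - 1 \<notin> \<int>\<^sub>\<le>\<^sub>0" using p by (auto elim!: nonpos_Ints_cases)
    then have 1: "Gamma (Re a + real n) = (Re a + real n - 1) * Gamma (Re a + real n - 1)"
      using Gamma_plus1[of "Re a + real n - 1"] by simp
    have "norm (GI y ?a / Gamma ?a - 1) = norm ((GI y ?a - Gamma ?a) / Gamma ?a)"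
      using Gn by (simp add: diff_divide_distrib)
    also have "\<dots> \<le> y * Gamma (Re a + real n - 1) / norm (Gamma ?a)"
      using GI_minus_Gamma[of ?a y] assms by (simp add: norm_divide divide_right_mono)
    also have "\<dots> = y * Gamma (Re a + real n) / ((Re a + real n - 1) * norm (Gamma ?a))"
      unfolding 1 using p by simp
    also have "\<dots> \<le> c / (Re a + real n - 1)"
    proof -
      have "Gamma (Re a + real n) / norm (Gamma ?a) \<le> Gamma (Re a) / norm (Gamma a)"
        using norm_Gamma_ratio[of a n] assms Ga Gn by (simp add: field_simps)
      then have "y * (Gamma (Re a + real n) / norm (Gamma ?a)) / (Re a + real n - 1) \<le> c / (Re a + real n - 1)"
        unfolding c_def using p assms by (intro divide_right_mono mult_left_mono) auto
      then show ?thesis by (simp add: mult_ac)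
    qed
    finally show ?thesis .
  qed
  moreover have "(\<lambda>n. c / (Re a + real n - 1)) \<longlonglongrightarrow> 0"
  proof -
    have "filterlim (\<lambda>n. (Re a - 1) + real n) at_top sequentially"
      by (intro filterlim_tendsto_add_at_top[OF tendsto_const] filterlim_real_sequentially)
    moreover have "(\<lambda>n. (Re a - 1) + real n) = (\<lambda>n. Re a + real n - 1)" by auto
    ultimately have "filterlim (\<lambda>n. Re a + real n - 1) at_top sequentially" by (simp only:)
    then show ?thesis by (rule real_tendsto_divide_at_top[OF tendsto_const])
  qed
  ultimately have "(\<lambda>n. GI y (a + of_nat n) / Gamma (a + of_nat n) - 1) \<longlonglongrightarrow> 0"
    by (rule Lim_null_comparison[OF always_eventually[OF allI]])
  then show ?thesis by (rule LIM_zero_cancel)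
qed

lemma inverse_shift_tendsto_0: "(\<lambda>n. C / norm (a + of_nat n :: complex)) \<longlonglongrightarrow> 0"
proof -
  have "filterlim (\<lambda>n. norm (a + of_nat n)) at_top sequentially"
  proof (rule filterlim_at_top_mono)
    show "filterlim (\<lambda>n. - norm a + real n) at_top sequentially"
      by (intro filterlim_tendsto_add_at_top[OF tendsto_const] filterlim_real_sequentially)
    show "\<forall>\<^sub>F n in sequentially. - norm a + real n \<le> norm (a + of_nat n)"
    proof (intro always_eventually allI)
      fix n show "- norm a + real n \<le> norm (a + of_nat n)"
        using norm_diff_ineq[of "of_nat n :: complex" a] by (simp add: add.commute)
    qed
  qed
  then show ?thesis by (rule real_tendsto_divide_at_top[OF tendsto_const])
qed

lemma KI_wronskian_real:
  assumes "0 < x"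
  shows "of_real x * (KI a (of_real x) * bessel_I (a + 1) (of_real (ln x)) +
            KI (a + 1) (of_real x) * bessel_I a (of_real (ln x))) = 1"
proof -
  define s where "s = complex_of_real (ln x)"
  define w where "w a = of_real x * (KI a (of_real x) * bessel_I (a + 1) s + KI (a + 1) (of_real x) * bessel_I a s)" for a
  define y where "y = x\<^sup>2 / 4"
  have y: "y \<ge> 0" by (simp add: y_def)
  have es: "exp s = of_real x" using assms by (simp add: s_def exp_of_real)
  have per1: "w (a + 1) = w a" for a
  proof -
    have K: "of_real x * KI (a + 1 + 1) (of_real x) = of_real x * KI a (of_real x) + 2 * (a + 1) * KI (a + 1) (of_real x)"
      using KI_recurrence[of "of_real x" "a + 1"] assms by (simp add: algebra_simps)
    have I: "of_real x * bessel_I (a + 1 + 1) s = of_real x * bessel_I a s - 2 * (a + 1) * bessel_I (a + 1) s"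
      using bessel_I_recurrence[of s "a + 1"] unfolding es by (simp add: algebra_simps)
    have "w (a + 1) = KI (a + 1) (of_real x) * (of_real x * bessel_I (a + 1 + 1) s)
        + (of_real x * KI (a + 1 + 1) (of_real x)) * bessel_I (a + 1) s"
      unfolding w_def by (simp only: algebra_simps)
    also have "\<dots> = w a" unfolding K I w_def by (simp add: algebra_simps)
    finally show ?thesis .
  qed
  have per: "w (a + of_nat n) = w a" for a n
    by (induction n) (use per1[of "a + of_nat _"] in \<open>auto simp: add_ac\<close>)
  have w_GI: "w a = of_real y * GI y a * Phi (a + 1) (of_real y) + GI y (a + 1) * Phi a (of_real y)" for a
  proof -
    let ?p = "exp (a * (s - of_real (ln 2)))"
    have ln: "of_real (ln (x / 2)) = s - complex_of_real (ln 2)" using assms by (simp add: s_def ln_div)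
    have pp: "exp (- a * (s - of_real (ln 2))) * ?p = 1" by (simp add: exp_add[symmetric])
    have K: "2 * KI a (of_real x) = exp (- a * (s - of_real (ln 2))) * GI y a" for a
      using KI_eq_GI[OF assms, of a] unfolding ln y_def .
    have I: "bessel_I a s = exp (a * (s - of_real (ln 2))) * Phi a (of_real y)" for a
      unfolding bessel_I_Phi es y_def by simp
    have K1: "KI a (of_real x) = exp (- a * (s - of_real (ln 2))) * GI y a / 2"
      using K[of a] by (metis nonzero_mult_div_cancel_left zero_neq_numeral)
    have "- (a + 1) * (s - of_real (ln 2)) = - a * (s - of_real (ln 2)) + (of_real (ln 2) - s)"
      by (simp add: algebra_simps)
    moreover have "exp (of_real (ln 2) - s) = 2 / of_real x"
      by (simp add: exp_diff es exp_of_real)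
    ultimately have E1: "exp (- (a + 1) * (s - of_real (ln 2))) = exp (- a * (s - of_real (ln 2))) * (2 / of_real x)"
      by (simp only: exp_add)
    have K2: "KI (a + 1) (of_real x) = exp (- a * (s - of_real (ln 2))) * GI y (a + 1) / of_real x"
    proof -
      have "2 * KI (a + 1) (of_real x) = 2 * (exp (- a * (s - of_real (ln 2))) * GI y (a + 1) / of_real x)"
        using K[of "a + 1"] E1 by simp
      then show ?thesis by (simp only: mult_cancel_left) simp
    qed
    have I2: "bessel_I (a + 1) s = ?p * (of_real x / 2) * Phi (a + 1) (of_real y)"
      unfolding I exp_mult_add_one es ..
    have "w a = (exp (- a * (s - of_real (ln 2))) * ?p) *
        (of_real x * of_real x / 4 * GI y a * Phi (a + 1) (of_real y) + GI y (a + 1) * Phi a (of_real y))"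
      unfolding w_def K1 K2 I2 I[of a] using assms by (simp add: field_simps)
    also have "of_real x * of_real x / 4 = complex_of_real y" by (simp add: y_def power2_eq_square)
    finally show ?thesis unfolding pp by simp
  qed
  have lim: "w a = 1" if "Re a > 1" for a
  proof -
    let ?a = "\<lambda>n. a + of_nat n" and ?y = "complex_of_real y"
    have R: "Re (?a n) > 1" for n using that by simp
    have Phi1: "(\<lambda>n. Gamma (?a n + 1 + c) * Phi (?a n + c) ?y) \<longlonglongrightarrow> 1" if "c = 0 \<or> c = 1" for c
    proof -
      have "norm (Gamma (?a n + 1 + c) * Phi (?a n + c) ?y - 1) \<le> exp (norm ?y) / norm (a + (1 + c) + of_nat n)" for n
        using Gamma_mult_Phi_bound[of "?a n + c" ?y] R[of n] that by (auto simp: add_ac)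
      moreover have "(\<lambda>n. exp (norm ?y) / norm (a + (1 + c) + of_nat n)) \<longlonglongrightarrow> 0"
        by (rule inverse_shift_tendsto_0)
      ultimately have "(\<lambda>n. Gamma (?a n + 1 + c) * Phi (?a n + c) ?y - 1) \<longlonglongrightarrow> 0"
        by (rule Lim_null_comparison[OF always_eventually[OF allI]])
      then show ?thesis by (rule LIM_zero_cancel)
    qed
    have G0: "(\<lambda>n. GI y (?a n) / Gamma (?a n)) \<longlonglongrightarrow> 1" by (rule GI_over_Gamma[OF that y])
    have G1: "(\<lambda>n. GI y (?a n + 1) / Gamma (?a n + 1)) \<longlonglongrightarrow> 1"
      using GI_over_Gamma[of "a + 1" y] that y by (simp add: add_ac)
    have inv: "(\<lambda>n. 1 / (?a n + c)) \<longlonglongrightarrow> 0" for c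
      by (rule tendsto_norm_zero_cancel)
         (use inverse_shift_tendsto_0[of 1 "a + c"] in \<open>simp add: norm_divide add_ac\<close>)
    have eq: "w (?a n) = ?y * (GI y (?a n) / Gamma (?a n)) * (Gamma (?a n + 1 + 1) * Phi (?a n + 1) ?y) *
          (1 / (?a n + 0) * (1 / (?a n + 1)))
        + (GI y (?a n + 1) / Gamma (?a n + 1)) * (Gamma (?a n + 1 + 0) * Phi (?a n + 0) ?y)" for n
    proof -
      have z: "?a n \<noteq> 0" "?a n + 1 \<noteq> 0" using R[of n] by (auto simp: complex_eq_iff)
      have n0: "?a n \<notin> \<int>\<^sub>\<le>\<^sub>0" "?a n + 1 \<notin> \<int>\<^sub>\<le>\<^sub>0" using R[of n] by (auto intro!: Gamma_notin)
      have g: "Gamma (?a n) \<noteq> 0" using n0 by (simp add: Gamma_eq_zero_iff)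
      have g1: "Gamma (?a n + 1) = ?a n * Gamma (?a n)" by (rule Gamma_plus1[OF n0(1)])
      have g2: "Gamma (?a n + 1 + 1) = (?a n + 1) * (?a n * Gamma (?a n))"
        using Gamma_plus1[OF n0(2)] g1 by simp
      have "Y * p * q + p' * q' = Y * (p / G) * (((A + 1) * (A * G)) * q) * (1 / A * (1 / (A + 1)))
          + (p' / (A * G)) * ((A * G) * q')"
        if "A \<noteq> 0" "A + 1 \<noteq> 0" "G \<noteq> 0" for Y A G p q p' q' :: complex
        using that by (simp add: divide_simps)
      from this[OF z g] show ?thesis unfolding w_GI add_0_right g2 g1 .
    qed
    have "(\<lambda>n. w (?a n)) \<longlonglongrightarrow> ?y * 1 * 1 * (0 * 0) + 1 * 1"
      unfolding eq by (intro tendsto_intros G0 G1 inv Phi1) auto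
    then have "(\<lambda>n. w a) \<longlonglongrightarrow> 1" by (simp add: per)
    then show ?thesis by (simp add: LIMSEQ_const_iff)
  qed
  obtain n :: nat where "real n > 1 - Re a" using reals_Archimedean2 by blast
  then have "w (a + of_nat n) = 1" by (intro lim) simp
  then show ?thesis unfolding per unfolding w_def s_def .
qed

text \<open>
  The difference \<open>d\<close> of the two functions satisfies a homogeneous \<open>2 \<times> 2\<close> system; its determinant is
  the Wronskian of \<open>I\<^sub>\<nu>\<close> and \<open>I\<^sub>-\<^sub>\<nu>\<close>, which is non-zero off the integers.
\<close>

lemma bessel_K_eq_KI_real:
  assumes "0 < x" "\<nu> \<notin> \<int>"
  shows "bessel_K \<nu> (of_real (ln x)) = KI \<nu> (of_real x)"
proof -
  define s where "s = complex_of_real (ln x)"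
  have es: "exp s = of_real x" using assms by (simp add: s_def exp_of_real)
  define d where "d \<nu> = KI \<nu> (of_real x) - bessel_K \<nu> s" for \<nu>
  have x: "of_real x \<noteq> (0::complex)" using assms by simp
  have w: "d \<nu> * bessel_I (\<nu> + 1) s + d (\<nu> + 1) * bessel_I \<nu> s = 0" for \<nu>
  proof -
    have "of_real x * (d \<nu> * bessel_I (\<nu> + 1) s + d (\<nu> + 1) * bessel_I \<nu> s) = 1 - 1"
      using KI_wronskian_real[OF assms(1), of \<nu>] bessel_KI_wronskian[of s \<nu>]
      unfolding es d_def s_def[symmetric] by (simp add: algebra_simps)
    then show ?thesis using x by simp
  qed
  have sym: "d (- \<nu>) = d \<nu>" for \<nu> by (simp add: d_def KI_minus_order bessel_K_minus_order)
  have "d (- \<nu> - 1) * bessel_I (- \<nu>) s + d (- \<nu>) * bessel_I (- \<nu> - 1) s = 0"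
    using w[of "- \<nu> - 1"] by simp
  moreover have "d (- \<nu> - 1) = d (\<nu> + 1)" using sym[of "\<nu> + 1"] by (simp only: minus_add_distrib add_uminus_conv_diff)
  ultimately have w2: "d (\<nu> + 1) * bessel_I (- \<nu>) s + d \<nu> * bessel_I (- \<nu> - 1) s = 0"
    by (simp add: sym)
  have "d \<nu> * (exp s * (bessel_I \<nu> s * bessel_I (- \<nu> - 1) s - bessel_I (\<nu> + 1) s * bessel_I (- \<nu>) s))
     = exp s * (bessel_I \<nu> s * (d (\<nu> + 1) * bessel_I (- \<nu>) s + d \<nu> * bessel_I (- \<nu> - 1) s)
        - bessel_I (- \<nu>) s * (d \<nu> * bessel_I (\<nu> + 1) s + d (\<nu> + 1) * bessel_I \<nu> s))"
    by (simp add: algebra_simps)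
  also have "\<dots> = 0" unfolding w w2 by simp
  finally have "d \<nu> = 0"
    unfolding bessel_I_wronskian using sin_pi_eq_0_Ints[of \<nu>] assms(2) by (simp add: mult.commute)
  then show ?thesis by (simp add: d_def s_def)
qed

lemma bessel_K_eq_KI:
  assumes "\<bar>Im s\<bar> < pi / 2" "\<nu> \<notin> \<int>"
  shows "bessel_K \<nu> s = KI \<nu> (exp s)"
proof -
  define S where "S = {s. - (pi / 2) < Im s} \<inter> {s. Im s < pi / 2}"
  have S: "open S" "connected S"
    unfolding S_def by (intro open_Int open_halfspace_Im_gt open_halfspace_Im_lt convex_connected
        convex_Int convex_halfspace_Im_gt convex_halfspace_Im_lt)+
  have Re: "0 < Re (exp s)" if "s \<in> S" for s
    using that by (auto simp: S_def Re_exp intro!: mult_pos_pos cos_gt_zero_pi)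
  have "bessel_K \<nu> holomorphic_on S"
    using bessel_K_deriv[OF assms(2)] by (auto simp: holomorphic_on_open[OF S(1)])
  moreover have "(\<lambda>s. KI \<nu> (exp s)) holomorphic_on S"
    by (rule holomorphic_on_compose_gen[OF _ KI_holomorphic, of exp, unfolded o_def])
       (auto intro!: holomorphic_intros Re)
  ultimately have hol: "(\<lambda>s. bessel_K \<nu> s - KI \<nu> (exp s)) holomorphic_on S"
    by (intro holomorphic_intros)
  have "bessel_K \<nu> s - KI \<nu> (exp s) = 0"
  proof (rule analytic_continuation[OF hol S, where U="\<real>" and \<xi>=0])
    show "\<real> \<subseteq> S" by (auto simp: S_def elim!: Reals_cases)
    show "0 \<in> S" by (simp add: S_def)
    show "s \<in> S" using assms by (auto simp: S_def)
    show "(0::complex) islimpt \<real>"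
    proof (rule islimptI)
      fix T :: "complex set" assume "0 \<in> T" "open T"
      then obtain e where e: "e > 0" "ball 0 e \<subseteq> T" by (meson open_contains_ball)
      then have "complex_of_real (e / 2) \<in> T" by (auto simp: subset_iff)
      then show "\<exists>y\<in>\<real>. y \<in> T \<and> y \<noteq> 0" using e by (intro bexI[of _ "complex_of_real (e / 2)"]) auto
    qed
    fix z :: complex assume "z \<in> \<real>"
    then obtain r where "z = of_real r" by (auto elim: Reals_cases)
    then show "bessel_K \<nu> z - KI \<nu> (exp z) = 0"
      using bessel_K_eq_KI_real[of "exp r" \<nu>] assms(2) by (simp add: exp_of_real)
  qed
  then show ?thesis by simp
qed

section \<open>Growth of the Bessel functions in the closed right half-plane\<close>

lemma gronwall:
  fixes S k :: "real \<Rightarrow> real"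
  assumes "a \<le> b"
    and S: "\<And>x. a \<le> x \<Longrightarrow> x \<le> b \<Longrightarrow> (S has_real_derivative S' x) (at x)"
    and k: "\<And>x. a \<le> x \<Longrightarrow> x \<le> b \<Longrightarrow> (k has_real_derivative k' x) (at x)"
    and le: "\<And>x. a \<le> x \<Longrightarrow> x \<le> b \<Longrightarrow> S' x \<le> k' x * S x"
  shows "S b \<le> S a * exp (k b - k a)"
proof -
  have "S b * exp (- k b) \<le> S a * exp (- k a)"
  proof (rule DERIV_nonpos_imp_nonincreasing[OF assms(1)])
    fix x assume x: "a \<le> x" "x \<le> b"
    have "((\<lambda>x. S x * exp (- k x)) has_real_derivative (S' x - k' x * S x) * exp (- k x)) (at x)"
      by (auto intro!: derivative_eq_intros S k x simp: algebra_simps)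
    moreover have "(S' x - k' x * S x) * exp (- k x) \<le> 0"
      using le[OF x] by (intro mult_nonpos_nonneg) auto
    ultimately show "\<exists>y. ((\<lambda>x. S x * exp (- k x)) has_real_derivative y) (at x) \<and> y \<le> 0" by blast
  qed
  then have "S b * exp (- k b) * exp (k b) \<le> S a * exp (- k a) * exp (k b)"
    by (rule mult_right_mono) simp
  then show ?thesis by (simp add: mult.assoc exp_add[symmetric])
qed

lemma norm_square_along_line_deriv:
  assumes "(F has_field_derivative F') (at (s + of_real \<tau> * d))"
  shows "((\<lambda>\<tau>. (norm (F (s + of_real \<tau> * d)))\<^sup>2) has_real_derivative 2 * Re (cnj (F (s + of_real \<tau> * d)) * (d * F'))) (at \<tau>)"
proof -
  let ?l = "\<lambda>\<tau>. s + of_real \<tau> * d"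
  have "(?l has_vector_derivative d) (at \<tau>)"
    by (auto intro!: derivative_eq_intros has_vector_derivative_of_real simp: has_vector_derivative_mult_left)
  then have "(F \<circ> ?l has_vector_derivative d * F') (at \<tau>)"
    using assms by (intro field_vector_diff_chain_at)
  then have v: "((\<lambda>\<tau>. F (?l \<tau>)) has_vector_derivative d * F') (at \<tau>)" by (simp add: o_def)
  have R: "((\<lambda>\<tau>. Re (F (?l \<tau>))) has_real_derivative Re (d * F')) (at \<tau>)"
    using bounded_linear.has_vector_derivative[OF bounded_linear_Re v]
    by (simp add: has_real_derivative_iff_has_vector_derivative)
  have I: "((\<lambda>\<tau>. Im (F (?l \<tau>))) has_real_derivative Im (d * F')) (at \<tau>)"
    using bounded_linear.has_vector_derivative[OF bounded_linear_Im v]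
    by (simp add: has_real_derivative_iff_has_vector_derivative)
  show ?thesis unfolding cmod_power2
    by (rule DERIV_cong[OF DERIV_add[OF DERIV_power[OF R, of 2] DERIV_power[OF I, of 2]]])
       (simp add: algebra_simps)
qed

lemma two_Re_cnj_mult_le: "\<bar>2 * Re (cnj a * b)\<bar> \<le> (norm a)\<^sup>2 + (norm b)\<^sup>2"
proof -
  have "\<bar>Re (cnj a * b)\<bar> \<le> norm a * norm b"
    using abs_Re_le_cmod[of "cnj a * b"] by (simp add: norm_mult)
  moreover have "2 * (norm a * norm b) \<le> (norm a)\<^sup>2 + (norm b)\<^sup>2"
    using sum_squares_bound[of "norm a" "norm b"] by simp
  ultimately show ?thesis by linarith
qed

lemma exp_Re_power_bound: "p \<ge> 0 \<Longrightarrow> exp (p * x) \<le> (1 + exp x) ^ nat \<lceil>p\<rceil>" for p x :: real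
proof -
  assume p: "p \<ge> 0"
  have "exp (p * x) = exp x powr p" by (simp add: powr_def mult.commute)
  also have "\<dots> \<le> (1 + exp x) powr p" using p by (intro powr_mono2) auto
  also have "\<dots> \<le> (1 + exp x) powr real (nat \<lceil>p\<rceil>)" by (intro powr_mono real_nat_ceiling_ge) auto
  also have "\<dots> = (1 + exp x) ^ nat \<lceil>p\<rceil>" by (subst powr_realpow) (auto intro: add_pos_pos)
  finally show ?thesis .
qed

lemma Re_exp_nonneg: "\<bar>Im s\<bar> \<le> pi / 2 \<Longrightarrow> 0 \<le> Re (exp s)"
  by (simp add: Re_exp cos_ge_zero abs_le_iff)

text \<open>
  Along a ray the squared length of \<open>(I\<^sub>\<mu>, I\<^sub>\<mu>\<^sub>+\<^sub>1)\<close> grows at a logarithmic rate of at most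
  \<open>2 (Re z + const)\<close>, because the cross terms carry only the real part of \<open>z\<close>.  This yields the
  exponent \<open>Re z\<close>; estimating the series term by term would give \<open>\<bar>z\<bar>\<close>, which is useless near the
  imaginary axis.
\<close>

lemma bessel_I_growth:
  "\<exists>C>0. \<exists>P::nat. \<forall>s. \<bar>Im s\<bar> \<le> pi / 2 \<longrightarrow> \<sigma>\<^sub>0 \<le> Re s \<longrightarrow>
     norm (bessel_I \<mu> s) \<le> C * (1 + norm (exp s)) ^ P * exp (Re (exp s)) \<and>
     norm (bessel_I (\<mu> + 1) s) \<le> C * (1 + norm (exp s)) ^ P * exp (Re (exp s))"
proof -
  let ?S = "\<lambda>s. (norm (bessel_I \<mu> s))\<^sup>2 + (norm (bessel_I (\<mu> + 1) s))\<^sup>2"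
  define p where "p = norm \<mu> + 1"
  have p: "p \<ge> 0" by (simp add: p_def)
  have "compact ((\<lambda>\<theta>. ?S (Complex \<sigma>\<^sub>0 \<theta>)) ` {- (pi / 2)..pi / 2})"
  proof (rule compact_continuous_image[OF _ compact_Icc])
    have "continuous_on UNIV (bessel_I \<nu>)" for \<nu>
      using bessel_I_holomorphic[OF holomorphic_on_ident] by (intro holomorphic_on_imp_continuous_on)
    moreover have "continuous_on A (\<lambda>\<theta>. Complex \<sigma>\<^sub>0 \<theta>)" for A
      unfolding Complex_eq by (intro continuous_intros)
    ultimately have "continuous_on A (\<lambda>\<theta>. bessel_I \<nu> (Complex \<sigma>\<^sub>0 \<theta>))" for A \<nu>
      by (rule continuous_on_compose2) auto
    then show "continuous_on {- (pi / 2)..pi / 2} (\<lambda>\<theta>. ?S (Complex \<sigma>\<^sub>0 \<theta>))"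
      by (intro continuous_on_add continuous_on_power continuous_on_norm)
  qed
  then have "bounded ((\<lambda>\<theta>. ?S (Complex \<sigma>\<^sub>0 \<theta>)) ` {- (pi / 2)..pi / 2})" by (rule compact_imp_bounded)
  then obtain C0 where b: "\<forall>x\<in>(\<lambda>\<theta>. ?S (Complex \<sigma>\<^sub>0 \<theta>)) ` {- (pi / 2)..pi / 2}. norm x \<le> C0"
    unfolding bounded_iff ..
  have C0: "?S (Complex \<sigma>\<^sub>0 \<theta>) \<le> C0" if "\<bar>\<theta>\<bar> \<le> pi / 2" for \<theta>
  proof -
    have "\<theta> \<in> {- (pi / 2)..pi / 2}" using that by (auto simp: abs_le_iff)
    then have "norm (?S (Complex \<sigma>\<^sub>0 \<theta>)) \<le> C0" by (intro bspec[OF b] imageI)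
    then show ?thesis by simp
  qed
  have "0 \<le> ?S (Complex \<sigma>\<^sub>0 0)" by simp
  also have "\<dots> \<le> C0" by (rule C0) simp
  finally have C0': "C0 \<ge> 0" .
  define C where "C = sqrt (C0 * exp (- 2 * p * \<sigma>\<^sub>0)) + 1"
  have "?S s \<le> (C * (1 + norm (exp s)) ^ nat \<lceil>p\<rceil> * exp (Re (exp s)))\<^sup>2"
    if s: "\<bar>Im s\<bar> \<le> pi / 2" "\<sigma>\<^sub>0 \<le> Re s" for s
  proof -
    let ?z = "Complex \<sigma>\<^sub>0 (Im s)"
    let ?l = "\<lambda>\<tau>. ?z + of_real \<tau> * 1"
    let ?k = "\<lambda>\<tau>. 2 * (exp (\<sigma>\<^sub>0 + \<tau>) * cos (Im s) + p * \<tau>)"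
    let ?S' = "\<lambda>\<tau>. 2 * Re (cnj (bessel_I \<mu> (?l \<tau>)) * (1 * (exp (?l \<tau>) * bessel_I (\<mu> + 1) (?l \<tau>) + \<mu> * bessel_I \<mu> (?l \<tau>))))
       + 2 * Re (cnj (bessel_I (\<mu> + 1) (?l \<tau>)) * (1 * (exp (?l \<tau>) * bessel_I \<mu> (?l \<tau>) - (\<mu> + 1) * bessel_I (\<mu> + 1) (?l \<tau>))))"
    have "?S (?l (Re s - \<sigma>\<^sub>0)) \<le> ?S (?l 0) * exp (?k (Re s - \<sigma>\<^sub>0) - ?k 0)"
    proof (rule gronwall[where S="\<lambda>\<tau>. ?S (?l \<tau>)" and S'="?S'" and k="?k"
          and k'="\<lambda>\<tau>. 2 * (exp (\<sigma>\<^sub>0 + \<tau>) * cos (Im s) + p)"])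
      show "0 \<le> Re s - \<sigma>\<^sub>0" using s by simp
      fix \<tau> :: real
      show "((\<lambda>\<tau>. ?S (?l \<tau>)) has_real_derivative ?S' \<tau>) (at \<tau>)"
        by (intro DERIV_add norm_square_along_line_deriv bessel_I_deriv bessel_I_Suc_deriv)
      show "(?k has_real_derivative 2 * (exp (\<sigma>\<^sub>0 + \<tau>) * cos (Im s) + p)) (at \<tau>)"
        by (auto intro!: derivative_eq_intros)
      let ?a = "bessel_I \<mu> (?l \<tau>)" and ?c = "bessel_I (\<mu> + 1) (?l \<tau>)"
      have Re_e: "Re (exp (?l \<tau>)) = exp (\<sigma>\<^sub>0 + \<tau>) * cos (Im s)" by (simp add: Re_exp)
      have Re_e0: "Re (exp (?l \<tau>)) \<ge> 0" using s by (intro Re_exp_nonneg) simp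
      have "?S' \<tau> = 2 * (Re (exp (?l \<tau>)) * (2 * Re (cnj ?a * ?c)) + Re \<mu> * (norm ?a)\<^sup>2 - Re (\<mu> + 1) * (norm ?c)\<^sup>2)"
        unfolding cmod_power2 by (simp add: algebra_simps power2_eq_square)
      also have "\<dots> \<le> 2 * (Re (exp (?l \<tau>)) * ((norm ?a)\<^sup>2 + (norm ?c)\<^sup>2) + p * (norm ?a)\<^sup>2 + p * (norm ?c)\<^sup>2)"
      proof -
        have "Re (exp (?l \<tau>)) * (2 * Re (cnj ?a * ?c)) \<le> Re (exp (?l \<tau>)) * ((norm ?a)\<^sup>2 + (norm ?c)\<^sup>2)"
          using two_Re_cnj_mult_le[of ?a ?c] by (intro mult_left_mono Re_e0) linarith
        moreover have "Re \<mu> * (norm ?a)\<^sup>2 \<le> p * (norm ?a)\<^sup>2"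
          using complex_Re_le_cmod[of \<mu>] by (intro mult_right_mono) (auto simp: p_def)
        moreover have "- Re (\<mu> + 1) * (norm ?c)\<^sup>2 \<le> p * (norm ?c)\<^sup>2"
          using abs_Re_le_cmod[of \<mu>] by (intro mult_right_mono) (auto simp: p_def)
        ultimately show ?thesis by (simp add: algebra_simps)
      qed
      also have "\<dots> = 2 * (exp (\<sigma>\<^sub>0 + \<tau>) * cos (Im s) + p) * ?S (?l \<tau>)"
        unfolding Re_e by (simp add: algebra_simps)
      finally show "?S' \<tau> \<le> 2 * (exp (\<sigma>\<^sub>0 + \<tau>) * cos (Im s) + p) * ?S (?l \<tau>)" .
    qed
    also have "?l (Re s - \<sigma>\<^sub>0) = s" by (simp add: complex_eq_iff)
    also have "?l 0 = ?z" by simp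
    also have "?k (Re s - \<sigma>\<^sub>0) - ?k 0 = 2 * Re (exp s) + 2 * p * Re s + (- 2 * p * \<sigma>\<^sub>0) - 2 * (exp \<sigma>\<^sub>0 * cos (Im s))"
      by (simp add: Re_exp algebra_simps)
    also have "?S ?z * exp (2 * Re (exp s) + 2 * p * Re s + (- 2 * p * \<sigma>\<^sub>0) - 2 * (exp \<sigma>\<^sub>0 * cos (Im s)))
      \<le> C0 * exp (2 * Re (exp s) + 2 * p * Re s + (- 2 * p * \<sigma>\<^sub>0))"
      using s C0[of "Im s"] by (intro mult_mono C0' iffD2[OF exp_le_cancel_iff]) (auto intro!: mult_nonneg_nonneg cos_ge_zero simp: abs_le_iff)
    also have "\<dots> = (sqrt (C0 * exp (- 2 * p * \<sigma>\<^sub>0)) * exp (p * Re s) * exp (Re (exp s)))\<^sup>2"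
    proof -
      have "exp (2 * Re (exp s) + 2 * p * Re s + (- 2 * p * \<sigma>\<^sub>0))
        = exp (- 2 * p * \<sigma>\<^sub>0) * (exp (p * Re s))\<^sup>2 * (exp (Re (exp s)))\<^sup>2"
        unfolding exp_double[symmetric] exp_add[symmetric] by (simp add: algebra_simps)
      then show ?thesis using C0' by (simp add: power_mult_distrib)
    qed
    also have "\<dots> \<le> (C * (1 + norm (exp s)) ^ nat \<lceil>p\<rceil> * exp (Re (exp s)))\<^sup>2"
      using exp_Re_power_bound[OF p, of "Re s"] C0'
      by (intro power_mono mult_right_mono mult_mono) (auto simp: C_def)
    finally show ?thesis .
  qed
  then have *: "(norm (bessel_I \<mu> s))\<^sup>2 \<le> (C * (1 + norm (exp s)) ^ nat \<lceil>p\<rceil> * exp (Re (exp s)))\<^sup>2 \<and>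
     (norm (bessel_I (\<mu> + 1) s))\<^sup>2 \<le> (C * (1 + norm (exp s)) ^ nat \<lceil>p\<rceil> * exp (Re (exp s)))\<^sup>2"
    if "\<bar>Im s\<bar> \<le> pi / 2" "\<sigma>\<^sub>0 \<le> Re s" for s using that by (smt (verit) zero_le_power2)
  have C: "C > 0" using C0' by (simp add: C_def add_nonneg_pos)
  have "0 \<le> C * (1 + norm (exp s)) ^ nat \<lceil>p\<rceil> * exp (Re (exp s))" for s
    using C by simp
  with * C show ?thesis
    by (intro exI[of _ C] conjI exI[of _ "nat \<lceil>p\<rceil>"] allI impI) (auto intro: power2_le_imp_le)
qed

lemma sin_ge_half: "0 \<le> x \<Longrightarrow> x \<le> 1 \<Longrightarrow> x / 2 \<le> sin x" for x :: real
proof -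
  assume x: "0 \<le> x" "x \<le> 1"
  have "sin 0 - 0 / 2 \<le> sin x - x / 2"
  proof (rule DERIV_nonneg_imp_nondecreasing[of 0 x "\<lambda>x. sin x - x / 2"])
    fix t assume t: "0 \<le> t" "t \<le> x"
    have "((\<lambda>x. sin x - x / 2) has_real_derivative cos t - 1 / 2) (at t)"
      by (auto intro!: derivative_eq_intros)
    moreover have "cos (pi / 3) \<le> cos t"
      using t x pi_gt3 by (intro cos_monotone_0_pi_le) auto
    ultimately show "\<exists>y. ((\<lambda>x. sin x - x / 2) has_real_derivative y) (at t) \<and> 0 \<le> y"
      by (intro exI[of _ "cos t - 1 / 2"]) (auto simp: cos_60)
  qed (use x in auto)
  then show ?thesis by simp
qed

text \<open>
  Where \<open>Re z\<close> is bounded below the integral gives the decay.  The remaining strip along the imaginary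
  axis is entered from there by turning through an angle of at most \<open>1/\<bar>z\<bar>\<close>, and over so short an arc
  the first-order system for \<open>(K\<^sub>\<kappa>, K\<^sub>\<kappa>\<^sub>+\<^sub>1)\<close> changes its solutions only by a bounded factor.  The
  constant is uniform for orders in a bounded set, so that integer orders can be reached as limits.
\<close>

lemma bessel_K_decay_nonint:
  assumes "0 \<le> B"
  shows "\<exists>C>0. \<forall>\<kappa> s. \<kappa> \<notin> \<int> \<longrightarrow> norm \<kappa> \<le> B \<longrightarrow> \<bar>Im s\<bar> \<le> pi / 2 \<longrightarrow> \<sigma>\<^sub>0 \<le> Re s \<longrightarrow>
     norm (bessel_K \<kappa> s) \<le> C * exp (- Re (exp s))"
proof -
  define c where "c = min (exp \<sigma>\<^sub>0) 1 / 2"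
  have c: "c > 0" by (simp add: c_def)
  obtain C0 where C0: "C0 > 0" "\<And>z \<nu>. c \<le> Re z \<Longrightarrow> \<bar>Re \<nu>\<bar> \<le> B + 1 \<Longrightarrow> norm (KI \<nu> z) \<le> C0 * exp (- Re z)"
    using KI_bound[OF c, of "B + 1"] by blast
  define C where "C = 2 * C0 * exp (B + 3)"
  have "norm (bessel_K \<kappa> s) \<le> C * exp (- Re (exp s))"
    if \<kappa>: "\<kappa> \<notin> \<int>" "norm \<kappa> \<le> B" and s: "\<bar>Im s\<bar> \<le> pi / 2" "\<sigma>\<^sub>0 \<le> Re s" for \<kappa> s
  proof -
    define \<rho> where "\<rho> = exp (Re s)"
    define \<eta> where "\<eta> = min 1 (1 / \<rho>)"
    have \<rho>: "\<rho> > 0" by (simp add: \<rho>_def)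
    have \<eta>: "0 < \<eta>" "\<eta> \<le> 1" "\<rho> * \<eta> \<le> 1" using \<rho> by (auto simp: \<eta>_def min_def field_simps)
    have \<eta>c: "\<rho> * (\<eta> / 2) \<ge> c"
      using s \<rho> by (auto simp: \<eta>_def c_def \<rho>_def min_def field_simps)
    have \<eta>pi: "\<eta> < pi / 2" using \<eta> pi_gt3 by linarith
    have far: "norm (bessel_K \<nu> t) \<le> C0 * exp (- Re (exp t))"
      if "\<nu> = \<kappa> \<or> \<nu> = \<kappa> + 1" "\<bar>Im t\<bar> \<le> pi / 2 - \<eta>" "Re t = Re s" for \<nu> t
    proof -
      have "\<eta> / 2 \<le> sin \<eta>" using \<eta> by (intro sin_ge_half) auto
      also have "\<dots> = cos (pi / 2 - \<eta>)" by (simp add: cos_diff)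
      also have "\<dots> \<le> cos \<bar>Im t\<bar>" using that \<eta> pi_gt3 by (intro cos_monotone_0_pi_le) auto
      finally have "\<eta> / 2 \<le> cos (Im t)" by simp
      then have "\<rho> * (\<eta> / 2) \<le> Re (exp t)" using \<rho> that by (simp add: Re_exp \<rho>_def)
      then have 1: "c \<le> Re (exp t)" using \<eta>c by simp
      have "\<bar>Re \<nu>\<bar> \<le> B + 1" using that abs_Re_le_cmod[of \<kappa>] \<kappa> by auto
      moreover have "\<nu> \<notin> \<int>" using that \<kappa> nonint_add_one by auto
      moreover have "\<bar>Im t\<bar> < pi / 2" using that \<eta> by simp
      ultimately show ?thesis using bessel_K_eq_KI[of t \<nu>] C0(2)[OF 1] by simp
    qed
    have "1 \<le> exp (B + 3)" using assms by simp
    then have "1 \<le> 2 * exp (B + 3)" by linarith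
    then have CC: "C0 \<le> C" using C0(1) by (simp add: C_def)
    show ?thesis
    proof (cases "\<bar>Im s\<bar> \<le> pi / 2 - \<eta>")
      case True
      have "norm (bessel_K \<kappa> s) \<le> C0 * exp (- Re (exp s))" by (rule far) (use True in auto)
      also have "\<dots> \<le> C * exp (- Re (exp s))" using CC by (intro mult_right_mono) auto
      finally show ?thesis .
    next
      case False
      define sg where "sg = (if Im s \<ge> 0 then 1 else - 1 :: real)"
      define d where "d = \<i> * of_real sg"
      define t0 where "t0 = Complex (Re s) (sg * (pi / 2 - \<eta>))"
      define h where "h = \<bar>Im s\<bar> - (pi / 2 - \<eta>)"
      have nd: "norm d = 1" by (simp add: d_def sg_def)
      have h: "0 \<le> h" "h \<le> \<eta>" using False s by (auto simp: h_def)
      let ?S = "\<lambda>s. (norm (bessel_K \<kappa> s))\<^sup>2 + (norm (bessel_K (\<kappa> + 1) s))\<^sup>2"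
      let ?l = "\<lambda>\<tau>. t0 + of_real \<tau> * d"
      let ?S' = "\<lambda>\<tau>. 2 * Re (cnj (bessel_K \<kappa> (?l \<tau>)) * (d * (\<kappa> * bessel_K \<kappa> (?l \<tau>) - exp (?l \<tau>) * bessel_K (\<kappa> + 1) (?l \<tau>))))
        + 2 * Re (cnj (bessel_K (\<kappa> + 1) (?l \<tau>)) * (d * (- exp (?l \<tau>) * bessel_K \<kappa> (?l \<tau>) - (\<kappa> + 1) * bessel_K (\<kappa> + 1) (?l \<tau>))))"
      have "?S (?l h) \<le> ?S (?l 0) * exp (2 * (\<rho> + B + 1) * h - 2 * (\<rho> + B + 1) * 0)"
      proof (rule gronwall[where S="\<lambda>\<tau>. ?S (?l \<tau>)" and S'="?S'" and k="\<lambda>\<tau>. 2 * (\<rho> + B + 1) * \<tau>"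
            and k'="\<lambda>\<tau>. 2 * (\<rho> + B + 1)"])
        fix \<tau> :: real
        show "((\<lambda>\<tau>. ?S (?l \<tau>)) has_real_derivative ?S' \<tau>) (at \<tau>)"
          by (intro DERIV_add norm_square_along_line_deriv bessel_K_deriv[OF \<kappa>(1)] bessel_K_Suc_deriv[OF \<kappa>(1)])
        show "((\<lambda>\<tau>. 2 * (\<rho> + B + 1) * \<tau>) has_real_derivative 2 * (\<rho> + B + 1)) (at \<tau>)"
          by (auto intro!: derivative_eq_intros)
        define a where "a = norm (bessel_K \<kappa> (?l \<tau>))"
        define e where "e = norm (bessel_K (\<kappa> + 1) (?l \<tau>))"
        have ae: "a \<ge> 0" "e \<ge> 0" by (auto simp: a_def e_def)
        have ne: "norm (exp (?l \<tau>)) = \<rho>" by (simp add: t0_def d_def \<rho>_def)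
        have n1: "norm (\<kappa> + 1) \<le> B + 1" using norm_triangle_ineq[of \<kappa> 1] \<kappa> by simp
        have "Re (cnj (bessel_K \<kappa> (?l \<tau>)) * (d * (\<kappa> * bessel_K \<kappa> (?l \<tau>) - exp (?l \<tau>) * bessel_K (\<kappa> + 1) (?l \<tau>))))
           \<le> a * (norm (\<kappa> * bessel_K \<kappa> (?l \<tau>) - exp (?l \<tau>) * bessel_K (\<kappa> + 1) (?l \<tau>)))"
          by (rule order_trans[OF complex_Re_le_cmod]) (simp add: norm_mult nd a_def)
        also have "\<dots> \<le> a * (B * a + \<rho> * e)"
        proof (intro mult_left_mono ae)
          have "norm (\<kappa> * bessel_K \<kappa> (?l \<tau>) - exp (?l \<tau>) * bessel_K (\<kappa> + 1) (?l \<tau>)) \<le> norm \<kappa> * a + \<rho> * e"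
            by (rule order_trans[OF norm_triangle_ineq4]) (simp only: norm_mult ne a_def e_def order_refl)
          also have "\<dots> \<le> B * a + \<rho> * e" using \<kappa> ae by (intro add_mono mult_right_mono) auto
          finally show "norm (\<kappa> * bessel_K \<kappa> (?l \<tau>) - exp (?l \<tau>) * bessel_K (\<kappa> + 1) (?l \<tau>)) \<le> B * a + \<rho> * e" .
        qed
        finally have 1: "Re (cnj (bessel_K \<kappa> (?l \<tau>)) * (d * (\<kappa> * bessel_K \<kappa> (?l \<tau>) - exp (?l \<tau>) * bessel_K (\<kappa> + 1) (?l \<tau>))))
           \<le> a * (B * a + \<rho> * e)" .
        have "Re (cnj (bessel_K (\<kappa> + 1) (?l \<tau>)) * (d * (- exp (?l \<tau>) * bessel_K \<kappa> (?l \<tau>) - (\<kappa> + 1) * bessel_K (\<kappa> + 1) (?l \<tau>))))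
           \<le> e * (norm (- exp (?l \<tau>) * bessel_K \<kappa> (?l \<tau>) - (\<kappa> + 1) * bessel_K (\<kappa> + 1) (?l \<tau>)))"
          by (rule order_trans[OF complex_Re_le_cmod]) (simp add: norm_mult nd e_def)
        also have "\<dots> \<le> e * (\<rho> * a + (B + 1) * e)"
        proof (intro mult_left_mono ae)
          have "norm (- exp (?l \<tau>) * bessel_K \<kappa> (?l \<tau>) - (\<kappa> + 1) * bessel_K (\<kappa> + 1) (?l \<tau>)) \<le> \<rho> * a + norm (\<kappa> + 1) * e"
            by (rule order_trans[OF norm_triangle_ineq4]) (simp only: norm_mult norm_minus_cancel ne a_def e_def order_refl)
          also have "\<dots> \<le> \<rho> * a + (B + 1) * e" using n1 ae by (intro add_mono mult_right_mono) auto
          finally show "norm (- exp (?l \<tau>) * bessel_K \<kappa> (?l \<tau>) - (\<kappa> + 1) * bessel_K (\<kappa> + 1) (?l \<tau>)) \<le> \<rho> * a + (B + 1) * e" .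
        qed
        finally have 2: "Re (cnj (bessel_K (\<kappa> + 1) (?l \<tau>)) * (d * (- exp (?l \<tau>) * bessel_K \<kappa> (?l \<tau>) - (\<kappa> + 1) * bessel_K (\<kappa> + 1) (?l \<tau>))))
           \<le> e * (\<rho> * a + (B + 1) * e)" .
        have 3: "\<rho> * (2 * (a * e)) \<le> \<rho> * (a\<^sup>2 + e\<^sup>2)"
          using sum_squares_bound[of a e] \<rho> by (intro mult_left_mono) auto
        have "2 * (a * (B * a + \<rho> * e)) + 2 * (e * (\<rho> * a + (B + 1) * e)) \<le> 2 * (\<rho> + B + 1) * (a\<^sup>2 + e\<^sup>2)"
        proof -
          have "2 * (a * (B * a + \<rho> * e)) + 2 * (e * (\<rho> * a + (B + 1) * e))
            = 2 * (B * a\<^sup>2) + 4 * (\<rho> * (a * e)) + 2 * (B * e\<^sup>2) + 2 * e\<^sup>2"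
            by (simp add: algebra_simps power2_eq_square)
          moreover have "2 * (\<rho> + B + 1) * (a\<^sup>2 + e\<^sup>2)
            = 2 * (\<rho> * (a\<^sup>2 + e\<^sup>2)) + 2 * (B * a\<^sup>2) + 2 * (B * e\<^sup>2) + 2 * a\<^sup>2 + 2 * e\<^sup>2"
            by (simp add: algebra_simps)
          moreover have "2 * (\<rho> * (a * e)) \<le> \<rho> * (a\<^sup>2 + e\<^sup>2)" using 3 by (simp only: mult.left_commute)
          ultimately show ?thesis using zero_le_power2[of a] by linarith
        qed
        then have "?S' \<tau> \<le> 2 * (\<rho> + B + 1) * (a\<^sup>2 + e\<^sup>2)"
          using 1 2 by linarith
        then show "?S' \<tau> \<le> 2 * (\<rho> + B + 1) * ?S (?l \<tau>)" by (simp only: a_def e_def)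
      qed (rule h)
      also have "?l h = s"
        by (auto simp: t0_def d_def h_def sg_def complex_eq_iff)
      also have "?l 0 = t0" by simp
      finally have S: "?S s \<le> ?S t0 * exp (2 * (\<rho> + B + 1) * h)" by simp
      have "2 * (\<rho> + B + 1) * h \<le> 2 * (B + 2)"
      proof -
        have "(\<rho> + B + 1) * h \<le> (\<rho> + B + 1) * \<eta>" using h \<rho> assms by (intro mult_left_mono) auto
        also have "\<dots> \<le> 1 + (B + 1) * 1"
          using \<eta> assms mult_left_mono[of \<eta> 1 "B + 1"] by (simp add: algebra_simps)
        finally have "(\<rho> + B + 1) * h \<le> 1 + (B + 1) * 1" .
        then have "2 * ((\<rho> + B + 1) * h) \<le> 2 * (1 + (B + 1) * 1)" by (rule mult_left_mono) simp
        also have "\<dots> = 2 * (B + 2)" by simp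
        finally show ?thesis by (simp only: mult.assoc)
      qed
      then have e1: "exp (2 * (\<rho> + B + 1) * h) \<le> exp (2 * (B + 2))" by simp
      have t0: "\<bar>Im t0\<bar> \<le> pi / 2 - \<eta>" "Re t0 = Re s" using \<eta>pi by (auto simp: t0_def sg_def)
      have "Re (exp t0) \<ge> 0" using t0 \<eta> by (intro Re_exp_nonneg) auto
      then have f: "norm (bessel_K \<nu> t0) \<le> C0" if "\<nu> = \<kappa> \<or> \<nu> = \<kappa> + 1" for \<nu>
        using far[OF that t0] C0(1) by (auto intro: order_trans simp: mult_le_cancel_left1)
      have "(norm (bessel_K \<kappa> s))\<^sup>2 \<le> ?S s" by simp
      also have "\<dots> \<le> (C0\<^sup>2 + C0\<^sup>2) * exp (2 * (B + 2))"
        by (rule order_trans[OF S]) (intro mult_mono add_mono power_mono f e1, auto)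
      also have "\<dots> \<le> (2 * C0 * exp (B + 2))\<^sup>2"
        by (simp add: power_mult_distrib exp_double[symmetric])
      finally have "norm (bessel_K \<kappa> s) \<le> 2 * C0 * exp (B + 2)"
        using C0(1) by (auto intro: power2_le_imp_le)
      also have "\<dots> \<le> C * exp (- Re (exp s))"
      proof -
        have "Re (exp s) = \<rho> * cos \<bar>Im s\<bar>" by (simp add: Re_exp \<rho>_def)
        also have "\<dots> \<le> \<rho> * cos (pi / 2 - \<eta>)"
          using False s \<rho> \<eta>pi by (intro mult_left_mono cos_monotone_0_pi_le) auto
        also have "\<dots> = \<rho> * sin \<eta>" by (simp add: cos_diff)
        also have "\<dots> \<le> \<rho> * \<eta>" using \<rho> \<eta> by (intro mult_left_mono sin_x_le_x) auto
        also have "\<dots> \<le> 1" by (rule \<eta>)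
        finally have "exp (B + 2) \<le> exp (B + 3) * exp (- Re (exp s))"
          by (simp add: exp_add[symmetric])
        then show ?thesis using C0(1) by (simp add: C_def)
      qed
      finally show ?thesis .
    qed
  qed
  moreover have "C > 0" using C0(1) by (simp add: C_def)
  ultimately show ?thesis by blast
qed

lemma bessel_K_decay:
  "\<exists>C>0. \<forall>s. \<bar>Im s\<bar> \<le> pi / 2 \<longrightarrow> \<sigma>\<^sub>0 \<le> Re s \<longrightarrow> norm (bessel_K \<nu> s) \<le> C * exp (- Re (exp s))"
proof -
  obtain C where C: "C > 0" "\<And>\<kappa> s. \<kappa> \<notin> \<int> \<Longrightarrow> norm \<kappa> \<le> norm \<nu> + 1 \<Longrightarrow> \<bar>Im s\<bar> \<le> pi / 2 \<Longrightarrow> \<sigma>\<^sub>0 \<le> Re s \<Longrightarrow>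
     norm (bessel_K \<kappa> s) \<le> C * exp (- Re (exp s))"
    using bessel_K_decay_nonint[of "norm \<nu> + 1" \<sigma>\<^sub>0] by auto
  have "norm (bessel_K \<nu> s) \<le> C * exp (- Re (exp s))" if "\<bar>Im s\<bar> \<le> pi / 2" "\<sigma>\<^sub>0 \<le> Re s" for s
  proof (rule tendsto_upperbound)
    show "((\<lambda>\<kappa>. norm (bessel_K \<kappa> s)) \<longlongrightarrow> norm (bessel_K \<nu> s)) (at \<nu>)" by (intro tendsto_intros)
    have "\<forall>\<^sub>F \<kappa> in at \<nu>. dist \<kappa> \<nu> < 1" by (auto simp: eventually_at intro!: exI[of _ 1])
    then show "\<forall>\<^sub>F \<kappa> in at \<nu>. norm (bessel_K \<kappa> s) \<le> C * exp (- Re (exp s))"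
      using eventually_nonint
    proof eventually_elim
      case (elim \<kappa>)
      have "norm \<kappa> \<le> norm \<nu> + 1" using elim(1) norm_triangle_sub[of \<kappa> \<nu>] by (simp add: dist_norm)
      then show ?case using elim that by (intro C(2))
    qed
  qed simp
  with C(1) show ?thesis by blast
qed

section \<open>Behaviour of the Bessel functions at the origin\<close>

lemma norm_quarter_le: "Re s \<le> 0 \<Longrightarrow> norm ((exp s)\<^sup>2 / 4 :: complex) \<le> 1 / 4"
  by (simp add: norm_divide norm_power power_le_one)

lemma bessel_I_small:
  "\<exists>C>0. \<forall>s. Re s \<le> 0 \<longrightarrow> norm (bessel_I \<nu> s) \<le> C * exp (Re (\<nu> * s))"
proof -
  obtain C where C: "C > 0" "\<And>\<nu>' y. norm \<nu>' \<le> norm \<nu> \<Longrightarrow> norm (Phi \<nu>' y) \<le> C * exp (norm y)"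
    using Phi_bound[of "norm \<nu>"] by blast
  have "norm (bessel_I \<nu> s) \<le> (C * exp 1 * exp (- Re \<nu> * ln 2)) * exp (Re (\<nu> * s))" if "Re s \<le> 0" for s
  proof -
    have "norm (Phi \<nu> ((exp s)\<^sup>2 / 4)) \<le> C * exp (norm ((exp s)\<^sup>2 / 4))" by (rule C(2)) simp
    also have "\<dots> \<le> C * exp 1" using norm_quarter_le[OF that] C(1) by (intro mult_left_mono) auto
    finally have 1: "norm (Phi \<nu> ((exp s)\<^sup>2 / 4)) \<le> C * exp 1" .
    have "Re (\<nu> * (s - of_real (ln 2))) = - Re \<nu> * ln 2 + Re (\<nu> * s)" by (simp add: algebra_simps)
    then have 2: "norm (exp (\<nu> * (s - of_real (ln 2)))) = exp (- Re \<nu> * ln 2) * exp (Re (\<nu> * s))"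
      by (simp only: norm_exp_eq_Re exp_add)
    have "norm (bessel_I \<nu> s) = exp (- Re \<nu> * ln 2) * exp (Re (\<nu> * s)) * norm (Phi \<nu> ((exp s)\<^sup>2 / 4))"
      unfolding bessel_I_Phi norm_mult 2 ..
    also have "\<dots> \<le> exp (- Re \<nu> * ln 2) * exp (Re (\<nu> * s)) * (C * exp 1)"
      by (intro mult_left_mono 1) simp
    finally show ?thesis by (simp only: mult_ac)
  qed
  moreover have "C * exp 1 * exp (- Re \<nu> * ln 2) > 0" using C(1) by simp
  ultimately show ?thesis by blast
qed

text \<open>
  On one sheet \<open>z\<^sup>\<nu>\<close> is dominated by \<open>z\<^sup>-\<^sup>\<nu>\<close> near the origin, since the argument of \<open>z\<close> is bounded.
\<close>

lemma exp_Re_mult_flip: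
  assumes "Re \<nu> \<ge> 0" "Re s \<le> 0" "\<bar>Im s\<bar> \<le> pi / 2"
  shows "exp (Re (\<nu> * s)) \<le> exp (pi * \<bar>Im \<nu>\<bar>) * exp (- Re (\<nu> * s))"
proof -
  have "Re \<nu> * Re s \<le> 0" using assms by (simp add: mult_nonneg_nonpos)
  moreover have "\<bar>Im \<nu> * Im s\<bar> \<le> \<bar>Im \<nu>\<bar> * (pi / 2)"
    unfolding abs_mult using assms by (intro mult_left_mono) auto
  ultimately have "Re (\<nu> * s) \<le> pi * \<bar>Im \<nu>\<bar> - Re (\<nu> * s)" by (simp add: abs_le_iff mult.commute)
  then have "exp (Re (\<nu> * s)) \<le> exp (pi * \<bar>Im \<nu>\<bar> - Re (\<nu> * s))" by simp
  then show ?thesis by (simp add: exp_add[symmetric])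
qed

lemma bessel_K_small_nonint:
  assumes "\<nu> \<notin> \<int>" "Re \<nu> \<ge> 0"
  shows "\<exists>C>0. \<forall>s. Re s \<le> 0 \<longrightarrow> \<bar>Im s\<bar> \<le> pi / 2 \<longrightarrow> norm (bessel_K \<nu> s) \<le> C * exp (- Re (\<nu> * s))"
proof -
  obtain C1 where C1: "C1 > 0" "\<And>s. Re s \<le> 0 \<Longrightarrow> norm (bessel_I (- \<nu>) s) \<le> C1 * exp (Re (- \<nu> * s))"
    using bessel_I_small[of "- \<nu>"] by blast
  obtain C2 where C2: "C2 > 0" "\<And>s. Re s \<le> 0 \<Longrightarrow> norm (bessel_I \<nu> s) \<le> C2 * exp (Re (\<nu> * s))"
    using bessel_I_small[of \<nu>] by blast
  define c where "c = norm (of_real (pi / 2) / sin (\<nu> * of_real pi))"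
  define C where "C = (c + 1) * (C1 + C2 * exp (pi * \<bar>Im \<nu>\<bar>))"
  have c: "c \<ge> 0" by (simp add: c_def)
  have "norm (bessel_K \<nu> s) \<le> C * exp (- Re (\<nu> * s))" if s: "Re s \<le> 0" "\<bar>Im s\<bar> \<le> pi / 2" for s
  proof -
    have "bessel_K \<nu> s = (of_real (pi / 2) / sin (\<nu> * of_real pi)) * (bessel_I (- \<nu>) s - bessel_I \<nu> s)"
      unfolding bessel_K_nonint[OF assms(1)] by simp
    then have "norm (bessel_K \<nu> s) = c * norm (bessel_I (- \<nu>) s - bessel_I \<nu> s)"
      by (simp only: norm_mult c_def)
    also have "\<dots> \<le> (c + 1) * (C1 * exp (- Re (\<nu> * s)) + C2 * (exp (pi * \<bar>Im \<nu>\<bar>) * exp (- Re (\<nu> * s))))"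
    proof (intro mult_mono)
      have "norm (bessel_I \<nu> s) \<le> C2 * exp (Re (\<nu> * s))" by (rule C2(2)[OF s(1)])
      also have "\<dots> \<le> C2 * (exp (pi * \<bar>Im \<nu>\<bar>) * exp (- Re (\<nu> * s)))"
        using C2(1) by (intro mult_left_mono exp_Re_mult_flip assms s) auto
      finally show "norm (bessel_I (- \<nu>) s - bessel_I \<nu> s) \<le>
          C1 * exp (- Re (\<nu> * s)) + C2 * (exp (pi * \<bar>Im \<nu>\<bar>) * exp (- Re (\<nu> * s)))"
        using C1(2)[OF s(1)] norm_triangle_ineq4[of "bessel_I (- \<nu>) s" "bessel_I \<nu> s"] by simp
    qed (use c in auto)
    also have "\<dots> = C * exp (- Re (\<nu> * s))" by (simp add: C_def algebra_simps)
    finally show ?thesis .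
  qed
  moreover have "C > 0" using c C1(1) C2(1) by (simp add: C_def add_nonneg_pos add_pos_pos)
  ultimately show ?thesis by blast
qed

text \<open>
  By the definition as a limit, \<open>K\<^sub>0\<close> is minus the derivative of \<open>I\<^sub>\<kappa>\<close> with respect to the order at
  \<open>\<kappa> = 0\<close>.  Differentiating the power yields the logarithm; the derivative of \<open>Phi\<close> is bounded by
  Cauchy's inequality.
\<close>

lemma bessel_K_0_log:
  "\<exists>C>0. \<forall>s. Re s \<le> 0 \<longrightarrow> norm (bessel_K 0 s + (s - of_real (ln 2)) * Phi 0 ((exp s)\<^sup>2 / 4)) \<le> C"
proof -
  obtain C where C: "C > 0" "\<And>\<nu> y. norm \<nu> \<le> 1 \<Longrightarrow> norm (Phi \<nu> y) \<le> C * exp (norm y)"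
    using Phi_bound[of 1] by blast
  have "norm (bessel_K 0 s + (s - of_real (ln 2)) * Phi 0 ((exp s)\<^sup>2 / 4)) \<le> C * exp 1" if s: "Re s \<le> 0" for s
  proof -
    let ?y = "(exp s)\<^sup>2 / 4" and ?t = "s - of_real (ln 2)"
    define D where "D = deriv (\<lambda>\<kappa>. Phi \<kappa> ?y) 0"
    have D: "((\<lambda>\<kappa>. Phi \<kappa> ?y) has_field_derivative D) (at 0)"
      unfolding D_def by (rule holomorphic_derivI[OF Phi_holomorphic_order]) auto
    have "norm ((deriv ^^ 1) (\<lambda>\<kappa>. Phi \<kappa> ?y) 0) \<le> fact 1 * (C * exp 1) / 1 ^ 1"
    proof (rule Cauchy_inequality)
      show "(\<lambda>\<kappa>. Phi \<kappa> ?y) holomorphic_on ball 0 1"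
        by (rule holomorphic_on_subset[OF Phi_holomorphic_order]) simp
      show "continuous_on (cball 0 1) (\<lambda>\<kappa>. Phi \<kappa> ?y)"
        by (intro holomorphic_on_imp_continuous_on holomorphic_on_subset[OF Phi_holomorphic_order]) simp
      fix x :: complex assume "norm (0 - x) = 1"
      then have "norm (Phi x ?y) \<le> C * exp (norm ?y)" by (intro C(2)) simp
      also have "\<dots> \<le> C * exp 1" using norm_quarter_le[OF s] C(1) by (intro mult_left_mono) auto
      finally show "norm (Phi x ?y) \<le> C * exp 1" .
    qed simp
    then have nD: "norm D \<le> C * exp 1" by (simp add: D_def)
    have D': "((\<lambda>\<kappa>. Phi (- \<kappa>) ?y) has_field_derivative - D) (at 0)"
    proof -
      have "(uminus has_field_derivative - 1) (at (0::complex))" by (auto intro!: derivative_eq_intros)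
      from DERIV_chain2[of "\<lambda>\<kappa>. Phi \<kappa> ?y" D uminus 0 "-1" UNIV, OF _ this] D show ?thesis by simp
    qed
    have N: "((\<lambda>\<kappa>. of_real (pi / 2) * (bessel_I (- \<kappa>) s - bessel_I \<kappa> s)) has_field_derivative
        of_real (pi / 2) * ((- ?t * Phi 0 ?y - D) - (?t * Phi 0 ?y + D))) (at 0)"
      unfolding bessel_I_Phi
      by (rule derivative_eq_intros D D' refl | simp)+
    have S: "((\<lambda>\<kappa>. sin (\<kappa> * of_real pi)) has_field_derivative of_real pi) (at (0::complex))"
      by (auto intro!: derivative_eq_intros)
    have "((\<lambda>\<kappa>. of_real (pi / 2) * (bessel_I (- \<kappa>) s - bessel_I \<kappa> s) / sin (\<kappa> * of_real pi)) \<longlongrightarrow>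
        of_real (pi / 2) * ((- ?t * Phi 0 ?y - D) - (?t * Phi 0 ?y + D)) / of_real pi) (at 0)"
      by (rule lhopital_complex_simple[OF N S]) auto
    then have "Lim (at 0) (\<lambda>\<kappa>. of_real (pi / 2) * (bessel_I (- \<kappa>) s - bessel_I \<kappa> s) / sin (\<kappa> * of_real pi))
        = of_real (pi / 2) * ((- ?t * Phi 0 ?y - D) - (?t * Phi 0 ?y + D)) / of_real pi"
      by (rule tendsto_Lim[rotated]) simp
    then have "bessel_K 0 s = of_real (pi / 2) * ((- ?t * Phi 0 ?y - D) - (?t * Phi 0 ?y + D)) / of_real pi"
      by (simp only: bessel_K_def Let_def Ints_0 if_True)
    also have "of_real (pi / 2) = of_real pi / (2 :: complex)" by simp
    also have "of_real pi / 2 * ((- ?t * Phi 0 ?y - D) - (?t * Phi 0 ?y + D)) / of_real pi = - (?t * Phi 0 ?y) - D"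
    proof -
      have "p / 2 * ((- t * x - d) - (t * x + d)) / p = - (t * x) - d" if "p \<noteq> 0" for p t x d :: complex
        using that by (simp add: field_simps)
      note q = this
      show ?thesis by (rule q) simp
    qed
    finally have "bessel_K 0 s = - (?t * Phi 0 ?y) - D" .
    moreover have "k = - x - d \<Longrightarrow> k + x = - d" for k x d :: complex by simp
    ultimately have "bessel_K 0 s + ?t * Phi 0 ?y = - D" by blast
    then show ?thesis using nD by simp
  qed
  moreover have "C * exp 1 > 0" using C(1) by simp
  ultimately show ?thesis by blast
qed

lemma Phi_0_near_1: "\<exists>\<sigma>\<le>0. \<forall>s. Re s \<le> \<sigma> \<longrightarrow> norm (Phi 0 ((exp s)\<^sup>2 / 4) - 1) \<le> 1 / 2"
proof -
  have "isCont (Phi 0) 0" by (rule DERIV_isCont[OF Phi_deriv])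
  then have "((\<lambda>y. Phi 0 y) \<longlongrightarrow> Phi 0 0) (at 0)" by (simp add: isCont_def)
  then obtain d where d: "d > 0" "\<And>y. y \<noteq> 0 \<Longrightarrow> norm y < d \<Longrightarrow> norm (Phi 0 y - Phi 0 0) < 1 / 2"
    unfolding LIM_eq by (metis diff_zero half_gt_zero zero_less_one)
  define \<sigma> where "\<sigma> = min 0 (ln d / 2)"
  have "norm (Phi 0 ((exp s)\<^sup>2 / 4) - 1) \<le> 1 / 2" if "Re s \<le> \<sigma>" for s
  proof -
    have "norm ((exp s)\<^sup>2 / 4) = exp (2 * Re s) / 4" by (simp add: norm_divide norm_power exp_double)
    also have "\<dots> \<le> exp (ln d) / 4" using that by (auto simp: \<sigma>_def)
    also have "\<dots> < d" using d(1) by simp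
    finally show ?thesis using d(2)[of "(exp s)\<^sup>2 / 4"] by (simp add: Phi_0)
  qed
  then show ?thesis by (intro exI[of _ \<sigma>]) (auto simp: \<sigma>_def)
qed

text \<open>
  Near the origin, and on every sheet, \<open>\<bar>K\<^sub>0(z)\<bar>\<close> is comparable with \<open>1 + \<bar>log z\<bar>\<close>.  The lower bound replaces, for \<open>\<mu> = 0\<close>, the
  compensation of \<open>z\<^sup>-\<^sup>\<mu>\<close> against \<open>z\<^sup>\<mu>\<close> that is available for the other orders.
\<close>

lemma bessel_K_0_bounds:
  "\<exists>C>0. \<exists>\<sigma>\<le>0. \<forall>s. Re s \<le> \<sigma> \<longrightarrow> norm (bessel_K 0 s) \<le> C * (1 + norm s) \<and> 1 + norm s \<le> C * norm (bessel_K 0 s)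
     \<and> 1 / 2 \<le> norm (bessel_I 0 s)"
proof -
  obtain C where C: "C > 0" "\<And>s. Re s \<le> 0 \<Longrightarrow> norm (bessel_K 0 s + (s - of_real (ln 2)) * Phi 0 ((exp s)\<^sup>2 / 4)) \<le> C"
    using bessel_K_0_log by blast
  obtain \<sigma>0 where \<sigma>0: "\<sigma>0 \<le> 0" "\<And>s. Re s \<le> \<sigma>0 \<Longrightarrow> norm (Phi 0 ((exp s)\<^sup>2 / 4) - 1) \<le> 1 / 2"
    using Phi_0_near_1 by blast
  define \<sigma> where "\<sigma> = min \<sigma>0 (- (4 * C + 6))"
  have "norm (bessel_K 0 s) \<le> (C + 8) * (1 + norm s) \<and> 1 + norm s \<le> (C + 8) * norm (bessel_K 0 s)
     \<and> 1 / 2 \<le> norm (bessel_I 0 s)" if s: "Re s \<le> \<sigma>" for s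
  proof -
    define P where "P = norm (Phi 0 ((exp s)\<^sup>2 / 4))"
    define t where "t = norm (s - of_real (ln 2))"
    have "Re s \<le> 0" using s \<sigma>0 by (simp add: \<sigma>_def)
    then have K: "norm (bessel_K 0 s + (s - of_real (ln 2)) * Phi 0 ((exp s)\<^sup>2 / 4)) \<le> C" by (rule C(2))
    have "norm (Phi 0 ((exp s)\<^sup>2 / 4) - 1) \<le> 1 / 2" using s by (intro \<sigma>0(2)) (simp add: \<sigma>_def)
    then have P: "1 / 2 \<le> P" "P \<le> 3 / 2"
      using norm_triangle_ineq2[of "Phi 0 ((exp s)\<^sup>2 / 4)" 1] norm_triangle_ineq3[of "Phi 0 ((exp s)\<^sup>2 / 4)" 1]
      by (auto simp: P_def)
    have "norm (of_real (ln 2) :: complex) = ln 2" by simp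
    moreover have "ln 2 \<le> (1::real)" using ln_add_one_self_le_self[of 1] by simp
    ultimately have t: "norm s - 1 \<le> t" "t \<le> norm s + 1"
      using norm_triangle_ineq2[of s "of_real (ln 2)"] norm_triangle_ineq4[of s "of_real (ln 2)"] by (auto simp: t_def)
    have t0: "t \<ge> 0" by (simp add: t_def)
    have "Re s \<le> - (4 * C + 6)" using s by (simp add: \<sigma>_def)
    then have ns: "norm s \<ge> 4 * C + 6" using abs_Re_le_cmod[of s] by linarith
    have tP: "norm ((s - of_real (ln 2)) * Phi 0 ((exp s)\<^sup>2 / 4)) = t * P" by (simp add: norm_mult t_def P_def)
    have u: "norm (bessel_K 0 s) \<le> C + t * P" and l: "t * P - C \<le> norm (bessel_K 0 s)"
      using K norm_triangle_ineq2[of "bessel_K 0 s" "- ((s - of_real (ln 2)) * Phi 0 ((exp s)\<^sup>2 / 4))"]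
        norm_triangle_ineq3[of "bessel_K 0 s" "- ((s - of_real (ln 2)) * Phi 0 ((exp s)\<^sup>2 / 4))"] tP
      by auto
    have "t * P \<le> (norm s + 1) * (3 / 2)" using t P t0 by (intro mult_mono) auto
    then have 1: "norm (bessel_K 0 s) \<le> (C + 8) * (1 + norm s)"
    proof -
      have "0 \<le> C * norm s" using C(1) by simp
      moreover have "t * P \<le> 3 / 2 * norm s + 3 / 2" using \<open>t * P \<le> _\<close> by (simp add: distrib_right)
      ultimately have "norm (bessel_K 0 s) \<le> C + C * norm s + 8 + 8 * norm s"
        using u norm_ge_zero[of s] by linarith
      then show ?thesis by (simp add: algebra_simps)
    qed
    have "t * P \<ge> (norm s - 1) * (1 / 2)" using t P t0 by (intro mult_mono) auto
    then have "norm (bessel_K 0 s) \<ge> norm s / 4" using l ns C(1) by simp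
    then have "1 + norm s \<le> 8 * norm (bessel_K 0 s)" using ns C(1) by simp
    then have 2: "1 + norm s \<le> (C + 8) * norm (bessel_K 0 s)"
    proof -
      have "0 \<le> C * norm (bessel_K 0 s)" using C(1) by simp
      then show ?thesis using \<open>1 + norm s \<le> 8 * _\<close> by (simp add: algebra_simps)
    qed
    show ?thesis using 1 2 P(1) by (simp add: bessel_I_Phi P_def)
  qed
  then show ?thesis using C(1) \<sigma>0(1) by (intro exI[of _ "C + 8"] conjI exI[of _ \<sigma>]) (auto simp: \<sigma>_def)
qed

lemma norm_mult_exp_bounded:
  assumes "Re s \<le> 0" "\<bar>Im s\<bar> \<le> pi / 2"
  shows "(1 + norm s) * exp (Re s) \<le> 4"
proof -
  have "- Re s \<le> exp (- Re s)" using exp_ge_add_one_self[of "- Re s"] by simp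
  then have "- Re s * exp (Re s) \<le> exp (- Re s) * exp (Re s)" by (intro mult_right_mono) auto
  then have 1: "- Re s * exp (Re s) \<le> 1" by (simp add: exp_add[symmetric])
  have "norm s \<le> \<bar>Re s\<bar> + \<bar>Im s\<bar>" by (rule cmod_le)
  then have "1 + norm s \<le> 3 - Re s" using assms pi_less_4 by linarith
  then have "(1 + norm s) * exp (Re s) \<le> (3 - Re s) * exp (Re s)" by (intro mult_right_mono) auto
  also have "\<dots> \<le> 4"
  proof -
    have "exp (Re s) \<le> 1" using assms by simp
    moreover have "(3 - Re s) * exp (Re s) = 3 * exp (Re s) + - Re s * exp (Re s)" by (simp add: algebra_simps)
    ultimately show ?thesis using 1 by linarith
  qed
  finally show ?thesis .
qed

text \<open>
  The Wronskian relation with \<open>I\<^sub>0\<close> and \<open>I\<^sub>1\<close> expresses \<open>z K\<^sub>1\<close> through \<open>K\<^sub>0\<close>.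
\<close>

lemma bessel_K_1_small:
  "\<exists>C>0. \<exists>\<sigma>\<le>0. \<forall>s. Re s \<le> \<sigma> \<longrightarrow> \<bar>Im s\<bar> \<le> pi / 2 \<longrightarrow>
     norm (exp s * bessel_K 1 s) \<le> C \<and> norm (exp s * bessel_K 0 s) \<le> C"
proof -
  obtain C \<sigma> where C: "C > 0" "\<sigma> \<le> 0" and b: "\<And>s. Re s \<le> \<sigma> \<Longrightarrow> norm (bessel_K 0 s) \<le> C * (1 + norm s)"
    "\<And>s. Re s \<le> \<sigma> \<Longrightarrow> 1 / 2 \<le> norm (bessel_I 0 s)"
    using bessel_K_0_bounds by blast
  obtain C1 where C1: "C1 > 0" "\<And>s. Re s \<le> 0 \<Longrightarrow> norm (bessel_I 1 s) \<le> C1 * exp (Re (1 * s))"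
    using bessel_I_small[of 1] by blast
  have "norm (exp s * bessel_K 1 s) \<le> 2 * (1 + C * 4 * C1) + C * 4 \<and> norm (exp s * bessel_K 0 s) \<le> 2 * (1 + C * 4 * C1) + C * 4"
    if s: "Re s \<le> \<sigma>" "\<bar>Im s\<bar> \<le> pi / 2" for s
  proof -
    have s0: "Re s \<le> 0" using s C by simp
    have "norm (exp s * bessel_K 0 s) \<le> exp (Re s) * (C * (1 + norm s))"
      unfolding norm_mult norm_exp_eq_Re by (intro mult_left_mono b s) simp
    also have "\<dots> = C * ((1 + norm s) * exp (Re s))" by simp
    also have "\<dots> \<le> C * 4" using C by (intro mult_left_mono norm_mult_exp_bounded s0 s) auto
    finally have 1: "norm (exp s * bessel_K 0 s) \<le> C * 4" .
    have "norm (bessel_I 1 s) \<le> C1 * exp (Re s)" using C1(2)[OF s0] by simp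
    also have "\<dots> \<le> C1" using C1(1) s0 by (simp add: mult_le_cancel_left2)
    finally have "norm (exp s * bessel_K 0 s * bessel_I 1 s) \<le> C * 4 * C1"
      unfolding norm_mult[of "exp s * bessel_K 0 s"] using 1 C by (intro mult_mono) auto
    moreover have "exp s * bessel_K 1 s * bessel_I 0 s = 1 - exp s * bessel_K 0 s * bessel_I 1 s"
      using bessel_KI_wronskian[of s 0] by (simp add: algebra_simps)
    ultimately have "norm (exp s * bessel_K 1 s * bessel_I 0 s) \<le> 1 + C * 4 * C1"
      using norm_triangle_ineq4[of 1 "exp s * bessel_K 0 s * bessel_I 1 s"] by simp
    moreover have "norm (exp s * bessel_K 1 s) * (1 / 2) \<le> norm (exp s * bessel_K 1 s) * norm (bessel_I 0 s)"
      by (intro mult_left_mono b s) simp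
    ultimately have "norm (exp s * bessel_K 1 s) * (1 / 2) \<le> 1 + C * 4 * C1"
      unfolding norm_mult[of _ "bessel_I 0 s"] by linarith
    moreover have "x * (1 / 2) \<le> y \<Longrightarrow> x \<le> 2 * y" for x y :: real by linarith
    ultimately have "norm (exp s * bessel_K 1 s) \<le> 2 * (1 + C * 4 * C1)" by blast
    moreover have "0 \<le> C * 4 * C1" using C C1 by simp
    moreover have "x \<le> 2 * (1 + q) + C * 4 \<and> y \<le> 2 * (1 + q) + C * 4"
      if "x \<le> 2 * (1 + q)" "0 \<le> q" "y \<le> C * 4" for x y q
      using that C by auto
    ultimately show ?thesis using 1 by blast
  qed
  moreover have "2 * (1 + C * 4 * C1) + C * 4 > 0" using C C1 by (simp add: add_pos_pos)
  ultimately show ?thesis using C(2) by blast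
qed

lemma bessel_K_small_nat:
  "\<exists>C>0. \<exists>\<sigma>\<le>0. \<forall>s. Re s \<le> \<sigma> \<longrightarrow> \<bar>Im s\<bar> \<le> pi / 2 \<longrightarrow>
     norm (exp (of_nat (Suc n) * s) * bessel_K (of_nat (Suc n)) s) \<le> C \<and> norm (exp (of_nat n * s + s) * bessel_K (of_nat n) s) \<le> C"
proof (induction n)
  case 0
  show ?case using bessel_K_1_small by simp
next
  case (Suc n)
  then obtain C \<sigma> where C: "C > 0" "\<sigma> \<le> 0" and b: "\<And>s. Re s \<le> \<sigma> \<Longrightarrow> \<bar>Im s\<bar> \<le> pi / 2 \<Longrightarrow>
     norm (exp (of_nat (Suc n) * s) * bessel_K (of_nat (Suc n)) s) \<le> C"
     "\<And>s. Re s \<le> \<sigma> \<Longrightarrow> \<bar>Im s\<bar> \<le> pi / 2 \<Longrightarrow> norm (exp (of_nat n * s + s) * bessel_K (of_nat n) s) \<le> C"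
    by blast
  let ?n = "of_nat (Suc n) :: complex"
  have "norm (exp (of_nat (Suc (Suc n)) * s) * bessel_K (of_nat (Suc (Suc n))) s) \<le> C * (1 + 2 * real (Suc n)) \<and>
      norm (exp (?n * s + s) * bessel_K ?n s) \<le> C * (1 + 2 * real (Suc n))"
    if s: "Re s \<le> \<sigma>" "\<bar>Im s\<bar> \<le> pi / 2" for s
  proof -
    have e1: "norm (exp s) \<le> 1" using s C by simp
    have "exp s * bessel_K (?n + 1) s = exp s * bessel_K (?n - 1) s + 2 * ?n * bessel_K ?n s"
      using bessel_K_recurrence[of s ?n] by (simp only: algebra_simps)
    then have "exp (?n * s) * (exp s * bessel_K (?n + 1) s)
        = exp (?n * s) * (exp s * bessel_K (?n - 1) s) + 2 * ?n * (exp (?n * s) * bessel_K ?n s)"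
      by (simp only: distrib_left mult_ac)
    moreover have "exp (of_nat (Suc (Suc n)) * s) = exp (?n * s) * exp s"
      unfolding exp_add[symmetric] by (simp add: algebra_simps)
    moreover have "exp (?n * s) * exp s = exp s * exp (of_nat n * s + s)"
      unfolding exp_add[symmetric] by (simp add: algebra_simps)
    moreover have "of_nat (Suc (Suc n)) = ?n + 1" "?n - 1 = of_nat n" by simp_all
    ultimately have "exp (of_nat (Suc (Suc n)) * s) * bessel_K (of_nat (Suc (Suc n))) s
        = exp s * (exp (of_nat n * s + s) * bessel_K (of_nat n) s) + 2 * ?n * (exp (?n * s) * bessel_K ?n s)"
      by (simp only: mult.assoc[symmetric])
    also have "norm \<dots> \<le> norm (exp s) * norm (exp (of_nat n * s + s) * bessel_K (of_nat n) s)
         + norm (2 * ?n) * norm (exp (?n * s) * bessel_K ?n s)"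
      by (rule order_trans[OF norm_triangle_ineq]) (simp only: norm_mult order_refl mult.assoc)
    also have "\<dots> \<le> 1 * C + norm (2 * ?n) * C"
      by (intro add_mono mult_mono b s e1 order_refl) (use C in auto)
    also have "norm (2 * ?n) = 2 * real (Suc n)" by (simp only: norm_mult norm_of_nat norm_numeral)
    finally have 1: "norm (exp (of_nat (Suc (Suc n)) * s) * bessel_K (of_nat (Suc (Suc n))) s) \<le> C * (1 + 2 * real (Suc n))"
      by (simp add: algebra_simps)
    have "exp (?n * s + s) * bessel_K ?n s = exp s * (exp (?n * s) * bessel_K ?n s)" by (simp add: exp_add)
    also have "norm \<dots> \<le> 1 * C" unfolding norm_mult[of "exp s"] by (intro mult_mono e1 b s) auto
    also have "\<dots> \<le> C * (1 + 2 * real (Suc n))" using C by simp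
    finally show ?thesis using 1 by simp
  qed
  moreover have "C * (1 + 2 * real (Suc n)) > 0" using C by (simp add: add_pos_nonneg)
  ultimately show ?case using C(2) by (intro exI[of _ "C * (1 + 2 * real (Suc n))"] conjI exI[of _ \<sigma>]) auto
qed

text \<open>
  Off the integers this is read off the definition.  Integer orders follow from \<open>K\<^sub>0\<close> and \<open>K\<^sub>1\<close> by the
  upward recurrence, in which the dominant terms add up without loss.
\<close>

lemma bessel_K_small:
  assumes "\<nu> \<noteq> 0" "Re \<nu> \<ge> 0"
  shows "\<exists>C>0. \<exists>\<sigma>\<le>0. \<forall>s. Re s \<le> \<sigma> \<longrightarrow> \<bar>Im s\<bar> \<le> pi / 2 \<longrightarrow> norm (bessel_K \<nu> s) \<le> C * exp (- Re (\<nu> * s))"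
proof (cases "\<nu> \<in> \<int>")
  case False
  then show ?thesis using bessel_K_small_nonint[OF False assms(2)] by blast
next
  case True
  then obtain k where k: "\<nu> = of_int k" by (rule Ints_cases)
  with assms have "k > 0" by (simp add: order_less_le)
  then obtain n where n: "\<nu> = of_nat (Suc n)" using k by (metis gr0_implies_Suc of_int_of_nat_eq zero_less_imp_eq_int)
  obtain C \<sigma> where C: "C > 0" "\<sigma> \<le> 0" and b: "\<And>s. Re s \<le> \<sigma> \<Longrightarrow> \<bar>Im s\<bar> \<le> pi / 2 \<Longrightarrow>
     norm (exp (\<nu> * s) * bessel_K \<nu> s) \<le> C"
    using bessel_K_small_nat[of n] unfolding n by blast
  have "norm (bessel_K \<nu> s) \<le> C * exp (- Re (\<nu> * s))" if "Re s \<le> \<sigma>" "\<bar>Im s\<bar> \<le> pi / 2" for s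
  proof -
    have "bessel_K \<nu> s = exp (\<nu> * s) * bessel_K \<nu> s * exp (- (\<nu> * s))"
      by (simp add: mult.commute[of "exp (\<nu> * s)"] mult.assoc exp_add[symmetric])
    then have "norm (bessel_K \<nu> s) = norm (exp (\<nu> * s) * bessel_K \<nu> s) * exp (- Re (\<nu> * s))"
      by (metis norm_mult norm_exp_eq_Re uminus_complex.sel(1))
    also have "\<dots> \<le> C * exp (- Re (\<nu> * s))" by (intro mult_right_mono b that) simp
    finally show ?thesis .
  qed
  then show ?thesis using C by blast
qed

section \<open>Monodromy\<close>

text \<open>
  The second component is \<open>z K\<^sub>\<mu>\<^sub>+\<^sub>1\<close>.  The factor \<open>z\<close> gives it the same monodromy as \<open>K\<^sub>\<mu>\<close>, up to the sign
  of the \<open>I\<close>-term, and makes the Wronskian of the pairs \<open>(K\<^sub>\<mu>, z K\<^sub>\<mu>\<^sub>+\<^sub>1)\<close> and \<open>(I\<^sub>\<mu>, - z I\<^sub>\<mu>\<^sub>+\<^sub>1)\<close> constant.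
\<close>

definition K_size :: "complex \<Rightarrow> complex \<Rightarrow> real" where
  "K_size \<mu> s = norm (bessel_K \<mu> s) + norm (exp s * bessel_K (\<mu> + 1) s)"

definition I_size :: "complex \<Rightarrow> complex \<Rightarrow> real" where
  "I_size \<mu> s = norm (bessel_I \<mu> s) + norm (exp s * bessel_I (\<mu> + 1) s)"

lemma K_size_nonneg: "0 \<le> K_size \<mu> s" and I_size_nonneg: "0 \<le> I_size \<mu> s"
  by (auto simp: K_size_def I_size_def)

lemma sheet_exists:
  obtains m :: int and s0 where "s = s0 + of_int m * (\<i> * of_real pi)" "\<bar>Im s0\<bar> \<le> pi / 2" "Re s0 = Re s"
proof -
  define m where "m = round (Im s / pi)"
  define s0 where "s0 = s - of_int m * (\<i> * of_real pi)"
  have "\<bar>of_int m - Im s / pi\<bar> \<le> 1 / 2" unfolding m_def by (rule of_int_round_abs_le)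
  then have "\<bar>of_int m - Im s / pi\<bar> * pi \<le> 1 / 2 * pi" by (intro mult_right_mono) auto
  also have "\<bar>of_int m - Im s / pi\<bar> * pi = \<bar>(of_int m - Im s / pi) * pi\<bar>" by (simp add: abs_mult)
  also have "(of_int m - Im s / pi) * pi = - Im s0" by (simp add: s0_def field_simps)
  finally have "\<bar>Im s0\<bar> \<le> pi / 2" by simp
  then show thesis by (intro that[of s0 m]) (auto simp: s0_def)
qed

text \<open>
  After \<open>m\<close> half-turns the pair \<open>(F, J)\<close> has been acted on by the \<open>m\<close>-th power of a triangular matrix
  with the entries \<open>exp (\<mp> \<i> \<pi> \<mu>)\<close> on the diagonal.  The off-diagonal entry \<open>U\<close> depends on \<open>m\<close> and
  \<open>\<mu>\<close> alone, so one \<open>U\<close> serves all functions with this monodromy.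
\<close>

lemma monodromy_iterate:
  fixes m :: int and \<mu> :: complex
  shows "\<exists>U. (\<mu> = 0 \<longrightarrow> U = of_int m) \<and> (\<forall>T F J s.
     (\<forall>s. Re s \<le> T \<longrightarrow> F (s + \<i> * of_real pi) = exp (- (\<i> * of_real pi * \<mu>)) * F s + J s) \<longrightarrow>
     (\<forall>s. Re s \<le> T \<longrightarrow> J (s + \<i> * of_real pi) = exp (\<i> * of_real pi * \<mu>) * J s) \<longrightarrow> Re s \<le> T \<longrightarrow>
       F (s + of_int m * (\<i> * of_real pi)) = exp (- (of_int m * (\<i> * of_real pi * \<mu>))) * F s + U * J s \<and>
       J (s + of_int m * (\<i> * of_real pi)) = exp (of_int m * (\<i> * of_real pi * \<mu>)) * (J s :: complex))"
  (is "\<exists>U. ?P m U")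
proof (induction m rule: int_induct[where k=0])
  case base
  show ?case by (intro exI[of _ 0]) simp
next
  case (step1 m)
  then obtain U where U: "?P m U" by blast
  let ?w = "\<i> * of_real pi :: complex"
  have "?P (m + 1) (exp (- (?w * \<mu>)) * U + exp (of_int m * (?w * \<mu>)))"
  proof (intro conjI allI impI)
    assume "\<mu> = 0" then show "exp (- (?w * \<mu>)) * U + exp (of_int m * (?w * \<mu>)) = of_int (m + 1)"
      using U by simp
  next
    fix T :: real and F J :: "complex \<Rightarrow> complex" and s :: complex
    assume F: "\<forall>s. Re s \<le> T \<longrightarrow> F (s + ?w) = exp (- (?w * \<mu>)) * F s + J s"
      and J: "\<forall>s. Re s \<le> T \<longrightarrow> J (s + ?w) = exp (?w * \<mu>) * J s" and s: "Re s \<le> T"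
    have IH: "F (s + of_int m * ?w) = exp (- (of_int m * (?w * \<mu>))) * F s + U * J s"
      "J (s + of_int m * ?w) = exp (of_int m * (?w * \<mu>)) * J s" using U F J s by blast+
    have eq: "s + of_int (m + 1) * ?w = (s + of_int m * ?w) + ?w" by (simp add: algebra_simps)
    have R: "Re (s + of_int m * ?w) \<le> T" using s by simp
    have e: "exp (- (of_int (m + 1) * (?w * \<mu>))) = exp (- (?w * \<mu>)) * exp (- (of_int m * (?w * \<mu>)))"
      "exp (of_int (m + 1) * (?w * \<mu>)) = exp (?w * \<mu>) * exp (of_int m * (?w * \<mu>))"
      unfolding exp_add[symmetric] by (simp_all add: algebra_simps)
    show "F (s + of_int (m + 1) * ?w) = exp (- (of_int (m + 1) * (?w * \<mu>))) * F s
        + (exp (- (?w * \<mu>)) * U + exp (of_int m * (?w * \<mu>))) * J s"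
      unfolding eq F[rule_format, OF R] IH e by (simp only: distrib_left distrib_right mult.assoc add.assoc)
    show "J (s + of_int (m + 1) * ?w) = exp (of_int (m + 1) * (?w * \<mu>)) * J s"
      unfolding eq J[rule_format, OF R] IH e by (simp only: mult.assoc)
  qed
  then show ?case by blast
next
  case (step2 m)
  then obtain U where U: "?P m U" by blast
  let ?w = "\<i> * of_real pi :: complex"
  have "?P (m - 1) (exp (?w * \<mu>) * (U - exp (of_int (m - 1) * (?w * \<mu>))))"
  proof (intro conjI allI impI)
    assume "\<mu> = 0" then show "exp (?w * \<mu>) * (U - exp (of_int (m - 1) * (?w * \<mu>))) = of_int (m - 1)"
      using U by simp
  next
    fix T :: real and F J :: "complex \<Rightarrow> complex" and s :: complex
    assume F: "\<forall>s. Re s \<le> T \<longrightarrow> F (s + ?w) = exp (- (?w * \<mu>)) * F s + J s"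
      and J: "\<forall>s. Re s \<le> T \<longrightarrow> J (s + ?w) = exp (?w * \<mu>) * J s" and s: "Re s \<le> T"
    let ?t = "s + of_int (m - 1) * ?w"
    have IH: "F (s + of_int m * ?w) = exp (- (of_int m * (?w * \<mu>))) * F s + U * J s"
      "J (s + of_int m * ?w) = exp (of_int m * (?w * \<mu>)) * J s" using U F J s by blast+
    have eq: "s + of_int m * ?w = ?t + ?w" by (simp add: algebra_simps)
    have R: "Re ?t \<le> T" using s by simp
    have e1: "exp (?w * \<mu>) * exp (- (?w * \<mu>)) = 1" by (simp add: exp_add[symmetric])
    have e: "exp (- (of_int (m - 1) * (?w * \<mu>))) = exp (?w * \<mu>) * exp (- (of_int m * (?w * \<mu>)))"
      "exp (of_int (m - 1) * (?w * \<mu>)) = exp (- (?w * \<mu>)) * exp (of_int m * (?w * \<mu>))"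
      unfolding exp_add[symmetric] by (simp_all add: algebra_simps)
    have "J ?t = (exp (?w * \<mu>) * exp (- (?w * \<mu>))) * J ?t" unfolding e1 by simp
    also have "\<dots> = exp (- (?w * \<mu>)) * J (?t + ?w)" unfolding J[rule_format, OF R] by (simp only: mult_ac)
    also have "\<dots> = exp (of_int (m - 1) * (?w * \<mu>)) * J s" unfolding eq[symmetric] IH e by (simp only: mult_ac)
    finally show Jt: "J ?t = exp (of_int (m - 1) * (?w * \<mu>)) * J s" .
    have "F ?t = (exp (?w * \<mu>) * exp (- (?w * \<mu>))) * F ?t" unfolding e1 by simp
    also have "\<dots> = exp (?w * \<mu>) * (F (?t + ?w) - J ?t)" unfolding F[rule_format, OF R] by (simp add: mult.assoc)
    also have "\<dots> = exp (- (of_int (m - 1) * (?w * \<mu>))) * F s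
        + exp (?w * \<mu>) * (U - exp (of_int (m - 1) * (?w * \<mu>))) * J s"
      unfolding eq[symmetric] IH Jt e(1) by (simp only: right_diff_distrib left_diff_distrib distrib_left mult.assoc add_diff_eq)
    finally show "F ?t = exp (- (of_int (m - 1) * (?w * \<mu>))) * F s
        + exp (?w * \<mu>) * (U - exp (of_int (m - 1) * (?w * \<mu>))) * J s" .
  qed
  then show ?case by blast
qed

lemma exp_shift_i_pi: "exp (s + \<i> * of_real pi) = - exp (s::complex)"
  by (simp add: exp_add)

lemma exp_i_pi_add_one: "exp (\<i> * of_real pi * (\<mu> + 1)) = - exp (\<i> * of_real pi * \<mu>)"
  "exp (- (\<i> * of_real pi * (\<mu> + 1))) = - exp (- (\<i> * of_real pi * \<mu>))"
  by (simp_all add: distrib_left exp_add exp_diff exp_minus)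

lemma exp_bessel_K_shift:
  "exp (s + \<i> * of_real pi) * bessel_K (\<mu> + 1) (s + \<i> * of_real pi)
    = exp (- (\<i> * of_real pi * \<mu>)) * (exp s * bessel_K (\<mu> + 1) s) + \<i> * of_real pi * (exp s * bessel_I (\<mu> + 1) s)"
  unfolding exp_shift_i_pi bessel_K_shift[of "\<mu> + 1"] exp_i_pi_add_one by (simp add: algebra_simps)

lemma exp_bessel_I_shift:
  "exp (s + \<i> * of_real pi) * bessel_I (\<mu> + 1) (s + \<i> * of_real pi)
    = exp (\<i> * of_real pi * \<mu>) * (exp s * bessel_I (\<mu> + 1) s)"
  unfolding exp_shift_i_pi bessel_I_shift[of "\<mu> + 1"] exp_i_pi_add_one by simp

text \<open>
  The key to uniformity in the number of turns.  On the \<open>m\<close>-th sheet the vector \<open>(K\<^sub>\<mu>, z K\<^sub>\<mu>\<^sub>+\<^sub>1)\<close> equals the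
  diagonal multiplier times its value on the base sheet plus \<open>U\<close> times an \<open>I\<close>-vector.  Taking the cross
  product with the \<open>I\<close>-vector isolates the multiplier, taking it with the base \<open>K\<close>-vector isolates \<open>U\<close>.
  Thus both are bounded by the size of \<open>K\<close> on the \<open>m\<close>-th sheet itself, even if they grow with \<open>m\<close> or if
  they happen to be small.
\<close>

lemma monodromy_multiplier:
  fixes m :: int and \<mu> :: complex
  shows "\<exists>U. (\<mu> = 0 \<longrightarrow> U = of_int m) \<and>
    (\<forall>T F J s. (\<forall>s. Re s \<le> T \<longrightarrow> F (s + \<i> * of_real pi) = exp (- (\<i> * of_real pi * \<mu>)) * F s + J s) \<longrightarrow>
     (\<forall>s. Re s \<le> T \<longrightarrow> J (s + \<i> * of_real pi) = exp (\<i> * of_real pi * \<mu>) * J s) \<longrightarrow> Re s \<le> T \<longrightarrow>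
       F (s + of_int m * (\<i> * of_real pi)) = exp (- (of_int m * (\<i> * of_real pi * \<mu>))) * F s + U * (J s :: complex)) \<and>
    (\<forall>s. norm (exp (- (of_int m * (\<i> * of_real pi * \<mu>)))) \<le> K_size \<mu> (s + of_int m * (\<i> * of_real pi)) * I_size \<mu> s) \<and>
    (\<forall>s. norm U \<le> K_size \<mu> (s + of_int m * (\<i> * of_real pi)) * K_size \<mu> s)"
proof -
  obtain U where U0: "\<mu> = 0 \<longrightarrow> U = of_int m" and U: "\<forall>T F J s.
     (\<forall>s. Re s \<le> T \<longrightarrow> F (s + \<i> * of_real pi) = exp (- (\<i> * of_real pi * \<mu>)) * F s + J s) \<longrightarrow>
     (\<forall>s. Re s \<le> T \<longrightarrow> J (s + \<i> * of_real pi) = exp (\<i> * of_real pi * \<mu>) * J s) \<longrightarrow> Re s \<le> T \<longrightarrow>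
       F (s + of_int m * (\<i> * of_real pi)) = exp (- (of_int m * (\<i> * of_real pi * \<mu>))) * F s + U * (J s :: complex)"
    using monodromy_iterate[of \<mu> m] by blast
  define e where "e = exp (- (of_int m * (\<i> * of_real pi * \<mu>)))"
  have A: "bessel_K \<mu> (s + of_int m * (\<i> * of_real pi)) = e * bessel_K \<mu> s + U * (- (\<i> * of_real pi) * bessel_I \<mu> s)" for s
    unfolding e_def
  proof (rule U[rule_format, where T="Re s" and J="\<lambda>s. - (\<i> * of_real pi) * bessel_I \<mu> s"])
  qed (auto simp: bessel_K_shift bessel_I_shift)
  have B: "exp (s + of_int m * (\<i> * of_real pi)) * bessel_K (\<mu> + 1) (s + of_int m * (\<i> * of_real pi))
      = e * (exp s * bessel_K (\<mu> + 1) s) + U * (\<i> * of_real pi * (exp s * bessel_I (\<mu> + 1) s))" for s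
    unfolding e_def
  proof (rule U[rule_format, where T="Re s" and F="\<lambda>s. exp s * bessel_K (\<mu> + 1) s"
        and J="\<lambda>s. \<i> * of_real pi * (exp s * bessel_I (\<mu> + 1) s)"])
  qed (simp_all only: exp_bessel_K_shift exp_bessel_I_shift mult_ac order_refl)
  have cross: "norm (x * d + y * c) \<le> (norm x + norm y) * (norm c + norm d)" for x y c d :: complex
  proof -
    have "norm (x * d + y * c) \<le> norm x * norm d + norm y * norm c"
      by (rule order_trans[OF norm_triangle_ineq]) (simp add: norm_mult)
    also have "\<dots> \<le> (norm x + norm y) * (norm c + norm d)" by (simp add: algebra_simps)
    finally show ?thesis .
  qed
  have 1: "norm e \<le> K_size \<mu> (s + of_int m * (\<i> * of_real pi)) * I_size \<mu> s" for s
  proof -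
    define a b c d where "a = bessel_K \<mu> s" and "b = exp s * bessel_K (\<mu> + 1) s" and "c = bessel_I \<mu> s" and "d = exp s * bessel_I (\<mu> + 1) s"
    have w: "a * d + b * c = 1" using bessel_KI_wronskian[of s \<mu>] by (simp add: a_def b_def c_def d_def algebra_simps)
    let ?x = "e * a + U * (- (\<i> * of_real pi) * c)" and ?y = "e * b + U * (\<i> * of_real pi * d)"
    have "?x * d + ?y * c = e * (a * d + b * c)" by (simp add: algebra_simps)
    then have "e = ?x * d + ?y * c" using w by simp
    then have "norm e \<le> (norm ?x + norm ?y) * (norm c + norm d)" using cross[of ?x d ?y c] by simp
    then show ?thesis unfolding K_size_def I_size_def A B a_def b_def c_def d_def .
  qed
  have 2: "norm U \<le> K_size \<mu> (s + of_int m * (\<i> * of_real pi)) * K_size \<mu> s" for s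
  proof -
    define a b c d where "a = bessel_K \<mu> s" and "b = exp s * bessel_K (\<mu> + 1) s" and "c = bessel_I \<mu> s" and "d = exp s * bessel_I (\<mu> + 1) s"
    have w: "a * d + b * c = 1" using bessel_KI_wronskian[of s \<mu>] by (simp add: a_def b_def c_def d_def algebra_simps)
    let ?x = "e * a + U * (- (\<i> * of_real pi) * c)" and ?y = "e * b + U * (\<i> * of_real pi * d)"
    have "?x * b + ?y * (- a) = - (U * (\<i> * of_real pi)) * (a * d + b * c)" by (simp add: algebra_simps)
    then have "- (U * (\<i> * of_real pi)) = ?x * b + ?y * (- a)" using w by simp
    then have "norm (- (U * (\<i> * of_real pi))) \<le> (norm ?x + norm ?y) * (norm (- a) + norm b)"
      by (simp only: cross)
    moreover have "norm (- (U * (\<i> * of_real pi))) = norm U * pi" by (simp add: norm_mult)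
    moreover have "norm U * 1 \<le> norm U * pi" using pi_gt3 by (intro mult_left_mono) auto
    ultimately have "norm U \<le> (norm ?x + norm ?y) * (norm a + norm b)" by simp
    then show ?thesis unfolding K_size_def A B a_def b_def c_def d_def .
  qed
  show ?thesis using U0 U 1 2 unfolding e_def by blast
qed

text \<open>
  The maximum principle for functions that descend to a punctured disc.  By periodicity the supremum of
  \<open>\<bar>\<phi> s exp (d s)\<bar>\<close> over a vertical strip is attained, hence attained on the boundary; the factor with
  \<open>d > 0\<close> suppresses the left edge as it moves to the cusp, and afterwards \<open>d\<close> tends to \<open>0\<close>.
\<close>

lemma periodic_half_plane_maximum:
  assumes hol: "\<phi> holomorphic_on {s. Re s < T}" and "\<sigma> < T"
    and per: "\<And>s. Re s < T \<Longrightarrow> \<phi> (s + \<i> * of_real pi) = \<phi> s"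
    and bdd: "\<And>s. Re s \<le> a \<Longrightarrow> norm (\<phi> s) \<le> M"
    and bnd: "\<And>s. Re s = \<sigma> \<Longrightarrow> \<bar>Im s\<bar> \<le> pi / 2 \<Longrightarrow> norm (\<phi> s) \<le> B"
    and s: "Re s \<le> \<sigma>"
  shows "norm (\<phi> s) \<le> B"
proof -
  have "norm (\<phi> (of_real \<sigma>)) \<le> B" by (rule bnd) simp_all
  then have B0: "B \<ge> 0" by (rule order_trans[OF norm_ge_zero])
  have per_int: "\<phi> (s + of_int m * (\<i> * of_real pi)) = \<phi> s" if "Re s < T" for s m
  proof (induction m rule: int_induct[where k=0])
    case (step1 m)
    have eq: "s + of_int (m + 1) * (\<i> * of_real pi) = (s + of_int m * (\<i> * of_real pi)) + \<i> * of_real pi"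
      by (simp add: algebra_simps)
    have "Re (s + of_int m * (\<i> * of_real pi)) < T" using that by simp
    from per[OF this] step1(2) show ?case by (simp only: eq)
  next
    case (step2 m)
    have eq: "s + of_int m * (\<i> * of_real pi) = (s + of_int (m - 1) * (\<i> * of_real pi)) + \<i> * of_real pi"
      by (simp add: algebra_simps)
    have "Re (s + of_int (m - 1) * (\<i> * of_real pi)) < T" using that by simp
    from per[OF this] step2(2) show ?case by (simp only: eq)
  qed simp
  have key: "norm (\<phi> s) * exp (d * Re s) \<le> max (M * exp (d * L)) (B * exp (d * \<sigma>))"
    if d: "d > 0" and L: "L \<le> a" "L < Re s" for d L
  proof -
    define G where "G z = \<phi> z * exp (of_real d * z)" for z
    have nG: "norm (G z) = norm (\<phi> z) * exp (d * Re z)" for z by (simp add: G_def norm_mult)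
    have contG: "continuous_on {z. Re z < T} G" unfolding G_def
      by (intro continuous_intros holomorphic_on_imp_continuous_on hol)
    define Kr where "Kr = cbox (Complex L (- (pi / 2))) (Complex \<sigma> (pi / 2))"
    have Kr: "z \<in> Kr \<longleftrightarrow> L \<le> Re z \<and> Re z \<le> \<sigma> \<and> \<bar>Im z\<bar> \<le> pi / 2" for z
      by (auto simp: Kr_def in_cbox_complex_iff)
    have "compact Kr" "Kr \<noteq> {}"
      using Kr[of "Complex \<sigma> 0"] L s by (auto simp: Kr_def compact_cbox)
    moreover have "continuous_on Kr (\<lambda>z. norm (G z))"
      using \<open>\<sigma> < T\<close> by (intro continuous_on_norm continuous_on_subset[OF contG]) (auto simp: Kr)
    ultimately obtain \<xi> where \<xi>: "\<xi> \<in> Kr" "\<And>z. z \<in> Kr \<Longrightarrow> norm (G z) \<le> norm (G \<xi>)"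
      using continuous_attains_sup[of Kr "\<lambda>z. norm (G z)"] by blast
    have sup: "norm (G z) \<le> norm (G \<xi>)" if "L \<le> Re z" "Re z \<le> \<sigma>" for z
    proof -
      obtain m z0 where z: "z = z0 + of_int m * (\<i> * of_real pi)" "\<bar>Im z0\<bar> \<le> pi / 2" "Re z0 = Re z"
        using sheet_exists[of z] by blast
      have "Re z0 < T" unfolding z(3) using that \<open>\<sigma> < T\<close> by simp
      then have "\<phi> z = \<phi> z0" unfolding z(1) by (rule per_int)
      then have "norm (G z) = norm (G z0)" unfolding nG z(3) by simp
      also have "\<dots> \<le> norm (G \<xi>)" by (rule \<xi>(2)) (use z(2) that in \<open>simp add: Kr z(3)\<close>)
      finally show ?thesis .
    qed
    have "norm (G \<xi>) \<le> max (M * exp (d * L)) (B * exp (d * \<sigma>))"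
    proof (cases "Re \<xi> = L \<or> Re \<xi> = \<sigma>")
      case True
      then show ?thesis
      proof
        assume x: "Re \<xi> = L"
        then have "norm (\<phi> \<xi>) \<le> M" using L by (intro bdd) simp
        then have "norm (G \<xi>) \<le> M * exp (d * L)" unfolding nG x by (rule mult_right_mono) simp
        then show ?thesis by (rule max.coboundedI1)
      next
        assume x: "Re \<xi> = \<sigma>"
        then have "norm (\<phi> \<xi>) \<le> B" using \<xi>(1) by (intro bnd) (simp_all add: Kr)
        then have "norm (G \<xi>) \<le> B * exp (d * \<sigma>)" unfolding nG x by (rule mult_right_mono) simp
        then show ?thesis by (rule max.coboundedI2)
      qed
    next
      case False
      define S where "S = {z. L < Re z} \<inter> {z. Re z < \<sigma>}"
      have opS: "open S" unfolding S_def by (intro open_Int open_halfspace_Re_gt open_halfspace_Re_lt)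
      have conS: "connected S" unfolding S_def
        by (intro convex_connected convex_Int convex_halfspace_Re_gt convex_halfspace_Re_lt)
      have \<xi>S: "\<xi> \<in> S" using False \<xi>(1) by (auto simp: S_def Kr)
      have "G constant_on S"
      proof (rule maximum_modulus_principle[OF _ opS conS opS order_refl \<xi>S])
        show "G holomorphic_on S" unfolding G_def
          using \<open>\<sigma> < T\<close> by (intro holomorphic_intros holomorphic_on_subset[OF hol]) (auto simp: S_def)
        show "norm (G z) \<le> norm (G \<xi>)" if "z \<in> S" for z using that by (intro sup) (auto simp: S_def)
      qed
      then have c: "G z = G \<xi>" if "z \<in> S" for z using that \<xi>S by (auto simp: constant_on_def)
      have "((\<lambda>t. G (of_real t)) \<longlongrightarrow> G (of_real \<sigma>)) (at_left \<sigma>)"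
      proof (rule isCont_tendsto_compose[of _ G])
        show "isCont G (of_real \<sigma>)"
          using contG \<open>\<sigma> < T\<close> by (auto simp: continuous_on_eq_continuous_at open_halfspace_Re_lt)
        show "((\<lambda>t. complex_of_real t) \<longlongrightarrow> of_real \<sigma>) (at_left \<sigma>)" by (intro tendsto_intros)
      qed
      moreover have "\<forall>\<^sub>F t in at_left \<sigma>. G (of_real t) = G \<xi>"
      proof -
        have "L < \<sigma>" using L s by simp
        then have "\<forall>\<^sub>F t in at_left \<sigma>. t \<in> {L<..<\<sigma>}" by (rule eventually_at_left_real)
        then show ?thesis by eventually_elim (rule c, auto simp: S_def)
      qed
      ultimately have "G (of_real \<sigma>) = G \<xi>"
        by (rule tendsto_unique[OF trivial_limit_at_left_real _ tendsto_eventually])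
      then have "norm (G \<xi>) = norm (G (of_real \<sigma>))" by simp
      also have "\<dots> \<le> B * exp (d * \<sigma>)"
        using bnd[of "of_real \<sigma>"] by (simp add: nG mult_right_mono)
      finally show ?thesis by simp
    qed
    then show ?thesis using sup[of s] s L by (simp add: nG)
  qed
  have step: "norm (\<phi> s) * exp (d * Re s) \<le> B * exp (d * \<sigma>)" if d: "d > 0" for d
  proof (rule field_le_epsilon)
    fix e :: real assume e: "e > 0"
    have "((\<lambda>L. M * exp (d * L)) \<longlongrightarrow> M * 0) at_bot"
      using d by (intro tendsto_mult tendsto_const filterlim_compose[OF exp_at_bot]
          filterlim_tendsto_pos_mult_at_bot[OF tendsto_const]) (auto simp: filterlim_ident)
    then have "\<forall>\<^sub>F L in at_bot. M * exp (d * L) < e" using e by (intro order_tendstoD) auto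
    moreover have "\<forall>\<^sub>F L in at_bot. L \<le> a" by (rule eventually_le_at_bot)
    moreover have "\<forall>\<^sub>F L in at_bot. L < Re s" by (rule eventually_gt_at_bot)
    ultimately have "\<forall>\<^sub>F L in at_bot. M * exp (d * L) < e \<and> L \<le> a \<and> L < Re s"
      by eventually_elim auto
    then obtain L where L: "M * exp (d * L) < e" "L \<le> a" "L < Re s"
      using eventually_happens'[OF trivial_limit_at_bot_linorder] by blast
    have "max (M * exp (d * L)) (B * exp (d * \<sigma>)) \<le> B * exp (d * \<sigma>) + e"
    proof (rule max.boundedI)
      have "0 \<le> B * exp (d * \<sigma>)" using B0 by simp
      then show "M * exp (d * L) \<le> B * exp (d * \<sigma>) + e" using L(1) by linarith
    qed (use e in simp)
    then show "norm (\<phi> s) * exp (d * Re s) \<le> B * exp (d * \<sigma>) + e"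
      by (rule order_trans[OF key[OF d L(2,3)]])
  qed
  have "((\<lambda>d. B * exp (d * \<sigma>) - norm (\<phi> s) * exp (d * Re s)) \<longlongrightarrow> B * exp (0 * \<sigma>) - norm (\<phi> s) * exp (0 * Re s)) (at_right 0)"
    by (intro tendsto_intros)
  moreover have "\<forall>\<^sub>F d in at_right (0::real). 0 \<le> B * exp (d * \<sigma>) - norm (\<phi> s) * exp (d * Re s)"
    using eventually_at_right_less[of 0] by eventually_elim (use step in simp)
  ultimately have "0 \<le> B * exp (0 * \<sigma>) - norm (\<phi> s) * exp (0 * Re s)"
    by (intro tendsto_lowerbound) auto
  then show ?thesis by simp
qed

section \<open>Transporting an error bound to all sheets\<close>

lemma sizes_right:
  fixes \<mu> :: complex and \<sigma> :: real
  shows "\<exists>C>0. \<exists>P::nat. \<forall>s. \<bar>Im s\<bar> \<le> pi / 2 \<longrightarrow> \<sigma> \<le> Re s \<longrightarrow>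
    K_size \<mu> s \<le> C * (1 + norm (exp s)) ^ P * exp (- Re (exp s)) \<and>
    I_size \<mu> s \<le> C * (1 + norm (exp s)) ^ P * exp (Re (exp s))"
proof -
  obtain C1 where C1: "C1 > 0" "\<And>s. \<bar>Im s\<bar> \<le> pi / 2 \<Longrightarrow> \<sigma> \<le> Re s \<Longrightarrow> norm (bessel_K \<mu> s) \<le> C1 * exp (- Re (exp s))"
    using bessel_K_decay[of \<sigma> \<mu>] by blast
  obtain C2 where C2: "C2 > 0" "\<And>s. \<bar>Im s\<bar> \<le> pi / 2 \<Longrightarrow> \<sigma> \<le> Re s \<Longrightarrow> norm (bessel_K (\<mu> + 1) s) \<le> C2 * exp (- Re (exp s))"
    using bessel_K_decay[of \<sigma> "\<mu> + 1"] by blast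
  obtain C3 P where C3: "C3 > 0" "\<And>s. \<bar>Im s\<bar> \<le> pi / 2 \<Longrightarrow> \<sigma> \<le> Re s \<Longrightarrow>
     norm (bessel_I \<mu> s) \<le> C3 * (1 + norm (exp s)) ^ P * exp (Re (exp s)) \<and>
     norm (bessel_I (\<mu> + 1) s) \<le> C3 * (1 + norm (exp s)) ^ P * exp (Re (exp s))"
    using bessel_I_growth[of \<sigma> \<mu>] by blast
  define C where "C = C1 + C2 + 2 * C3"
  have pw: "1 \<le> (1 + norm (exp s)) ^ n" for s :: complex and n by (simp add: one_le_power)
  show ?thesis
  proof (intro exI[of _ C] exI[of _ "P + 1"] allI impI conjI)
    show "C > 0" using C1 C2 C3 by (simp add: C_def)
    fix s assume s: "\<bar>Im s\<bar> \<le> pi / 2" "\<sigma> \<le> Re s"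
    let ?r = "norm (exp s)" and ?x = "Re (exp s)"
    have "norm (bessel_K \<mu> s) \<le> C1 * (1 + ?r) ^ (P + 1) * exp (- ?x)"
    proof -
      have "C1 * 1 * exp (- ?x) \<le> C1 * (1 + ?r) ^ (P + 1) * exp (- ?x)"
        using C1(1) by (intro mult_right_mono mult_left_mono pw) auto
      then show ?thesis using C1(2)[OF s] by simp
    qed
    moreover have "norm (exp s * bessel_K (\<mu> + 1) s) \<le> C2 * (1 + ?r) ^ (P + 1) * exp (- ?x)"
    proof -
      have "norm (exp s * bessel_K (\<mu> + 1) s) \<le> (1 * (1 + ?r)) * (C2 * exp (- ?x))"
        unfolding norm_mult[of "exp s"] by (intro mult_mono C2(2) s) auto
      also have "\<dots> \<le> ((1 + ?r) ^ P * (1 + ?r)) * (C2 * exp (- ?x))"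
        using C2(1) by (intro mult_right_mono pw) auto
      finally show ?thesis by (simp add: mult_ac)
    qed
    moreover have "C * (1 + ?r) ^ (P + 1) * exp (- ?x) = C1 * (1 + ?r) ^ (P + 1) * exp (- ?x)
        + C2 * (1 + ?r) ^ (P + 1) * exp (- ?x) + 2 * C3 * (1 + ?r) ^ (P + 1) * exp (- ?x)"
      by (simp add: C_def distrib_right)
    moreover have "0 \<le> 2 * C3 * (1 + ?r) ^ (P + 1) * exp (- ?x)" using C3(1) by simp
    ultimately show "K_size \<mu> s \<le> C * (1 + ?r) ^ (P + 1) * exp (- ?x)" unfolding K_size_def by linarith
    have "norm (bessel_I \<mu> s) \<le> C3 * (1 + ?r) ^ (P + 1) * exp ?x"
    proof -
      have "C3 * (1 + ?r) ^ P * exp ?x \<le> C3 * (1 + ?r) ^ (P + 1) * exp ?x"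
        using C3(1) by (intro mult_right_mono mult_left_mono power_increasing) auto
      then show ?thesis using C3(2)[OF s] by simp
    qed
    moreover have "norm (exp s * bessel_I (\<mu> + 1) s) \<le> C3 * (1 + ?r) ^ (P + 1) * exp ?x"
    proof -
      have "norm (exp s * bessel_I (\<mu> + 1) s) \<le> (1 + ?r) * (C3 * (1 + ?r) ^ P * exp ?x)"
        unfolding norm_mult[of "exp s"] using C3(2)[OF s] by (intro mult_mono) auto
      then show ?thesis by (simp only: power_add power_one_right mult_ac)
    qed
    moreover have "C * (1 + ?r) ^ (P + 1) * exp ?x = (C1 + C2) * (1 + ?r) ^ (P + 1) * exp ?x
        + C3 * (1 + ?r) ^ (P + 1) * exp ?x + C3 * (1 + ?r) ^ (P + 1) * exp ?x"
      by (simp add: C_def algebra_simps)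
    moreover have "0 \<le> (C1 + C2) * (1 + ?r) ^ (P + 1) * exp ?x" using C1(1) C2(1) by simp
    ultimately show "I_size \<mu> s \<le> C * (1 + ?r) ^ (P + 1) * exp ?x" unfolding I_size_def by linarith
  qed
qed

text \<open>
  Away from the origin the exponentials of \<open>K\<close> and \<open>I\<close> compensate each other up to powers of \<open>z\<close>.
\<close>

lemma size_products_right:
  fixes \<mu> :: complex and \<sigma> :: real
  shows "\<exists>C>0. \<exists>P::nat. \<forall>s. \<bar>Im s\<bar> \<le> pi / 2 \<longrightarrow> \<sigma> \<le> Re s \<longrightarrow>
    K_size \<mu> s * (K_size \<mu> s + I_size \<mu> s) \<le> C * (1 + norm (exp s)) ^ P"
proof -
  obtain C P where C: "C > 0"
    and K: "\<And>s. \<bar>Im s\<bar> \<le> pi / 2 \<Longrightarrow> \<sigma> \<le> Re s \<Longrightarrow> K_size \<mu> s \<le> C * (1 + norm (exp s)) ^ P * exp (- Re (exp s))"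
    and I: "\<And>s. \<bar>Im s\<bar> \<le> pi / 2 \<Longrightarrow> \<sigma> \<le> Re s \<Longrightarrow> I_size \<mu> s \<le> C * (1 + norm (exp s)) ^ P * exp (Re (exp s))"
    using sizes_right[of \<sigma> \<mu>] by blast
  show ?thesis
  proof (intro exI[of _ "2 * (C * C)"] exI[of _ "P + P"] allI impI conjI)
    show "2 * (C * C) > 0" using C by simp
    fix s assume s: "\<bar>Im s\<bar> \<le> pi / 2" "\<sigma> \<le> Re s"
    let ?q = "C * (1 + norm (exp s)) ^ P" and ?x = "Re (exp s)"
    have q: "?q \<ge> 0" using C by simp
    have "?q * exp (- ?x) \<le> ?q * exp ?x" using Re_exp_nonneg[OF s(1)] by (intro mult_left_mono q) simp
    then have "K_size \<mu> s + I_size \<mu> s \<le> 2 * (?q * exp ?x)" using K[OF s] I[OF s] by linarith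
    then have "K_size \<mu> s * (K_size \<mu> s + I_size \<mu> s) \<le> (?q * exp (- ?x)) * (2 * (?q * exp ?x))"
      using q by (intro mult_mono K s) (auto intro: add_nonneg_nonneg K_size_nonneg I_size_nonneg)
    also have "\<dots> = 2 * (?q * ?q) * (exp (- ?x) * exp ?x)" by (simp only: mult_ac)
    also have "exp (- ?x) * exp ?x = 1" by (simp add: exp_add[symmetric])
    finally show "K_size \<mu> s * (K_size \<mu> s + I_size \<mu> s) \<le> 2 * (C * C) * (1 + norm (exp s)) ^ (P + P)"
      by (simp add: power_add mult_ac)
  qed
qed

text \<open>
  Near the origin \<open>z\<^sup>-\<^sup>\<mu>\<close> and \<open>z\<^sup>\<mu>\<close> compensate each other.
\<close>

lemma sizes_left:
  assumes "\<mu> \<noteq> 0" "Re \<mu> \<ge> 0"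
  shows "\<exists>C>0. \<exists>\<sigma>\<le>0. \<forall>s. Re s \<le> \<sigma> \<longrightarrow> \<bar>Im s\<bar> \<le> pi / 2 \<longrightarrow>
    K_size \<mu> s \<le> C * exp (- Re (\<mu> * s)) \<and> I_size \<mu> s \<le> C * exp (Re (\<mu> * s))"
proof -
  obtain C1 \<sigma>1 where C1: "C1 > 0" "\<sigma>1 \<le> 0" "\<And>s. Re s \<le> \<sigma>1 \<Longrightarrow> \<bar>Im s\<bar> \<le> pi / 2 \<Longrightarrow> norm (bessel_K \<mu> s) \<le> C1 * exp (- Re (\<mu> * s))"
    using bessel_K_small[OF assms] by blast
  have "Re (\<mu> + 1) \<ge> 0" "\<mu> + 1 \<noteq> 0" using assms by (auto simp: complex_eq_iff)
  from bessel_K_small[OF this(2,1)]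
  obtain C2 \<sigma>2 where C2: "C2 > 0" "\<sigma>2 \<le> 0" "\<And>s. Re s \<le> \<sigma>2 \<Longrightarrow> \<bar>Im s\<bar> \<le> pi / 2 \<Longrightarrow> norm (bessel_K (\<mu> + 1) s) \<le> C2 * exp (- Re ((\<mu> + 1) * s))"
    by blast
  obtain C3 where C3: "C3 > 0" "\<And>s. Re s \<le> 0 \<Longrightarrow> norm (bessel_I \<mu> s) \<le> C3 * exp (Re (\<mu> * s))"
    using bessel_I_small[of \<mu>] by blast
  obtain C4 where C4: "C4 > 0" "\<And>s. Re s \<le> 0 \<Longrightarrow> norm (bessel_I (\<mu> + 1) s) \<le> C4 * exp (Re ((\<mu> + 1) * s))"
    using bessel_I_small[of "\<mu> + 1"] by blast
  define C where "C = (C1 + C2) + (C3 + C4)"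
  have "K_size \<mu> s \<le> C * exp (- Re (\<mu> * s)) \<and> I_size \<mu> s \<le> C * exp (Re (\<mu> * s))"
    if s: "Re s \<le> min \<sigma>1 \<sigma>2" "\<bar>Im s\<bar> \<le> pi / 2" for s
  proof
    have s0: "Re s \<le> 0" using s C1(2) by simp
    have "norm (exp s * bessel_K (\<mu> + 1) s) \<le> exp (Re s) * (C2 * exp (- Re ((\<mu> + 1) * s)))"
      unfolding norm_mult norm_exp_eq_Re using s by (intro mult_left_mono C2(3)) auto
    also have "\<dots> = C2 * (exp (Re s) * exp (- Re ((\<mu> + 1) * s)))" by (simp only: mult_ac)
    also have "exp (Re s) * exp (- Re ((\<mu> + 1) * s)) = exp (- Re (\<mu> * s))"
      unfolding exp_add[symmetric] by (simp add: algebra_simps)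
    finally have "norm (exp s * bessel_K (\<mu> + 1) s) \<le> C2 * exp (- Re (\<mu> * s))" .
    moreover have "norm (bessel_K \<mu> s) \<le> C1 * exp (- Re (\<mu> * s))" using s by (intro C1(3)) auto
    ultimately have "K_size \<mu> s \<le> (C1 + C2) * exp (- Re (\<mu> * s))" by (simp add: K_size_def distrib_right)
    also have "\<dots> \<le> C * exp (- Re (\<mu> * s))" using C3(1) C4(1) by (intro mult_right_mono) (auto simp: C_def)
    finally show "K_size \<mu> s \<le> C * exp (- Re (\<mu> * s))" .
    have "norm (exp s * bessel_I (\<mu> + 1) s) \<le> exp (Re s) * (C4 * exp (Re ((\<mu> + 1) * s)))"
      unfolding norm_mult norm_exp_eq_Re using s0 by (intro mult_left_mono C4(2)) auto
    also have "\<dots> = C4 * (exp (Re s) * exp (Re ((\<mu> + 1) * s)))" by (simp only: mult_ac)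
    also have "exp (Re s) * exp (Re ((\<mu> + 1) * s)) \<le> exp (Re (\<mu> * s))"
      unfolding exp_add[symmetric] using s0 by (simp add: algebra_simps)
    finally have "norm (exp s * bessel_I (\<mu> + 1) s) \<le> C4 * exp (Re (\<mu> * s))" using C4(1) by simp
    moreover have "norm (bessel_I \<mu> s) \<le> C3 * exp (Re (\<mu> * s))" by (rule C3(2)[OF s0])
    ultimately have "I_size \<mu> s \<le> (C3 + C4) * exp (Re (\<mu> * s))" by (simp add: I_size_def distrib_right)
    also have "\<dots> \<le> C * exp (Re (\<mu> * s))" using C1(1) C2(1) by (intro mult_right_mono) (auto simp: C_def)
    finally show "I_size \<mu> s \<le> C * exp (Re (\<mu> * s))" .
  qed
  moreover have "C > 0" "min \<sigma>1 \<sigma>2 \<le> 0" using C1 C2 C3 C4 by (auto simp: C_def)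
  ultimately show ?thesis by blast
qed

lemma norm_exp_i_pi: "norm (exp (\<i> * of_real pi * \<mu>)) \<le> exp (pi * \<bar>Im \<mu>\<bar>)"
  "norm (exp (- (\<i> * of_real pi * \<mu>))) \<le> exp (pi * \<bar>Im \<mu>\<bar>)"
  by (simp_all add: norm_exp_eq_Re abs_if)

lemma K_size_neighbour:
  defines "c \<equiv> \<lambda>\<mu>. exp (pi * \<bar>Im \<mu>\<bar>) + pi"
  shows "K_size \<mu> (s + \<i> * of_real pi) \<le> c \<mu> * (K_size \<mu> s + I_size \<mu> s)"
    and "K_size \<mu> (s - \<i> * of_real pi) \<le> c \<mu> * (K_size \<mu> s + I_size \<mu> s)"
proof -
  have *: "norm (e * a + k * i) + norm (e * b + k' * d) \<le> c \<mu> * ((norm a + norm b) + (norm i + norm d))"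
    if "norm e \<le> exp (pi * \<bar>Im \<mu>\<bar>)" "norm k = pi" "norm k' = pi" for e k k' a b i d :: complex
  proof -
    have "norm (e * a + k * i) + norm (e * b + k' * d) \<le> (norm e * norm a + pi * norm i) + (norm e * norm b + pi * norm d)"
      using that by (intro add_mono order_trans[OF norm_triangle_ineq]) (auto simp: norm_mult)
    also have "\<dots> = norm e * (norm a + norm b) + pi * (norm i + norm d)" by (simp add: algebra_simps)
    also have "\<dots> \<le> c \<mu> * (norm a + norm b) + c \<mu> * (norm i + norm d)"
    proof -
      have "norm e \<le> c \<mu>" "pi \<le> c \<mu>" using that(1) pi_ge_zero unfolding c_def by (linarith, simp)
      then show ?thesis by (intro add_mono mult_right_mono) auto
    qed
    finally show ?thesis by (simp add: distrib_left)
  qed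
  let ?w = "\<i> * of_real pi :: complex"
  have A: "bessel_K \<mu> (s + ?w) = exp (- (?w * \<mu>)) * bessel_K \<mu> s + (- ?w) * bessel_I \<mu> s"
    by (simp add: bessel_K_shift)
  have B: "exp (s + ?w) * bessel_K (\<mu> + 1) (s + ?w) = exp (- (?w * \<mu>)) * (exp s * bessel_K (\<mu> + 1) s) + ?w * (exp s * bessel_I (\<mu> + 1) s)"
    by (rule exp_bessel_K_shift)
  show "K_size \<mu> (s + ?w) \<le> c \<mu> * (K_size \<mu> s + I_size \<mu> s)"
    unfolding K_size_def I_size_def A B by (rule *) (use norm_exp_i_pi in \<open>auto simp: norm_mult\<close>)
  let ?t = "s - ?w"
  have t: "?t + ?w = s" by simp
  have e1: "exp (?w * \<mu>) * exp (- (?w * \<mu>)) = 1" by (simp add: exp_add[symmetric])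
  have "exp (?w * \<mu>) * bessel_K \<mu> s + ?w * bessel_I \<mu> s
     = exp (?w * \<mu>) * (exp (- (?w * \<mu>)) * bessel_K \<mu> ?t - ?w * bessel_I \<mu> ?t) + ?w * (exp (?w * \<mu>) * bessel_I \<mu> ?t)"
    using bessel_K_shift[of \<mu> ?t] bessel_I_shift[of \<mu> ?t] unfolding t by simp
  also have "\<dots> = (exp (?w * \<mu>) * exp (- (?w * \<mu>))) * bessel_K \<mu> ?t" by (simp add: algebra_simps)
  finally have A: "bessel_K \<mu> ?t = exp (?w * \<mu>) * bessel_K \<mu> s + ?w * bessel_I \<mu> s" unfolding e1 by simp
  have "exp (?w * \<mu>) * (exp s * bessel_K (\<mu> + 1) s) + (- ?w) * (exp s * bessel_I (\<mu> + 1) s)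
     = exp (?w * \<mu>) * (exp (- (?w * \<mu>)) * (exp ?t * bessel_K (\<mu> + 1) ?t) + ?w * (exp ?t * bessel_I (\<mu> + 1) ?t))
       + (- ?w) * (exp (?w * \<mu>) * (exp ?t * bessel_I (\<mu> + 1) ?t))"
    using exp_bessel_K_shift[of ?t \<mu>] exp_bessel_I_shift[of ?t \<mu>] unfolding t by simp
  also have "\<dots> = (exp (?w * \<mu>) * exp (- (?w * \<mu>))) * (exp ?t * bessel_K (\<mu> + 1) ?t)" by (simp add: algebra_simps)
  finally have B: "exp ?t * bessel_K (\<mu> + 1) ?t = exp (?w * \<mu>) * (exp s * bessel_K (\<mu> + 1) s) + (- ?w) * (exp s * bessel_I (\<mu> + 1) s)"
    unfolding e1 by simp
  show "K_size \<mu> ?t \<le> c \<mu> * (K_size \<mu> s + I_size \<mu> s)"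
    unfolding K_size_def I_size_def A B by (rule *) (use norm_exp_i_pi in \<open>auto simp: norm_mult\<close>)
qed

definition shift_const :: "complex \<Rightarrow> real" where
  "shift_const \<mu> = exp (pi * \<bar>Im \<mu>\<bar>) * 2 + pi"

lemma shift_const_pos: "0 < shift_const \<mu>"
  by (simp add: shift_const_def add_pos_pos)

text \<open>
  Here \<open>s = log (u z)\<close>, and \<open>e\<close> stands for the error of a truncated expansion, divided by \<open>z\<close>.  Half a turn
  maps \<open>e\<close> to a multiple of itself plus a defect \<open>j\<close> with the monodromy of \<open>I\<^sub>\<mu>\<close>.  The bounds
  \<open>Re s \<le> T\<close> and \<open>Re s < T'\<close> correspond to \<open>\<bar>z\<bar> \<le> R\<close> and \<open>\<bar>z\<bar> < R0\<close>.  The smallness of \<open>e\<close> is assumed for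
  \<open>\<bar>arg z\<bar> \<le> \<pi>\<close> only.
\<close>

locale error_term =
  fixes \<mu> :: complex and T T' \<epsilon> a M :: real and e j :: "complex \<Rightarrow> complex"
  assumes TT: "T < T'" and eps: "0 \<le> \<epsilon>"
    and e_shift: "\<And>s. Re s < T' \<Longrightarrow> e (s + \<i> * of_real pi) = exp (- (\<i> * of_real pi * \<mu>)) * e s + j s"
    and j_shift: "\<And>s. Re s < T' \<Longrightarrow> j (s + \<i> * of_real pi) = exp (\<i> * of_real pi * \<mu>) * j s"
    and j_hol: "j holomorphic_on {s. Re s < T'}"
    and j_bdd: "\<And>s. Re s \<le> a \<Longrightarrow> norm (j s) \<le> M * exp (Re (\<mu> * s))"
    and e_small: "\<And>s. Re s \<le> T \<Longrightarrow> \<bar>Im s\<bar> \<le> pi \<Longrightarrow> norm (e s) \<le> \<epsilon> * K_size \<mu> s"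
begin

text \<open>
  The defect at \<open>s\<close> involves \<open>e\<close> on one neighbouring sheet: the upper one for \<open>Im s \<le> 0\<close>, the lower one
  otherwise, so that the argument never exceeds \<open>\<pi>\<close> in modulus.
\<close>

lemma j_bound:
  assumes "Re s \<le> T" "\<bar>Im s\<bar> \<le> pi / 2"
  shows "norm (j s) \<le> \<epsilon> * shift_const \<mu> * (K_size \<mu> s + I_size \<mu> s)"
proof -
  let ?w = "\<i> * of_real pi :: complex"
  let ?E = "exp (pi * \<bar>Im \<mu>\<bar>)"
  have e0: "norm (e s) \<le> \<epsilon> * (K_size \<mu> s + I_size \<mu> s)"
  proof -
    have "norm (e s) \<le> \<epsilon> * K_size \<mu> s" using assms by (intro e_small) auto
    also have "\<dots> \<le> \<epsilon> * (K_size \<mu> s + I_size \<mu> s)" using I_size_nonneg by (intro mult_left_mono eps) auto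
    finally show ?thesis .
  qed
  have fin: "norm (j s) \<le> \<epsilon> * shift_const \<mu> * (K_size \<mu> s + I_size \<mu> s)"
    if j: "norm (j s) \<le> norm (e t) + ?E * norm (e s)"
      and t: "norm (e t) \<le> \<epsilon> * ((?E + pi) * (K_size \<mu> s + I_size \<mu> s))" for t
  proof -
    have "norm (j s) \<le> \<epsilon> * ((?E + pi) * (K_size \<mu> s + I_size \<mu> s)) + ?E * (\<epsilon> * (K_size \<mu> s + I_size \<mu> s))"
    proof -
      have "?E * norm (e s) \<le> ?E * (\<epsilon> * (K_size \<mu> s + I_size \<mu> s))" by (intro mult_left_mono e0) simp
      then show ?thesis using j t by linarith
    qed
    also have "\<dots> = \<epsilon> * shift_const \<mu> * (K_size \<mu> s + I_size \<mu> s)" by (simp add: shift_const_def algebra_simps)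
    finally show ?thesis .
  qed
  show ?thesis
  proof (cases "Im s \<le> 0")
    case True
    have "j s = e (s + ?w) - exp (- (?w * \<mu>)) * e s" using e_shift[of s] assms TT by simp
    then have "norm (j s) \<le> norm (e (s + ?w)) + norm (exp (- (?w * \<mu>)) * e s)"
      by (simp only: norm_triangle_ineq4)
    also have "norm (exp (- (?w * \<mu>)) * e s) \<le> ?E * norm (e s)"
      unfolding norm_mult by (intro mult_right_mono norm_exp_i_pi) simp
    finally have 1: "norm (j s) \<le> norm (e (s + ?w)) + ?E * norm (e s)" by simp
    have "norm (e (s + ?w)) \<le> \<epsilon> * K_size \<mu> (s + ?w)"
      using assms True by (intro e_small) auto
    also have "\<dots> \<le> \<epsilon> * ((?E + pi) * (K_size \<mu> s + I_size \<mu> s))"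
      by (intro mult_left_mono K_size_neighbour eps)
    finally show ?thesis by (rule fin[OF 1])
  next
    case False
    let ?t = "s - ?w"
    have t: "?t + ?w = s" by simp
    have R: "Re ?t < T'" using assms TT by simp
    have e1: "exp (?w * \<mu>) * exp (- (?w * \<mu>)) = 1" by (simp add: exp_add[symmetric])
    have "j s = exp (?w * \<mu>) * (e s - exp (- (?w * \<mu>)) * e ?t)"
      using e_shift[OF R] j_shift[OF R] unfolding t by simp
    also have "\<dots> = exp (?w * \<mu>) * e s - (exp (?w * \<mu>) * exp (- (?w * \<mu>))) * e ?t" by (simp add: algebra_simps)
    finally have "j s = exp (?w * \<mu>) * e s - e ?t" unfolding e1 by simp
    then have "norm (j s) \<le> norm (exp (?w * \<mu>) * e s) + norm (e ?t)"
      by (simp only: norm_triangle_ineq4)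
    also have "norm (exp (?w * \<mu>) * e s) \<le> ?E * norm (e s)"
      unfolding norm_mult by (intro mult_right_mono norm_exp_i_pi) simp
    finally have 1: "norm (j s) \<le> norm (e ?t) + ?E * norm (e s)" by simp
    have "norm (e ?t) \<le> \<epsilon> * K_size \<mu> ?t"
      using assms False by (intro e_small) auto
    also have "\<dots> \<le> \<epsilon> * ((?E + pi) * (K_size \<mu> s + I_size \<mu> s))"
      by (intro mult_left_mono K_size_neighbour eps)
    finally show ?thesis by (rule fin[OF 1])
  qed
qed

text \<open>
  For \<open>z \<rightarrow> 0\<close> the preceding bound is of order \<open>z\<^sup>-\<^sup>\<mu>\<close>, which is too weak on sheets where the multiplier
  of the defect is large.  But \<open>j exp (- \<mu> s)\<close> is periodic and bounded at the cusp, so its bound on the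
  line \<open>Re s = \<sigma>\<close> propagates and \<open>j\<close> is of order \<open>z\<^sup>\<mu>\<close>.
\<close>

lemma j_near_cusp:
  assumes \<sigma>: "\<sigma> \<le> T" and D: "\<And>s. Re s = \<sigma> \<Longrightarrow> \<bar>Im s\<bar> \<le> pi / 2 \<Longrightarrow> (K_size \<mu> s + I_size \<mu> s) * exp (- Re (\<mu> * s)) \<le> D"
    and s: "Re s \<le> \<sigma>"
  shows "norm (j s) \<le> \<epsilon> * shift_const \<mu> * D * exp (Re (\<mu> * s))"
proof -
  have nj: "norm (j s * exp (- (\<mu> * s))) = norm (j s) * exp (- Re (\<mu> * s))" for s
    by (simp add: norm_mult)
  have "norm (j s * exp (- (\<mu> * s))) \<le> \<epsilon> * shift_const \<mu> * D"
  proof (rule periodic_half_plane_maximum[where T=T' and \<sigma>=\<sigma> and a=a and M=M and \<phi>="\<lambda>s. j s * exp (- (\<mu> * s))"])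
    show "(\<lambda>s. j s * exp (- (\<mu> * s))) holomorphic_on {s. Re s < T'}"
      by (intro holomorphic_intros j_hol)
    show "\<sigma> < T'" using \<sigma> TT by simp
    fix s :: complex
    show "j (s + \<i> * of_real pi) * exp (- (\<mu> * (s + \<i> * of_real pi))) = j s * exp (- (\<mu> * s))" if "Re s < T'"
    proof -
      have "j (s + \<i> * of_real pi) * exp (- (\<mu> * (s + \<i> * of_real pi)))
        = j s * (exp (\<i> * of_real pi * \<mu>) * exp (- (\<mu> * (s + \<i> * of_real pi))))"
        unfolding j_shift[OF that] by (simp only: mult_ac)
      also have "exp (\<i> * of_real pi * \<mu>) * exp (- (\<mu> * (s + \<i> * of_real pi))) = exp (- (\<mu> * s))"
        unfolding exp_add[symmetric] by (simp add: algebra_simps)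
      finally show ?thesis .
    qed
    show "norm (j s * exp (- (\<mu> * s))) \<le> M" if "Re s \<le> a"
    proof -
      have "norm (j s) * exp (- Re (\<mu> * s)) \<le> M * exp (Re (\<mu> * s)) * exp (- Re (\<mu> * s))"
        by (intro mult_right_mono j_bdd that) simp
      also have "\<dots> = M" by (simp add: mult.assoc exp_add[symmetric])
      finally show ?thesis unfolding nj .
    qed
    show "norm (j s * exp (- (\<mu> * s))) \<le> \<epsilon> * shift_const \<mu> * D" if l: "Re s = \<sigma>" "\<bar>Im s\<bar> \<le> pi / 2"
    proof -
      have "norm (j s) * exp (- Re (\<mu> * s)) \<le> \<epsilon> * shift_const \<mu> * (K_size \<mu> s + I_size \<mu> s) * exp (- Re (\<mu> * s))"
        using l \<sigma> by (intro mult_right_mono j_bound) auto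
      also have "\<dots> = \<epsilon> * shift_const \<mu> * ((K_size \<mu> s + I_size \<mu> s) * exp (- Re (\<mu> * s)))" by (simp only: mult.assoc)
      also have "\<dots> \<le> \<epsilon> * shift_const \<mu> * D" by (intro mult_left_mono D l mult_nonneg_nonneg eps less_imp_le[OF shift_const_pos])
      finally show ?thesis unfolding nj .
    qed
  qed (rule s)
  then have "norm (j s) * exp (- Re (\<mu> * s)) * exp (Re (\<mu> * s)) \<le> \<epsilon> * shift_const \<mu> * D * exp (Re (\<mu> * s))"
    unfolding nj by (rule mult_right_mono) simp
  then show ?thesis by (simp add: mult.assoc exp_add[symmetric])
qed

end

lemma line_bound:
  fixes \<mu> :: complex and \<sigma> :: real
  shows "\<exists>D>0. \<forall>s. Re s = \<sigma> \<longrightarrow> \<bar>Im s\<bar> \<le> pi / 2 \<longrightarrow> (K_size \<mu> s + I_size \<mu> s) * exp (- Re (\<mu> * s)) \<le> D"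
proof -
  obtain C P where C: "C > 0"
    and K: "\<And>s. \<bar>Im s\<bar> \<le> pi / 2 \<Longrightarrow> \<sigma> \<le> Re s \<Longrightarrow> K_size \<mu> s \<le> C * (1 + norm (exp s)) ^ P * exp (- Re (exp s))"
    and I: "\<And>s. \<bar>Im s\<bar> \<le> pi / 2 \<Longrightarrow> \<sigma> \<le> Re s \<Longrightarrow> I_size \<mu> s \<le> C * (1 + norm (exp s)) ^ P * exp (Re (exp s))"
    using sizes_right[of \<sigma> \<mu>] by blast
  let ?q = "C * (1 + exp \<sigma>) ^ P * exp (exp \<sigma>)"
  show ?thesis
  proof (intro exI[of _ "(?q + ?q) * exp (norm \<mu> * (\<bar>\<sigma>\<bar> + pi / 2))"] allI impI conjI)
    have q: "?q > 0" using C by (simp add: add_pos_pos)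
    then show "(?q + ?q) * exp (norm \<mu> * (\<bar>\<sigma>\<bar> + pi / 2)) > 0"
      using C by (intro mult_pos_pos add_pos_pos zero_less_power) (auto intro: add_pos_pos)
    fix s assume s: "Re s = \<sigma>" "\<bar>Im s\<bar> \<le> pi / 2"
    have n: "norm (exp s) = exp \<sigma>" using s by simp
    have r: "\<bar>Re (exp s)\<bar> \<le> exp \<sigma>" using abs_Re_le_cmod[of "exp s"] n by simp
    have "K_size \<mu> s \<le> ?q"
      by (rule order_trans[OF K]) (use s r n C in \<open>auto intro!: mult_left_mono\<close>)
    moreover have "I_size \<mu> s \<le> ?q"
      by (rule order_trans[OF I]) (use s r n C in \<open>auto intro!: mult_left_mono\<close>)
    moreover have "exp (- Re (\<mu> * s)) \<le> exp (norm \<mu> * (\<bar>\<sigma>\<bar> + pi / 2))"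
    proof -
      have "- Re (\<mu> * s) \<le> norm \<mu> * norm s" using abs_Re_le_cmod[of "\<mu> * s"] by (simp add: norm_mult)
      also have "norm s \<le> \<bar>\<sigma>\<bar> + pi / 2" using cmod_le[of s] s by simp
      finally show ?thesis by (simp add: mult_left_mono)
    qed
    ultimately show "(K_size \<mu> s + I_size \<mu> s) * exp (- Re (\<mu> * s)) \<le> (?q + ?q) * exp (norm \<mu> * (\<bar>\<sigma>\<bar> + pi / 2))"
    proof (rule mult_mono[OF add_mono])
      show "0 \<le> ?q + ?q" using q by linarith
    qed auto
  qed
qed

context error_term
begin

lemma e_transport:
  fixes m :: int
  assumes "Re s0 \<le> T"
  shows "\<exists>U. (\<mu> = 0 \<longrightarrow> U = of_int m) \<and>
    e (s0 + of_int m * (\<i> * of_real pi)) = exp (- (of_int m * (\<i> * of_real pi * \<mu>))) * e s0 + U * j s0 \<and>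
    norm (exp (- (of_int m * (\<i> * of_real pi * \<mu>)))) \<le> K_size \<mu> (s0 + of_int m * (\<i> * of_real pi)) * I_size \<mu> s0 \<and>
    norm U \<le> K_size \<mu> (s0 + of_int m * (\<i> * of_real pi)) * K_size \<mu> s0"
proof -
  obtain U where U: "\<mu> = 0 \<longrightarrow> U = of_int m"
    "\<forall>T F J s. (\<forall>s. Re s \<le> T \<longrightarrow> F (s + \<i> * of_real pi) = exp (- (\<i> * of_real pi * \<mu>)) * F s + J s) \<longrightarrow>
     (\<forall>s. Re s \<le> T \<longrightarrow> J (s + \<i> * of_real pi) = exp (\<i> * of_real pi * \<mu>) * J s) \<longrightarrow> Re s \<le> T \<longrightarrow>
       F (s + of_int m * (\<i> * of_real pi)) = exp (- (of_int m * (\<i> * of_real pi * \<mu>))) * F s + U * (J s :: complex)"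
    "\<forall>s. norm (exp (- (of_int m * (\<i> * of_real pi * \<mu>)))) \<le> K_size \<mu> (s + of_int m * (\<i> * of_real pi)) * I_size \<mu> s"
    "\<forall>s. norm U \<le> K_size \<mu> (s + of_int m * (\<i> * of_real pi)) * K_size \<mu> s"
    using monodromy_multiplier[of \<mu> m] by blast
  have "\<forall>s. Re s \<le> T \<longrightarrow> e (s + \<i> * of_real pi) = exp (- (\<i> * of_real pi * \<mu>)) * e s + j s"
    using e_shift TT by force
  moreover have "\<forall>s. Re s \<le> T \<longrightarrow> j (s + \<i> * of_real pi) = exp (\<i> * of_real pi * \<mu>) * j s"
    using j_shift TT by force
  ultimately have "e (s0 + of_int m * (\<i> * of_real pi)) = exp (- (of_int m * (\<i> * of_real pi * \<mu>))) * e s0 + U * j s0"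
    using U(2) assms by blast
  then show ?thesis using U by blast
qed

text \<open>
  With the bounds on the multipliers the size of \<open>K\<close> at the target point \<open>s\<close> factors out.
\<close>

lemma e_bound_from_sheet:
  assumes s0: "Re s0 \<le> T" "\<bar>Im s0\<bar> \<le> pi / 2" and s: "s = s0 + of_int m * (\<i> * of_real pi)"
    and j: "norm (j s0) \<le> \<epsilon> * J"
  shows "norm (e s) \<le> \<epsilon> * (K_size \<mu> s0 * (I_size \<mu> s0 + J)) * K_size \<mu> s"
proof -
  obtain U where U: "e s = exp (- (of_int m * (\<i> * of_real pi * \<mu>))) * e s0 + U * j s0"
    "norm (exp (- (of_int m * (\<i> * of_real pi * \<mu>)))) \<le> K_size \<mu> s * I_size \<mu> s0"
    "norm U \<le> K_size \<mu> s * K_size \<mu> s0"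
    using e_transport[OF s0(1), of m] unfolding s by blast
  have e0: "norm (e s0) \<le> \<epsilon> * K_size \<mu> s0" using s0 by (intro e_small) auto
  have "norm (e s) \<le> norm (exp (- (of_int m * (\<i> * of_real pi * \<mu>)))) * norm (e s0) + norm U * norm (j s0)"
    unfolding U(1) by (rule order_trans[OF norm_triangle_ineq]) (simp only: norm_mult order_refl)
  also have "\<dots> \<le> (K_size \<mu> s * I_size \<mu> s0) * (\<epsilon> * K_size \<mu> s0) + (K_size \<mu> s * K_size \<mu> s0) * (\<epsilon> * J)"
    by (intro add_mono mult_mono U e0 j) (auto intro: mult_nonneg_nonneg K_size_nonneg I_size_nonneg)
  also have "\<dots> = \<epsilon> * (K_size \<mu> s0 * (I_size \<mu> s0 + J)) * K_size \<mu> s" by (simp add: algebra_simps)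
  finally show ?thesis .
qed

end

text \<open>
  Near the origin.  For \<open>\<mu> \<noteq> 0\<close> the products of sizes are bounded.  For \<open>\<mu> = 0\<close> they grow like a
  logarithm, but then \<open>U = m\<close>, so that the error is at most of order \<open>1 + \<bar>log z\<bar>\<close> and \<open>K\<^sub>0\<close> exactly of this
  order, where the logarithm includes the \<open>m\<close> half-turns.
\<close>

lemma connection_left:
  assumes "Re \<mu> \<ge> 0"
  shows "\<exists>C>0. \<exists>\<sigma>\<le>0. \<forall>T T' \<epsilon> a M e j s. error_term \<mu> T T' \<epsilon> a M e j \<longrightarrow> \<sigma> \<le> T \<longrightarrow> Re s \<le> \<sigma> \<longrightarrow>
    norm (e s) \<le> \<epsilon> * C * K_size \<mu> s"
proof (cases "\<mu> = 0")
  case False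
  obtain C \<sigma> where C: "C > 0" "\<sigma> \<le> 0" and KI: "\<And>s. Re s \<le> \<sigma> \<Longrightarrow> \<bar>Im s\<bar> \<le> pi / 2 \<Longrightarrow>
    K_size \<mu> s \<le> C * exp (- Re (\<mu> * s)) \<and> I_size \<mu> s \<le> C * exp (Re (\<mu> * s))"
    using sizes_left[OF False assms] by blast
  obtain D where D: "D > 0" "\<And>s. Re s = \<sigma> \<Longrightarrow> \<bar>Im s\<bar> \<le> pi / 2 \<Longrightarrow> (K_size \<mu> s + I_size \<mu> s) * exp (- Re (\<mu> * s)) \<le> D"
    using line_bound[of \<sigma> \<mu>] by blast
  define C' where "C' = C * (C + shift_const \<mu> * D)"
  have "norm (e s) \<le> \<epsilon> * C' * K_size \<mu> s"
    if et: "error_term \<mu> T T' \<epsilon> a M e j" and T: "\<sigma> \<le> T" and s: "Re s \<le> \<sigma>" for T T' \<epsilon> a M e j s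
  proof -
    interpret error_term \<mu> T T' \<epsilon> a M e j by (rule et)
    obtain m s0 where z: "s = s0 + of_int m * (\<i> * of_real pi)" and z2: "\<bar>Im s0\<bar> \<le> pi / 2" and z3: "Re s0 = Re s"
      using sheet_exists[of s] by blast
    have r: "Re s0 \<le> \<sigma>" "Re s0 \<le> T" unfolding z3 using s T by auto
    have "norm (j s0) \<le> \<epsilon> * (shift_const \<mu> * D * exp (Re (\<mu> * s0)))"
      using j_near_cusp[OF T D(2) r(1)] by (simp only: mult.assoc)
    then have "norm (e s) \<le> \<epsilon> * (K_size \<mu> s0 * (I_size \<mu> s0 + shift_const \<mu> * D * exp (Re (\<mu> * s0)))) * K_size \<mu> s"
      by (rule e_bound_from_sheet[OF r(2) z2 z])
    also have "\<dots> \<le> \<epsilon> * C' * K_size \<mu> s"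
    proof (intro mult_right_mono mult_left_mono K_size_nonneg eps)
      have "K_size \<mu> s0 * (I_size \<mu> s0 + shift_const \<mu> * D * exp (Re (\<mu> * s0)))
        \<le> (C * exp (- Re (\<mu> * s0))) * (C * exp (Re (\<mu> * s0)) + shift_const \<mu> * D * exp (Re (\<mu> * s0)))"
        using KI[OF r(1) z2] C D shift_const_pos[of \<mu>]
        by (intro mult_mono add_mono) (auto intro!: add_nonneg_nonneg I_size_nonneg)
      also have "\<dots> = C' * (exp (- Re (\<mu> * s0)) * exp (Re (\<mu> * s0)))" by (simp add: C'_def algebra_simps)
      also have "exp (- Re (\<mu> * s0)) * exp (Re (\<mu> * s0)) = 1" by (simp add: exp_add[symmetric])
      finally show "K_size \<mu> s0 * (I_size \<mu> s0 + shift_const \<mu> * D * exp (Re (\<mu> * s0))) \<le> C'" by simp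
    qed
    finally show ?thesis .
  qed
  moreover have "C' > 0" using C D shift_const_pos[of \<mu>] by (auto simp: C'_def intro!: mult_pos_pos add_pos_pos)
  ultimately show ?thesis using C(2) by blast
next
  case True
  obtain C1 \<sigma>1 where C1: "C1 > 0" "\<sigma>1 \<le> 0" and K0: "\<And>s. Re s \<le> \<sigma>1 \<Longrightarrow> norm (bessel_K 0 s) \<le> C1 * (1 + norm s) \<and> 1 + norm s \<le> C1 * norm (bessel_K 0 s)"
    using bessel_K_0_bounds by blast
  obtain C2 \<sigma>2 where C2: "C2 > 0" "\<sigma>2 \<le> 0" and K1: "\<And>s. Re s \<le> \<sigma>2 \<Longrightarrow> \<bar>Im s\<bar> \<le> pi / 2 \<Longrightarrow> norm (exp s * bessel_K 1 s) \<le> C2"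
    using bessel_K_1_small by blast
  define \<sigma> where "\<sigma> = min \<sigma>1 \<sigma>2"
  obtain D where D: "D > 0" "\<And>s. Re s = \<sigma> \<Longrightarrow> \<bar>Im s\<bar> \<le> pi / 2 \<Longrightarrow> (K_size 0 s + I_size 0 s) * exp (- Re (0 * s)) \<le> D"
    using line_bound[of \<sigma> 0] by blast
  define C' where "C' = ((C1 + C2) * 3 + shift_const 0 * D) * C1"
  have "norm (e s) \<le> \<epsilon> * C' * K_size 0 s"
    if et: "error_term 0 T T' \<epsilon> a M e j" and T: "\<sigma> \<le> T" and s: "Re s \<le> \<sigma>" for T T' \<epsilon> a M e j s
  proof -
    interpret error_term 0 T T' \<epsilon> a M e j by (rule et)
    obtain m s0 where z: "s = s0 + of_int m * (\<i> * of_real pi)" and z2: "\<bar>Im s0\<bar> \<le> pi / 2" and z3: "Re s0 = Re s"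
      using sheet_exists[of s] by blast
    have r: "Re s0 \<le> \<sigma>" "Re s0 \<le> T" unfolding z3 using s T by auto
    have j: "norm (j s0) \<le> \<epsilon> * (shift_const 0 * D)"
      using j_near_cusp[OF T D(2) r(1)] by simp
    have "e s = e s0 + of_int m * j s0"
      using e_transport[OF r(2), of m] unfolding z[symmetric] by auto
    then have "norm (e s) \<le> norm (e s0) + norm (of_int m * j s0)" by (simp only: norm_triangle_ineq)
    also have "norm (of_int m * j s0) = \<bar>of_int m\<bar> * norm (j s0)" by (simp add: norm_mult)
    also have "norm (e s0) + \<bar>of_int m\<bar> * norm (j s0) \<le> \<epsilon> * ((C1 + C2) * (3 * (1 + norm s))) + (1 + norm s) * (\<epsilon> * (shift_const 0 * D))"
    proof (rule add_mono)
      have "norm (e s0) \<le> \<epsilon> * K_size 0 s0" using r z2 by (intro e_small) auto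
      also have "\<dots> \<le> \<epsilon> * ((C1 + C2) * (3 * (1 + norm s)))"
      proof (intro mult_left_mono eps)
        have n0: "1 + norm s0 \<le> 3 * (1 + norm s)"
        proof -
          have "norm s0 \<le> \<bar>Re s0\<bar> + \<bar>Im s0\<bar>" by (rule cmod_le)
          also have "\<dots> \<le> norm s + 2" using z2 abs_Re_le_cmod[of s] pi_less_4 unfolding z3 by linarith
          finally have "norm s0 \<le> norm s + 2" .
          moreover have "3 * (1 + norm s) = 3 + 3 * norm s" by simp
          ultimately show ?thesis using norm_ge_zero[of s] by linarith
        qed
        have "norm (bessel_K 0 s0) \<le> C1 * (1 + norm s0)" using K0 r by (auto simp: \<sigma>_def)
        moreover have "norm (exp s0 * bessel_K 1 s0) \<le> C2 * 1" using K1[of s0] r z2 by (auto simp: \<sigma>_def)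
        moreover have "C2 * 1 \<le> C2 * (1 + norm s0)" using C2 by (intro mult_left_mono) auto
        ultimately have "K_size 0 s0 \<le> (C1 + C2) * (1 + norm s0)"
          by (simp only: K_size_def distrib_right add_0_left)
        also have "\<dots> \<le> (C1 + C2) * (3 * (1 + norm s))" using n0 C1 C2 by (intro mult_left_mono) auto
        finally show "K_size 0 s0 \<le> (C1 + C2) * (3 * (1 + norm s))" .
      qed
      finally show "norm (e s0) \<le> \<epsilon> * ((C1 + C2) * (3 * (1 + norm s)))" .
      have "of_int m * pi = Im s - Im s0" using z by simp
      then have "\<bar>of_int m\<bar> * pi \<le> norm s + pi / 2"
        using z2 abs_Im_le_cmod[of s] abs_mult[of "of_int m" pi] by simp
      also have "\<dots> \<le> (1 + norm s) * pi"
        using mult_left_mono[of 1 pi "norm s"] pi_gt3 by (simp add: algebra_simps)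
      finally have "\<bar>of_int m\<bar> \<le> 1 + norm s" by simp
      then show "\<bar>of_int m\<bar> * norm (j s0) \<le> (1 + norm s) * (\<epsilon> * (shift_const 0 * D))"
        by (intro mult_mono j) auto
    qed
    also have "\<dots> = \<epsilon> * ((C1 + C2) * 3 + shift_const 0 * D) * (1 + norm s)" by (simp add: algebra_simps)
    also have "\<dots> \<le> \<epsilon> * ((C1 + C2) * 3 + shift_const 0 * D) * (C1 * K_size 0 s)"
    proof (rule mult_left_mono)
      have "1 + norm s \<le> C1 * norm (bessel_K 0 s)" using K0 s by (auto simp: \<sigma>_def)
      also have "\<dots> \<le> C1 * K_size 0 s" using C1 by (intro mult_left_mono) (auto simp: K_size_def)
      finally show "1 + norm s \<le> C1 * K_size 0 s" .
      show "0 \<le> \<epsilon> * ((C1 + C2) * 3 + shift_const 0 * D)"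
        using eps C1 C2 D shift_const_pos[of 0] by (intro mult_nonneg_nonneg add_nonneg_nonneg) auto
    qed
    finally show ?thesis by (simp add: C'_def mult_ac)
  qed
  moreover have "C' > 0" using C1 C2 D shift_const_pos[of 0] by (auto simp: C'_def intro!: mult_pos_pos add_pos_pos)
  moreover have "\<sigma> \<le> 0" using C1 by (simp add: \<sigma>_def)
  ultimately show ?thesis unfolding True by blast
qed

text \<open>
  On all sheets the relative error deteriorates at most by a fixed power of \<open>exp T\<close>, that is of \<open>u\<close>.
\<close>

theorem connection_estimate:
  assumes "Re \<mu> \<ge> 0"
  shows "\<exists>C>0. \<exists>P::nat. \<exists>\<sigma>. \<forall>T T' \<epsilon> a M e j s. error_term \<mu> T T' \<epsilon> a M e j \<longrightarrow> \<sigma> \<le> T \<longrightarrow> Re s \<le> T \<longrightarrow>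
    norm (e s) \<le> \<epsilon> * (C * (1 + exp T) ^ P) * K_size \<mu> s"
proof -
  obtain C1 \<sigma> where C1: "C1 > 0" "\<forall>T T' \<epsilon> a M e j s. error_term \<mu> T T' \<epsilon> a M e j \<longrightarrow> \<sigma> \<le> T \<longrightarrow> Re s \<le> \<sigma> \<longrightarrow>
    norm (e s) \<le> \<epsilon> * C1 * K_size \<mu> s"
    using connection_left[OF assms] by blast
  obtain C2 P where C2: "C2 > 0" "\<And>s. \<bar>Im s\<bar> \<le> pi / 2 \<Longrightarrow> \<sigma> \<le> Re s \<Longrightarrow>
      K_size \<mu> s * (K_size \<mu> s + I_size \<mu> s) \<le> C2 * (1 + norm (exp s)) ^ P"
    using size_products_right[of \<sigma> \<mu>] by blast
  define C where "C = C1 + (1 + shift_const \<mu>) * C2"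
  have sc: "shift_const \<mu> > 0" by (rule shift_const_pos)
  have "norm (e s) \<le> \<epsilon> * (C * (1 + exp T) ^ P) * K_size \<mu> s"
    if et: "error_term \<mu> T T' \<epsilon> a M e j" and T: "\<sigma> \<le> T" and s: "Re s \<le> T" for T T' \<epsilon> a M e j s
  proof -
    interpret error_term \<mu> T T' \<epsilon> a M e j by (rule et)
    have pw: "1 \<le> (1 + exp T) ^ P" by (simp add: one_le_power)
    show ?thesis
    proof (cases "Re s \<le> \<sigma>")
      case True
      have "norm (e s) \<le> \<epsilon> * C1 * K_size \<mu> s" using C1(2) et T True by blast
      also have "\<dots> \<le> \<epsilon> * (C * (1 + exp T) ^ P) * K_size \<mu> s"
      proof (intro mult_right_mono mult_left_mono K_size_nonneg eps)
        have "C1 * 1 \<le> C * (1 + exp T) ^ P" using C1 C2 sc pw by (intro mult_mono) (auto simp: C_def)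
        then show "C1 \<le> C * (1 + exp T) ^ P" by simp
      qed
      finally show ?thesis .
    next
      case False
      obtain m s0 where z: "s = s0 + of_int m * (\<i> * of_real pi)" and z2: "\<bar>Im s0\<bar> \<le> pi / 2" and z3: "Re s0 = Re s"
        using sheet_exists[of s] by blast
      have r: "\<sigma> \<le> Re s0" "Re s0 \<le> T" unfolding z3 using s False by auto
      have "norm (j s0) \<le> \<epsilon> * (shift_const \<mu> * (K_size \<mu> s0 + I_size \<mu> s0))"
        using j_bound[OF r(2) z2] by (simp only: mult.assoc)
      then have "norm (e s) \<le> \<epsilon> * (K_size \<mu> s0 * (I_size \<mu> s0 + shift_const \<mu> * (K_size \<mu> s0 + I_size \<mu> s0))) * K_size \<mu> s"
        by (rule e_bound_from_sheet[OF r(2) z2 z])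
      also have "\<dots> \<le> \<epsilon> * (C * (1 + exp T) ^ P) * K_size \<mu> s"
      proof (intro mult_right_mono mult_left_mono K_size_nonneg eps)
        have "K_size \<mu> s0 * (I_size \<mu> s0 + shift_const \<mu> * (K_size \<mu> s0 + I_size \<mu> s0))
          \<le> K_size \<mu> s0 * ((1 + shift_const \<mu>) * (K_size \<mu> s0 + I_size \<mu> s0))"
          using K_size_nonneg[of \<mu> s0] by (intro mult_left_mono) (auto simp: algebra_simps)
        also have "\<dots> = (1 + shift_const \<mu>) * (K_size \<mu> s0 * (K_size \<mu> s0 + I_size \<mu> s0))" by (simp only: mult_ac)
        also have "\<dots> \<le> (1 + shift_const \<mu>) * (C2 * (1 + norm (exp s0)) ^ P)"
          using sc by (intro mult_left_mono C2 z2 r) auto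
        also have "\<dots> \<le> (1 + shift_const \<mu>) * (C2 * (1 + exp T) ^ P)"
          using sc C2 r by (intro mult_left_mono power_mono) auto
        also have "\<dots> \<le> C * (1 + exp T) ^ P"
          using C1(1) pw by (simp add: C_def distrib_right)
        finally show "K_size \<mu> s0 * (I_size \<mu> s0 + shift_const \<mu> * (K_size \<mu> s0 + I_size \<mu> s0)) \<le> C * (1 + exp T) ^ P" .
      qed
      finally show ?thesis .
    qed
  qed
  moreover have "C > 0" using C1 C2 sc by (simp add: C_def add_pos_pos)
  ultimately show ?thesis by blast
qed

section \<open>Monodromy of the solutions of the differential equation\<close>

text \<open>
  The coefficients of \<open>z\<^sup>-\<^sup>\<mu> v\<close> for the solution \<open>v\<close> of \<open>(z d/dz)\<^sup>2 v = (\<mu>\<^sup>2 + z\<^sup>2 G(z)) v\<close> belonging to the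
  exponent \<open>\<mu>\<close>, where \<open>g\<close> are the coefficients of \<open>G\<close>.  As \<open>Re \<mu> \<ge> 0\<close>, the denominators do not vanish.
\<close>

fun frob_coeff :: "complex \<Rightarrow> (nat \<Rightarrow> complex) \<Rightarrow> nat \<Rightarrow> complex" where
  "frob_coeff \<mu> g 0 = 1"
| "frob_coeff \<mu> g (Suc n) =
     (\<Sum>i<n. g (n - Suc i) * frob_coeff \<mu> g i) / (of_nat (Suc n) * (of_nat (Suc n) + 2 * \<mu>))"

lemma frob_coeff_bound:
  assumes "Re \<mu> \<ge> 0" and g: "\<And>k. norm (g k) \<le> M * B ^ k" and "0 \<le> B"
    and \<kappa>: "1 \<le> \<kappa>" "B \<le> \<kappa>" "M \<le> \<kappa>"
  shows "norm (frob_coeff \<mu> g n) \<le> \<kappa> ^ n"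
proof (induction n rule: less_induct)
  case (less n)
  show ?case
  proof (cases n)
    case (Suc m)
    have M: "M \<ge> 0" using order_trans[OF norm_ge_zero g[of 0]] by simp
    let ?s = "\<Sum>i<m. g (m - Suc i) * frob_coeff \<mu> g i"
    have "norm ?s \<le> (\<Sum>i<m. M * \<kappa> ^ (m - 1))"
    proof (rule sum_norm_le)
      fix i assume i: "i \<in> {..<m}"
      have "norm (g (m - Suc i) * frob_coeff \<mu> g i) \<le> (M * B ^ (m - Suc i)) * \<kappa> ^ i"
        unfolding norm_mult using i Suc M assms(3) by (intro mult_mono g less.IH) auto
      also have "\<dots> \<le> (M * \<kappa> ^ (m - Suc i)) * \<kappa> ^ i"
        using M assms by (intro mult_right_mono mult_left_mono power_mono) auto
      also have "\<dots> = M * \<kappa> ^ (m - 1)"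
        using i by (simp add: mult.assoc power_add[symmetric])
      finally show "norm (g (m - Suc i) * frob_coeff \<mu> g i) \<le> M * \<kappa> ^ (m - 1)" .
    qed
    also have "\<dots> \<le> real (Suc m) * \<kappa> ^ Suc m"
    proof (cases m)
      case (Suc l)
      have "M * \<kappa> ^ l \<le> \<kappa> * \<kappa> ^ Suc l"
        using \<kappa> M by (intro mult_mono power_increasing) auto
      then have "real m * (M * \<kappa> ^ l) \<le> real (Suc m) * (\<kappa> * \<kappa> ^ Suc l)"
        using M \<kappa> by (intro mult_mono) auto
      then show ?thesis using Suc by simp
    qed (use \<kappa> in simp)
    finally have s: "norm ?s \<le> real (Suc m) * \<kappa> ^ Suc m" .
    let ?d = "of_nat (Suc m) * (of_nat (Suc m) + 2 * \<mu>)"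
    have "1 \<le> norm (of_nat (Suc m) + 2 * \<mu>)"
      using complex_Re_le_cmod[of "of_nat (Suc m) + 2 * \<mu>"] assms(1) by simp
    then have d: "real (Suc m) \<le> norm ?d" unfolding norm_mult norm_of_nat by simp
    have "norm (frob_coeff \<mu> g n) = norm ?s / norm ?d" using Suc by (simp add: norm_divide)
    also have "\<dots> \<le> (real (Suc m) * \<kappa> ^ Suc m) / real (Suc m)"
      using s d \<kappa> by (intro frac_le) auto
    also have "\<dots> = \<kappa> ^ n" using Suc by simp
    finally show ?thesis .
  qed simp
qed

lemma frobenius_fps:
  fixes F :: "complex fps"
  assumes "Re \<mu> \<ge> 0"
  defines "C \<equiv> Abs_fps (frob_coeff \<mu> (fps_nth F))"
  defines "C1 \<equiv> fps_X * fps_deriv C"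
  shows "fps_X * fps_deriv C1 + fps_const (2 * \<mu>) * C1 = fps_X ^ 2 * (F * C)"
proof (rule fps_ext)
  have X: "fps_nth (fps_X * fps_deriv A) n = of_nat n * fps_nth A n" for A :: "complex fps" and n
    by (cases n) simp_all
  fix n
  have "fps_nth C1 n = of_nat n * frob_coeff \<mu> (fps_nth F) n"
    by (simp only: C1_def X C_def fps_nth_Abs_fps)
  then have "fps_nth (fps_X * fps_deriv C1 + fps_const (2 * \<mu>) * C1) n
      = of_nat n * (of_nat n * frob_coeff \<mu> (fps_nth F) n) + 2 * \<mu> * (of_nat n * frob_coeff \<mu> (fps_nth F) n)"
    by (simp only: fps_add_nth X fps_mult_left_const_nth)
  also have "\<dots> = of_nat n * (of_nat n + 2 * \<mu>) * frob_coeff \<mu> (fps_nth F) n"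
    by (simp only: distrib_left distrib_right mult_ac)
  also have "\<dots> = fps_nth (fps_X ^ 2 * (F * C)) n"
  proof (cases n)
    case (Suc m)
    have "of_nat (Suc m) + 2 * \<mu> \<noteq> 0" using assms(1) by (auto simp: complex_eq_iff)
    then have "of_nat n * (of_nat n + 2 * \<mu>) * frob_coeff \<mu> (fps_nth F) n
      = (\<Sum>i<m. fps_nth F (m - Suc i) * frob_coeff \<mu> (fps_nth F) i)"
      using Suc by (simp del: of_nat_Suc)
    also have "\<dots> = fps_nth (fps_X ^ 2 * (F * C)) (Suc m)"
    proof (cases m)
      case (Suc l)
      have "fps_nth (fps_X ^ 2 * (F * C)) (Suc m) = fps_nth (C * F) l"
        using Suc by (simp add: fps_X_power_mult_nth mult.commute[of F C])
      also have "\<dots> = (\<Sum>i=0..l. fps_nth C i * fps_nth F (l - i))" by (simp add: fps_mult_nth)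
      also have "\<dots> = (\<Sum>i<m. fps_nth F (m - Suc i) * frob_coeff \<mu> (fps_nth F) i)"
        using Suc by (intro sum.cong) (auto simp: C_def)
      finally show ?thesis by simp
    qed (simp add: fps_X_power_mult_nth)
    finally show ?thesis using Suc by simp
  qed (simp add: fps_X_power_mult_nth)
  finally show "fps_nth (fps_X * fps_deriv C1 + fps_const (2 * \<mu>) * C1) n = fps_nth (fps_X ^ 2 * (F * C)) n" .
qed

lemma frobenius_solution:
  assumes "Re \<mu> \<ge> 0" "R0 > 0" and G: "G holomorphic_on ball 0 R0"
  shows "\<exists>r \<Phi> \<Phi>1 \<Phi>2. 0 < r \<and> r \<le> R0 \<and> continuous_on (ball 0 r) \<Phi> \<and> \<Phi> 0 = 1 \<and>
    (\<forall>z. norm z < r \<longrightarrow> (\<Phi> has_field_derivative \<Phi>1 z) (at z) \<and>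
       ((\<lambda>z. z * \<Phi>1 z) has_field_derivative \<Phi>2 z) (at z) \<and>
       z * \<Phi>2 z + 2 * \<mu> * (z * \<Phi>1 z) = z\<^sup>2 * G z * \<Phi> z)"
proof -
  define F where "F = fps_expansion G 0"
  have Gh: "G holomorphic_on eball 0 (ereal R0)" using G by simp
  have rF: "fps_conv_radius F \<ge> ereal R0"
    unfolding F_def by (rule conv_radius_fps_expansion[OF Gh])
  have eF: "eval_fps F z = G z" if "norm z < R0" for z
    unfolding F_def using eval_fps_expansion[OF Gh] that by simp
  define \<rho> where "\<rho> = R0 / 2"
  have \<rho>: "0 < \<rho>" "\<rho> < R0" using assms by (auto simp: \<rho>_def)
  have "summable (\<lambda>n. fps_nth F n * of_real \<rho> ^ n)"
    by (intro summable_fps less_le_trans[OF _ rF]) (use \<rho> in simp)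
  then have "Bseq (\<lambda>n. fps_nth F n * of_real \<rho> ^ n)"
    by (intro convergent_imp_Bseq) (auto dest!: summable_LIMSEQ_zero simp: convergent_def)
  then obtain M where M: "\<And>n. norm (fps_nth F n * of_real \<rho> ^ n) \<le> M" unfolding Bseq_def by blast
  have g: "norm (fps_nth F k) \<le> M * (1 / \<rho>) ^ k" for k
    using M[of k] \<rho> by (simp add: norm_mult norm_power power_divide field_simps)
  define \<kappa> where "\<kappa> = max 1 (max (1 / \<rho>) M)"
  define C where "C = Abs_fps (frob_coeff \<mu> (fps_nth F))"
  have cb: "norm (fps_nth C n) \<le> \<kappa> ^ n" for n
    unfolding C_def fps_nth_Abs_fps by (rule frob_coeff_bound[OF assms(1) g]) (use \<rho> in \<open>auto simp: \<kappa>_def\<close>)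
  have \<kappa>: "\<kappa> \<ge> 1" by (simp add: \<kappa>_def)
  define r where "r = min (1 / \<kappa>) R0"
  have r: "0 < r" "r \<le> R0" using \<kappa> assms by (auto simp: r_def)
  have rC: "fps_conv_radius C \<ge> ereal (1 / \<kappa>)"
    unfolding fps_conv_radius_def
  proof (rule conv_radius_geI_ex)
    fix t :: real assume t: "0 < t" "ereal t < ereal (1 / \<kappa>)"
    then have q: "\<kappa> * t < 1" using \<kappa> by (simp add: field_simps)
    have "summable (\<lambda>n. fps_nth C n * of_real t ^ n)"
    proof (rule summable_comparison_test'[OF summable_geometric[of "\<kappa> * t"], of 0])
      show "norm (\<kappa> * t) < 1" using q t \<kappa> by simp
      show "norm (fps_nth C n * of_real t ^ n) \<le> (\<kappa> * t) ^ n" for n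
        unfolding power_mult_distrib norm_mult using t cb \<kappa> by (intro mult_mono) (auto simp: norm_power)
    qed
    then show "\<exists>z. norm z = t \<and> summable (\<lambda>n. fps_nth C n * z ^ n)"
      using t by (intro exI[of _ "of_real t"]) auto
  qed
  define C1 where "C1 = fps_X * fps_deriv C"
  have inC: "ereal (norm z) < fps_conv_radius C" if "norm z < r" for z
    by (rule less_le_trans[OF _ rC]) (use that in \<open>simp add: r_def\<close>)
  have inF: "ereal (norm z) < fps_conv_radius F" if "norm z < r" for z
    by (rule less_le_trans[OF _ rF]) (use that r in simp)
  have inD: "ereal (norm z) < fps_conv_radius (fps_deriv C)" if "norm z < r" for z
    by (rule less_le_trans[OF inC[OF that] fps_conv_radius_deriv])
  have inC1: "ereal (norm z) < fps_conv_radius C1" if "norm z < r" for z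
    unfolding C1_def by (rule less_le_trans[OF _ fps_conv_radius_mult]) (use inD[OF that] in simp)
  have inD1: "ereal (norm z) < fps_conv_radius (fps_deriv C1)" if "norm z < r" for z
    by (rule less_le_trans[OF inC1[OF that] fps_conv_radius_deriv])
  have inFC: "ereal (norm z) < fps_conv_radius (F * C)" if "norm z < r" for z
    by (rule less_le_trans[OF _ fps_conv_radius_mult]) (use inC[OF that] inF[OF that] in simp)
  have eC1: "eval_fps C1 z = z * eval_fps (fps_deriv C) z" if "norm z < r" for z
    unfolding C1_def using inD[OF that] by (subst eval_fps_mult) auto
  have "continuous_on (ball 0 r) (eval_fps C)"
    by (intro continuous_on_eval_fps') (auto intro: inC continuous_on_id)
  moreover have "eval_fps C 0 = 1" by (simp add: eval_fps_at_0 C_def)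
  moreover have "(eval_fps C has_field_derivative eval_fps (fps_deriv C) z) (at z)" if "norm z < r" for z
    by (rule has_field_derivative_eval_fps[OF inC[OF that]])
  moreover have "((\<lambda>z. z * eval_fps (fps_deriv C) z) has_field_derivative eval_fps (fps_deriv C1) z) (at z)" if "norm z < r" for z
  proof -
    have "(eval_fps C1 has_field_derivative eval_fps (fps_deriv C1) z) (at z)"
      by (rule has_field_derivative_eval_fps[OF inC1[OF that]])
    then show ?thesis
      by (rule has_field_derivative_transform_within_open[of _ _ _ "ball 0 r"]) (use that eC1 in auto)
  qed
  moreover have "z * eval_fps (fps_deriv C1) z + 2 * \<mu> * (z * eval_fps (fps_deriv C) z) = z\<^sup>2 * G z * eval_fps C z"
    if "norm z < r" for z
  proof -
    have i1: "ereal (norm z) < fps_conv_radius (fps_X * fps_deriv C1)"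
      by (rule less_le_trans[OF _ fps_conv_radius_mult]) (use inD1[OF that] in simp)
    have i2: "ereal (norm z) < fps_conv_radius (fps_const (2 * \<mu>) * C1)"
      by (rule less_le_trans[OF _ fps_conv_radius_mult]) (use inC1[OF that] in simp)
    have "eval_fps (fps_X * fps_deriv C1 + fps_const (2 * \<mu>) * C1) z = z * eval_fps (fps_deriv C1) z + 2 * \<mu> * eval_fps C1 z"
      using i1 i2 inD1[OF that] inC1[OF that] by (simp add: eval_fps_add eval_fps_mult)
    moreover have "eval_fps (fps_X ^ 2 * (F * C)) z = z ^ 2 * (eval_fps F z * eval_fps C z)"
      using inFC[OF that] inF[OF that] inC[OF that] by (simp add: eval_fps_mult)
    moreover have "eval_fps F z = G z" using that r by (intro eF) simp
    ultimately show ?thesis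
      using frobenius_fps[OF assms(1), of F] eC1[OF that] unfolding C_def[symmetric] C1_def[symmetric]
      by (simp add: mult_ac)
  qed
  ultimately show ?thesis using r by blast
qed

text \<open>
  In the logarithmic chart, the solution with exponent \<open>\<mu>\<close> at the origin is an eigenfunction of the half-turn.
\<close>

lemma recessive_solution:
  assumes "Re \<mu> \<ge> 0" "R0 > 0" and G: "G holomorphic_on ball 0 R0"
    and even: "\<And>z. norm z < R0 \<Longrightarrow> G (- z) = G z"
  shows "\<exists>a v v1. a \<le> ln R0 \<and> (\<forall>\<zeta>. Re \<zeta> < a \<longrightarrow>
     (v has_field_derivative v1 \<zeta>) (at \<zeta>) \<and>
     (v1 has_field_derivative (\<mu>\<^sup>2 + (exp \<zeta>)\<^sup>2 * G (exp \<zeta>)) * v \<zeta>) (at \<zeta>) \<and>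
     v (\<zeta> + \<i> * of_real pi) = exp (\<i> * of_real pi * \<mu>) * v \<zeta> \<and>
     v1 (\<zeta> + \<i> * of_real pi) = exp (\<i> * of_real pi * \<mu>) * v1 \<zeta> \<and>
     v \<zeta> \<noteq> 0 \<and> norm (v \<zeta>) \<le> 2 * exp (Re (\<mu> * \<zeta>)))"
proof -
  obtain r \<Phi> \<Phi>1 \<Phi>2 where r: "0 < r" "r \<le> R0" and cont: "continuous_on (ball 0 r) \<Phi>" and \<Phi>0: "\<Phi> 0 = 1"
    and d1: "\<And>z. norm z < r \<Longrightarrow> (\<Phi> has_field_derivative \<Phi>1 z) (at z)"
    and d2: "\<And>z. norm z < r \<Longrightarrow> ((\<lambda>z. z * \<Phi>1 z) has_field_derivative \<Phi>2 z) (at z)"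
    and eq: "\<And>z. norm z < r \<Longrightarrow> z * \<Phi>2 z + 2 * \<mu> * (z * \<Phi>1 z) = z\<^sup>2 * G z * \<Phi> z"
    using frobenius_solution[OF assms(1-3)] by blast
  have "isCont \<Phi> 0" using cont r by (simp add: continuous_on_eq_continuous_at)
  then have "\<forall>e>0. \<exists>d>0. \<forall>z. dist z 0 < d \<longrightarrow> dist (\<Phi> z) (\<Phi> 0) < e" unfolding continuous_at_eps_delta .
  then have "\<exists>d>0. \<forall>z. dist z 0 < d \<longrightarrow> dist (\<Phi> z) (\<Phi> 0) < 1 / 2" by (rule allE[of _ "1 / 2"]) simp
  then obtain d where d: "d > 0" "\<And>z. norm z < d \<Longrightarrow> norm (\<Phi> z - 1) < 1 / 2"
    unfolding \<Phi>0 by (auto simp: dist_norm)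
  define a where "a = ln (min r d)"
  have a: "norm (exp \<zeta>) < r" "norm (exp \<zeta>) < d" if "Re \<zeta> < a" for \<zeta>
  proof -
    have "exp (Re \<zeta>) < min r d" using that d(1) r(1) unfolding a_def by (metis exp_less_mono exp_ln min_less_iff_conj)
    then show "norm (exp \<zeta>) < r" "norm (exp \<zeta>) < d" by auto
  qed
  have aR: "a \<le> ln R0" unfolding a_def using d r by (subst ln_le_cancel_iff) auto
  \<comment> \<open>The even part of the power series is again a solution because \<open>G\<close> is even.\<close>
  define p where "p z = (\<Phi> z + \<Phi> (- z)) / 2" for z
  define p1 where "p1 z = (z * \<Phi>1 z + (- z) * \<Phi>1 (- z)) / 2" for z
  define p2 where "p2 z = (z * \<Phi>2 z + (- z) * \<Phi>2 (- z)) / 2" for z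
  have pm: "p (- z) = p z" "p1 (- z) = p1 z" for z by (simp_all add: p_def p1_def)
  have pd: "((\<lambda>\<zeta>. p (exp \<zeta>)) has_field_derivative p1 (exp \<zeta>)) (at \<zeta>)"
      "((\<lambda>\<zeta>. p1 (exp \<zeta>)) has_field_derivative p2 (exp \<zeta>)) (at \<zeta>)" if "Re \<zeta> < a" for \<zeta>
  proof -
    have n: "norm (exp \<zeta>) < r" "norm (- exp \<zeta>) < r" using a[OF that] by auto
    have e: "(exp has_field_derivative exp \<zeta>) (at \<zeta>)" "((\<lambda>\<zeta>. - exp \<zeta>) has_field_derivative - exp \<zeta>) (at \<zeta>)"
      by (auto intro!: derivative_eq_intros)
    show "((\<lambda>\<zeta>. p (exp \<zeta>)) has_field_derivative p1 (exp \<zeta>)) (at \<zeta>)"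
      unfolding p_def using DERIV_cdivide[OF DERIV_add[OF DERIV_chain2[OF d1[OF n(1)] e(1)] DERIV_chain2[OF d1[OF n(2)] e(2)]], of 2]
      by (simp add: p1_def mult_ac)
    show "((\<lambda>\<zeta>. p1 (exp \<zeta>)) has_field_derivative p2 (exp \<zeta>)) (at \<zeta>)"
      unfolding p1_def using DERIV_cdivide[OF DERIV_add[OF DERIV_chain2[OF d2[OF n(1)] e(1)] DERIV_chain2[OF d2[OF n(2)] e(2)]], of 2]
      by (simp add: p2_def mult_ac)
  qed
  have peq: "p2 z + 2 * \<mu> * p1 z = z\<^sup>2 * G z * p z" if "norm z < r" for z
  proof -
    have n: "norm (- z) < r" using that by simp
    have Gm: "G (- z) = G z" using that r by (intro even) simp
    have "p2 z + 2 * \<mu> * p1 z = ((z * \<Phi>2 z + 2 * \<mu> * (z * \<Phi>1 z)) + ((- z) * \<Phi>2 (- z) + 2 * \<mu> * ((- z) * \<Phi>1 (- z)))) / 2"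
      by (simp add: p1_def p2_def algebra_simps add_divide_distrib diff_divide_distrib)
    also have "\<dots> = z\<^sup>2 * G z * p z" unfolding eq[OF that] eq[OF n] Gm p_def by (simp add: algebra_simps)
    finally show ?thesis .
  qed
  have pn: "p z \<noteq> 0" "norm (p z) \<le> 2" if "norm z < d" for z
  proof -
    have "p z - 1 = ((\<Phi> z - 1) + (\<Phi> (- z) - 1)) / 2" by (simp add: p_def field_simps)
    then have "norm (p z - 1) = norm ((\<Phi> z - 1) + (\<Phi> (- z) - 1)) / 2"
      by (simp only: norm_divide norm_numeral)
    also have "\<dots> < 1 / 2"
      using norm_triangle_ineq[of "\<Phi> z - 1" "\<Phi> (- z) - 1"] d(2)[of z] d(2)[of "- z"] that by simp
    finally have "norm (p z - 1) < 1 / 2" .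
    then show "p z \<noteq> 0" "norm (p z) \<le> 2" using norm_triangle_sub[of "p z" 1] by auto
  qed
  define v where "v \<zeta> = exp (\<mu> * \<zeta>) * p (exp \<zeta>)" for \<zeta>
  define v1 where "v1 \<zeta> = exp (\<mu> * \<zeta>) * (\<mu> * p (exp \<zeta>) + p1 (exp \<zeta>))" for \<zeta>
  have main: "(v has_field_derivative v1 \<zeta>) (at \<zeta>) \<and>
     (v1 has_field_derivative (\<mu>\<^sup>2 + (exp \<zeta>)\<^sup>2 * G (exp \<zeta>)) * v \<zeta>) (at \<zeta>) \<and>
     v (\<zeta> + \<i> * of_real pi) = exp (\<i> * of_real pi * \<mu>) * v \<zeta> \<and>
     v1 (\<zeta> + \<i> * of_real pi) = exp (\<i> * of_real pi * \<mu>) * v1 \<zeta> \<and>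
     v \<zeta> \<noteq> 0 \<and> norm (v \<zeta>) \<le> 2 * exp (Re (\<mu> * \<zeta>))" if z: "Re \<zeta> < a" for \<zeta>
  proof (intro conjI)
    show "(v has_field_derivative v1 \<zeta>) (at \<zeta>)"
      unfolding v_def v1_def by (auto intro!: derivative_eq_intros pd z simp: algebra_simps)
    have "(v1 has_field_derivative exp (\<mu> * \<zeta>) * (\<mu> * (\<mu> * p (exp \<zeta>) + p1 (exp \<zeta>)) + (\<mu> * p1 (exp \<zeta>) + p2 (exp \<zeta>)))) (at \<zeta>)"
      unfolding v1_def by (auto intro!: derivative_eq_intros pd z simp: algebra_simps)
    also have "exp (\<mu> * \<zeta>) * (\<mu> * (\<mu> * p (exp \<zeta>) + p1 (exp \<zeta>)) + (\<mu> * p1 (exp \<zeta>) + p2 (exp \<zeta>)))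
      = exp (\<mu> * \<zeta>) * (\<mu>\<^sup>2 * p (exp \<zeta>) + (p2 (exp \<zeta>) + 2 * \<mu> * p1 (exp \<zeta>)))"
      by (simp add: algebra_simps power2_eq_square)
    also have "\<dots> = (\<mu>\<^sup>2 + (exp \<zeta>)\<^sup>2 * G (exp \<zeta>)) * v \<zeta>"
      unfolding peq[OF a(1)[OF z]] v_def by (simp add: algebra_simps)
    finally show "(v1 has_field_derivative (\<mu>\<^sup>2 + (exp \<zeta>)\<^sup>2 * G (exp \<zeta>)) * v \<zeta>) (at \<zeta>)" .
    have E: "exp (\<mu> * (\<zeta> + \<i> * of_real pi)) = exp (\<i> * of_real pi * \<mu>) * exp (\<mu> * \<zeta>)"
      unfolding exp_add[symmetric] by (simp add: algebra_simps)
    show "v (\<zeta> + \<i> * of_real pi) = exp (\<i> * of_real pi * \<mu>) * v \<zeta>"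
      unfolding v_def exp_shift_i_pi pm E by (simp only: mult.assoc)
    show "v1 (\<zeta> + \<i> * of_real pi) = exp (\<i> * of_real pi * \<mu>) * v1 \<zeta>"
      unfolding v1_def exp_shift_i_pi pm E by (simp only: mult.assoc)
    show "v \<zeta> \<noteq> 0" using pn(1)[OF a(2)[OF z]] by (simp add: v_def)
    have "norm (v \<zeta>) = exp (Re (\<mu> * \<zeta>)) * norm (p (exp \<zeta>))" unfolding v_def norm_mult norm_exp_eq_Re ..
    also have "\<dots> \<le> exp (Re (\<mu> * \<zeta>)) * 2" by (intro mult_left_mono pn a z) simp
    finally show "norm (v \<zeta>) \<le> 2 * exp (Re (\<mu> * \<zeta>))" by (simp only: mult.commute)
  qed
  show ?thesis using aR main by blast
qed

text \<open>
  The half-turn maps solutions to solutions.  The Wronskian of the turned \<open>V\<close> with the recessive solution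
  \<open>v\<close> is \<open>exp (- \<i> \<pi> \<mu>)\<close> times that of \<open>V\<close> with \<open>v\<close>, since \<open>v\<close> is an eigenfunction.  Hence the defect
  \<open>J\<close> has Wronskian \<open>0\<close> with \<open>v\<close> and is a multiple of it.
\<close>

lemma solution_defect_recessive:
  assumes "Re \<mu> \<ge> 0" "R0 > 0" and G: "G holomorphic_on ball 0 R0"
    and even: "\<And>z. norm z < R0 \<Longrightarrow> G (- z) = G z"
    and V: "\<And>\<zeta>. Re \<zeta> < ln R0 \<Longrightarrow> (V has_field_derivative V1 \<zeta>) (at \<zeta>)"
    and V1: "\<And>\<zeta>. Re \<zeta> < ln R0 \<Longrightarrow> (V1 has_field_derivative (\<mu>\<^sup>2 + (exp \<zeta>)\<^sup>2 * G (exp \<zeta>)) * V \<zeta>) (at \<zeta>)"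
  defines "J \<equiv> \<lambda>\<zeta>. V (\<zeta> + \<i> * of_real pi) - exp (- (\<i> * of_real pi * \<mu>)) * V \<zeta>"
  shows "\<And>\<zeta>. Re \<zeta> < ln R0 \<Longrightarrow> J (\<zeta> + \<i> * of_real pi) = exp (\<i> * of_real pi * \<mu>) * J \<zeta>"
    and "\<exists>b M. \<forall>\<zeta>. Re \<zeta> \<le> b \<longrightarrow> norm (J \<zeta>) \<le> M * exp (Re (\<mu> * \<zeta>))"
proof -
  let ?w = "\<i> * of_real pi :: complex"
  let ?e = "exp (- (?w * \<mu>))"
  obtain a v v1 where a: "a \<le> ln R0"
    and v: "\<And>\<zeta>. Re \<zeta> < a \<Longrightarrow> (v has_field_derivative v1 \<zeta>) (at \<zeta>)"
    and v1: "\<And>\<zeta>. Re \<zeta> < a \<Longrightarrow> (v1 has_field_derivative (\<mu>\<^sup>2 + (exp \<zeta>)\<^sup>2 * G (exp \<zeta>)) * v \<zeta>) (at \<zeta>)"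
    and vs: "\<And>\<zeta>. Re \<zeta> < a \<Longrightarrow> v (\<zeta> + ?w) = exp (?w * \<mu>) * v \<zeta>"
    and v1s: "\<And>\<zeta>. Re \<zeta> < a \<Longrightarrow> v1 (\<zeta> + ?w) = exp (?w * \<mu>) * v1 \<zeta>"
    and v0: "\<And>\<zeta>. Re \<zeta> < a \<Longrightarrow> v \<zeta> \<noteq> 0" and vb: "\<And>\<zeta>. Re \<zeta> < a \<Longrightarrow> norm (v \<zeta>) \<le> 2 * exp (Re (\<mu> * \<zeta>))"
    using recessive_solution[OF assms(1,2) G even] by blast
  let ?H = "{\<zeta>. Re \<zeta> < a}"
  have H: "convex ?H" by (rule convex_halfspace_Re_lt)
  have "\<exists>c. \<forall>\<zeta>\<in>?H. V \<zeta> * v1 \<zeta> - V1 \<zeta> * v \<zeta> = c"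
  proof (rule has_field_derivative_zero_constant[OF H])
    fix \<zeta> assume "\<zeta> \<in> ?H"
    then have z: "Re \<zeta> < a" "Re \<zeta> < ln R0" using a by auto
    have "((\<lambda>\<zeta>. V \<zeta> * v1 \<zeta> - V1 \<zeta> * v \<zeta>) has_field_derivative 0) (at \<zeta>)"
      by (auto intro!: derivative_eq_intros V V1 v v1 z simp: algebra_simps)
    then show "((\<lambda>\<zeta>. V \<zeta> * v1 \<zeta> - V1 \<zeta> * v \<zeta>) has_field_derivative 0) (at \<zeta> within ?H)"
      by (rule has_field_derivative_at_within)
  qed
  then obtain c where c: "\<And>\<zeta>. Re \<zeta> < a \<Longrightarrow> V \<zeta> * v1 \<zeta> - V1 \<zeta> * v \<zeta> = c" by blast
  define J1 where "J1 \<zeta> = V1 (\<zeta> + ?w) - ?e * V1 \<zeta>" for \<zeta>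
  have ee: "?e * exp (?w * \<mu>) = 1" by (simp add: exp_add[symmetric])
  have W0: "J \<zeta> * v1 \<zeta> - J1 \<zeta> * v \<zeta> = 0" if z: "Re \<zeta> < a" for \<zeta>
  proof -
    have "Re (\<zeta> + ?w) < a" using z by simp
    from c[OF this] have s: "(V (\<zeta> + ?w) * v1 \<zeta> - V1 (\<zeta> + ?w) * v \<zeta>) * exp (?w * \<mu>) = c"
      unfolding vs[OF z] v1s[OF z] by (simp add: algebra_simps)
    have "J \<zeta> * v1 \<zeta> - J1 \<zeta> * v \<zeta> = (V (\<zeta> + ?w) * v1 \<zeta> - V1 (\<zeta> + ?w) * v \<zeta>) - ?e * (V \<zeta> * v1 \<zeta> - V1 \<zeta> * v \<zeta>)"
      unfolding J_def J1_def by (simp add: algebra_simps)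
    also have "V (\<zeta> + ?w) * v1 \<zeta> - V1 (\<zeta> + ?w) * v \<zeta> = ?e * c"
      unfolding s[symmetric] using ee by (simp add: mult_ac)
    finally show ?thesis unfolding c[OF z] by simp
  qed
  have Jd: "(J has_field_derivative J1 \<zeta>) (at \<zeta>)" if z: "Re \<zeta> < ln R0" for \<zeta>
  proof -
    have "Re (\<zeta> + ?w) < ln R0" using z by simp
    from V[OF this] have "((\<lambda>\<zeta>. V (\<zeta> + ?w)) has_field_derivative V1 (\<zeta> + ?w)) (at \<zeta>)"
      by (rule DERIV_shift[THEN iffD1])
    then show ?thesis unfolding J_def J1_def
      by (intro DERIV_diff DERIV_cmult V z)
  qed
  have "\<exists>k. \<forall>\<zeta>\<in>?H. J \<zeta> / v \<zeta> = k"
  proof (rule has_field_derivative_zero_constant[OF H])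
    fix \<zeta> assume "\<zeta> \<in> ?H"
    then have z: "Re \<zeta> < a" "Re \<zeta> < ln R0" using a by auto
    have "((\<lambda>\<zeta>. J \<zeta> / v \<zeta>) has_field_derivative (J1 \<zeta> * v \<zeta> - J \<zeta> * v1 \<zeta>) / (v \<zeta> * v \<zeta>)) (at \<zeta>)"
      by (intro DERIV_divide Jd v z v0)
    also have "J1 \<zeta> * v \<zeta> - J \<zeta> * v1 \<zeta> = 0" using W0[OF z(1)] by simp
    finally show "((\<lambda>\<zeta>. J \<zeta> / v \<zeta>) has_field_derivative 0) (at \<zeta> within ?H)"
      by (simp add: has_field_derivative_at_within)
  qed
  then obtain k where k: "\<And>\<zeta>. Re \<zeta> < a \<Longrightarrow> J \<zeta> / v \<zeta> = k" by blast
  have Jk: "J \<zeta> = k * v \<zeta>" if "Re \<zeta> < a" for \<zeta> using k[OF that] v0[OF that] by (simp add: field_simps)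
  have "norm (J \<zeta>) \<le> (norm k * 2) * exp (Re (\<mu> * \<zeta>))" if "Re \<zeta> \<le> a - 1" for \<zeta>
  proof -
    have z: "Re \<zeta> < a" using that by simp
    show ?thesis unfolding Jk[OF z] norm_mult using vb[OF z] by (simp add: mult.assoc mult_left_mono)
  qed
  then show "\<exists>b M. \<forall>\<zeta>. Re \<zeta> \<le> b \<longrightarrow> norm (J \<zeta>) \<le> M * exp (Re (\<mu> * \<zeta>))" by blast
  fix \<zeta> :: complex assume z: "Re \<zeta> < ln R0"
  let ?L = "{\<zeta>. Re \<zeta> < ln R0}"
  have Jh: "J holomorphic_on ?L"
    using Jd by (auto simp: holomorphic_on_open open_halfspace_Re_lt)
  have Js: "(\<lambda>\<zeta>. J (\<zeta> + ?w)) holomorphic_on ?L"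
    by (rule holomorphic_on_compose_gen[OF _ Jh, of "\<lambda>\<zeta>. \<zeta> + ?w", unfolded o_def])
       (auto intro!: holomorphic_intros)
  have "J (\<zeta> + ?w) - exp (?w * \<mu>) * J \<zeta> = 0"
  proof (rule analytic_continuation[where S="?L" and U="?H" and f="\<lambda>\<zeta>. J (\<zeta> + ?w) - exp (?w * \<mu>) * J \<zeta>" and \<xi>="of_real (a - 1)"])
    show "(\<lambda>\<zeta>. J (\<zeta> + ?w) - exp (?w * \<mu>) * J \<zeta>) holomorphic_on ?L"
      by (intro holomorphic_intros Jh Js)
    show "open ?L" by (rule open_halfspace_Re_lt)
    show "connected ?L" by (intro convex_connected convex_halfspace_Re_lt)
    show "?H \<subseteq> ?L" using a by auto
    show "complex_of_real (a - 1) \<in> ?L" using a by simp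
    have "complex_of_real (a - 1) \<in> ?H" by simp
    then show "complex_of_real (a - 1) islimpt ?H"
      by (intro interior_limit_point) (simp add: interior_open open_halfspace_Re_lt)
    show "\<zeta> \<in> ?L" using z by simp
    fix t assume "t \<in> ?H"
    then have t: "Re t < a" "Re (t + ?w) < a" by auto
    show "J (t + ?w) - exp (?w * \<mu>) * J t = 0"
      unfolding Jk[OF t(1)] Jk[OF t(2)] vs[OF t(1)] by simp
  qed
  then show "J (\<zeta> + ?w) = exp (?w * \<mu>) * J \<zeta>" by simp
qed

section \<open>Unrestricted validity of the expansion\<close>

lemma norm_exp_le_iff: "0 < R \<Longrightarrow> norm (exp \<zeta>) \<le> R \<longleftrightarrow> Re \<zeta> \<le> ln R"
  by (metis exp_le_cancel_iff exp_ln norm_exp_eq_Re)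

lemma norm_exp_less_iff: "0 < R \<Longrightarrow> norm (exp \<zeta>) < R \<longleftrightarrow> Re \<zeta> < ln R"
  by (metis exp_less_cancel_iff exp_ln norm_exp_eq_Re)

text \<open>
  Dividing by \<open>z\<close> removes the first-order term: in the chart the equation becomes
  \<open>V'' = (\<mu>\<^sup>2 + z\<^sup>2 (u\<^sup>2 + f z)) V\<close>.
\<close>

lemma ode_solution_chart:
  assumes "ode_solution \<mu> f R0 u w" "0 < R0"
  defines "V \<equiv> \<lambda>\<zeta>. exp (- \<zeta>) * w \<zeta>"
  shows "\<exists>V1. \<forall>\<zeta>. Re \<zeta> < ln R0 \<longrightarrow> (V has_field_derivative V1 \<zeta>) (at \<zeta>) \<and>
    (V1 has_field_derivative (\<mu>\<^sup>2 + (exp \<zeta>)\<^sup>2 * ((of_real u)\<^sup>2 + f (exp \<zeta>))) * V \<zeta>) (at \<zeta>)"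
proof -
  let ?L = "{\<zeta>. Re \<zeta> < ln R0}"
  have L: "surface_disc R0 = ?L" unfolding surface_disc_def norm_exp_less_iff[OF assms(2)] ..
  have oL: "open ?L" by (rule open_halfspace_Re_lt)
  have hol: "w holomorphic_on ?L" using assms(1) unfolding ode_solution_def L by simp
  have hol1: "deriv w holomorphic_on ?L" by (rule holomorphic_deriv[OF hol oL])
  define V1 where "V1 \<zeta> = exp (- \<zeta>) * (deriv w \<zeta> - w \<zeta>)" for \<zeta>
  have "(V has_field_derivative V1 \<zeta>) (at \<zeta>) \<and>
    (V1 has_field_derivative (\<mu>\<^sup>2 + (exp \<zeta>)\<^sup>2 * ((of_real u)\<^sup>2 + f (exp \<zeta>))) * V \<zeta>) (at \<zeta>)"
    if z: "Re \<zeta> < ln R0" for \<zeta>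
  proof
    have w1: "(w has_field_derivative deriv w \<zeta>) (at \<zeta>)" using holomorphic_derivI[OF hol oL] z by simp
    have w2: "(deriv w has_field_derivative deriv (deriv w) \<zeta>) (at \<zeta>)" using holomorphic_derivI[OF hol1 oL] z by simp
    show "(V has_field_derivative V1 \<zeta>) (at \<zeta>)"
      unfolding V_def V1_def by (auto intro!: derivative_eq_intros w1 simp: algebra_simps)
    have "((\<lambda>\<zeta>. deriv w \<zeta> / exp \<zeta>) has_field_derivative (deriv (deriv w) \<zeta> - deriv w \<zeta>) / exp \<zeta>) (at \<zeta>)"
      by (auto intro!: derivative_eq_intros w2 simp: field_simps)
    then have "deriv_z (deriv_z w) \<zeta> = (deriv (deriv w) \<zeta> - deriv w \<zeta>) / exp \<zeta> / exp \<zeta>"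
      unfolding deriv_z_def[abs_def] by (simp add: DERIV_imp_deriv)
    moreover have "deriv_z (deriv_z w) \<zeta> = 1 / exp \<zeta> * deriv_z w \<zeta>
          + ((of_real u)\<^sup>2 + (\<mu>\<^sup>2 - 1) / (exp \<zeta>)\<^sup>2 + f (exp \<zeta>)) * w \<zeta>"
      using assms(1) z unfolding ode_solution_def L by simp
    moreover have "deriv_z w \<zeta> = deriv w \<zeta> / exp \<zeta>" by (rule deriv_z_def)
    ultimately have "(deriv (deriv w) \<zeta> - deriv w \<zeta>) / exp \<zeta> / exp \<zeta> = 1 / exp \<zeta> * (deriv w \<zeta> / exp \<zeta>)
          + ((of_real u)\<^sup>2 + (\<mu>\<^sup>2 - 1) / (exp \<zeta>)\<^sup>2 + f (exp \<zeta>)) * w \<zeta>"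
      by (simp only:)
    then have ode: "deriv (deriv w) \<zeta> = 2 * deriv w \<zeta>
       + ((exp \<zeta>)\<^sup>2 * ((of_real u)\<^sup>2 + f (exp \<zeta>)) + \<mu>\<^sup>2 - 1) * w \<zeta>"
      by (simp add: field_simps power2_eq_square)
    have "(V1 has_field_derivative exp (- \<zeta>) * (deriv (deriv w) \<zeta> - 2 * deriv w \<zeta> + w \<zeta>)) (at \<zeta>)"
      unfolding V1_def by (auto intro!: derivative_eq_intros w1 w2 simp: algebra_simps)
    also have "exp (- \<zeta>) * (deriv (deriv w) \<zeta> - 2 * deriv w \<zeta> + w \<zeta>)
      = (\<mu>\<^sup>2 + (exp \<zeta>)\<^sup>2 * ((of_real u)\<^sup>2 + f (exp \<zeta>))) * V \<zeta>"
      unfolding ode V_def by (simp add: algebra_simps)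
    finally show "(V1 has_field_derivative (\<mu>\<^sup>2 + (exp \<zeta>)\<^sup>2 * ((of_real u)\<^sup>2 + f (exp \<zeta>))) * V \<zeta>) (at \<zeta>)" .
  qed
  then show ?thesis by blast
qed

text \<open>
  The whole error is charged to the larger of the two terms; this works also at the zeros of either one.
\<close>

lemma split_error:
  fixes E a b :: complex
  assumes "norm E \<le> q * (norm a + norm b)" "0 \<le> q"
  shows "\<exists>g h. E = a * g - b * h \<and> norm g + norm h \<le> 2 * q"
proof (cases "norm a \<ge> norm b")
  case True
  show ?thesis
  proof (cases "a = 0")
    case False
    have "norm E \<le> q * (2 * norm a)" by (rule order_trans[OF assms(1)]) (use True assms(2) in \<open>auto intro: mult_left_mono\<close>)
    then show ?thesis using False by (intro exI[of _ "E / a"] exI[of _ 0]) (simp add: norm_divide field_simps)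
  qed (use assms True in \<open>auto intro!: exI[of _ 0]\<close>)
next
  case False
  then have b: "b \<noteq> 0" by auto
  have "norm E \<le> q * (2 * norm b)" by (rule order_trans[OF assms(1)]) (use False assms(2) in \<open>auto intro: mult_left_mono\<close>)
  then show ?thesis using b by (intro exI[of _ 0] exI[of _ "- (E / b)"]) (simp add: norm_divide field_simps)
qed

lemma analytic_bounded_on_cball:
  assumes "F analytic_on ball 0 R0" "R < R0"
  shows "\<exists>C\<ge>0. \<forall>z. norm z \<le> R \<longrightarrow> norm (F z) \<le> C"
proof -
  have "F holomorphic_on ball 0 R0" using assms(1) by (simp add: analytic_on_open)
  then have "continuous_on (cball 0 R) F"
    using assms(2) by (intro holomorphic_on_imp_continuous_on) (auto elim: holomorphic_on_subset)
  then have "bounded (F ` cball 0 R)" by (intro compact_imp_bounded compact_continuous_image compact_cball)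
  then obtain C where "\<forall>x\<in>F ` cball 0 R. norm x \<le> C" unfolding bounded_iff ..
  then show ?thesis by (intro exI[of _ "\<bar>C\<bar>"]) force
qed

lemma analytic_vanishing_linear_bound:
  assumes "F analytic_on ball 0 R0" "R < R0" "F 0 = 0"
  shows "\<exists>C\<ge>0. \<forall>z. norm z \<le> R \<longrightarrow> norm (F z) \<le> C * norm z"
proof -
  have hol: "F holomorphic_on ball 0 R0" using assms(1) by (simp add: analytic_on_open)
  then have "deriv F analytic_on ball 0 R0" by (simp add: analytic_on_open holomorphic_deriv)
  then obtain C where C: "C \<ge> 0" "\<And>z. norm z \<le> R \<Longrightarrow> norm (deriv F z) \<le> C"
    using analytic_bounded_on_cball[OF _ assms(2)] by blast
  have "norm (F z) \<le> C * norm z" if "norm z \<le> R" for z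
  proof -
    have "norm (F z - F 0) \<le> C * norm (z - 0)"
    proof (rule field_differentiable_bound[where S="cball 0 R" and f'="deriv F"])
      fix t :: complex assume t: "t \<in> cball 0 R"
      then have "(F has_field_derivative deriv F t) (at t)"
        using assms(2) by (intro holomorphic_derivI[OF hol]) auto
      then show "(F has_field_derivative deriv F t) (at t within cball 0 R)" by (rule has_field_derivative_at_within)
      show "norm (deriv F t) \<le> C" using t by (intro C) simp
    qed (use that in \<open>auto intro: order_trans[OF norm_ge_zero]\<close>)
    then show ?thesis by (simp add: assms(3))
  qed
  then show ?thesis using C(1) by blast
qed

theorem theorem4p1:
  fixes \<mu> :: complex and R R0 \<delta>\<^sub>0 :: real and f :: "complex \<Rightarrow> complex"
    and A B :: "nat \<Rightarrow> complex \<Rightarrow> complex" and W\<^sub>2 :: "real \<Rightarrow> complex \<Rightarrow> complex"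
  assumes "Re \<mu> \<ge> 0"
    and "0 < R" "R < R0"
    and "f analytic_on ball 0 R0" "\<forall>z\<in>ball 0 R0. f (- z) = f z"
    and "olver_coefficients \<mu> f R0 A B"
    and "0 < \<delta>\<^sub>0" "\<delta>\<^sub>0 < pi / 2"
    and "\<forall>u>0. ode_solution \<mu> f R0 u (W\<^sub>2 u)"
    and "olver_expansion_on (surface_sector R (3 / 2 * pi - \<delta>\<^sub>0)) \<mu> A B W\<^sub>2"
  shows "olver_expansion_on (surface_cdisc R) \<mu> A B W\<^sub>2"
  unfolding olver_expansion_on_def
proof (intro allI impI)
  fix N :: nat assume N: "N \<ge> 1"
  let ?w = "\<i> * of_real pi :: complex"
  have R0: "0 < R0" using assms by simp
  have Aan: "\<And>s. A s analytic_on ball 0 R0" and Aev: "\<And>s z. norm z < R0 \<Longrightarrow> A s (- z) = A s z"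
    and Ban: "\<And>s. B s analytic_on ball 0 R0" and Bod: "\<And>s z. norm z < R0 \<Longrightarrow> B s (- z) = - B s z"
    using assms(6) unfolding olver_coefficients_def by auto
  have B0: "B s 0 = 0" for s using Bod[of 0 s] R0 by simp
  obtain C P \<sigma> where C: "C > 0" and est: "\<forall>T T' \<epsilon> a M e j s. error_term \<mu> T T' \<epsilon> a M e j \<longrightarrow> \<sigma> \<le> T \<longrightarrow> Re s \<le> T \<longrightarrow>
    norm (e s) \<le> \<epsilon> * (C * (1 + exp T) ^ P) * K_size \<mu> s"
    using connection_estimate[OF assms(1)] by blast
  \<comment> \<open>The number of terms is raised so that the excess powers of \<open>u\<close> absorb the loss of \<open>u ^ P\<close>.\<close>
  define M where "M = N + P + 1"
  have "M \<ge> 1" by (simp add: M_def)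
  note ex = mp[OF spec[OF assms(10)[unfolded olver_expansion_on_def]] this]
  obtain g h :: "real \<Rightarrow> complex \<Rightarrow> complex" and K u0 :: real where gh0: "K > 0 \<and> u0 > 0 \<and>
      (\<forall>u\<ge>u0. \<forall>\<zeta>\<in>surface_sector R (3 / 2 * pi - \<delta>\<^sub>0).
           W\<^sub>2 u \<zeta> =
             exp \<zeta> * bessel_K \<mu> (of_real (ln u) + \<zeta>) *
               ((\<Sum>s<M. A s (exp \<zeta>) / of_real u ^ (2 * s)) + g u \<zeta>)
             - exp \<zeta> / of_real u * bessel_K (\<mu> + 1) (of_real (ln u) + \<zeta>) *
               ((\<Sum>s<M. B s (exp \<zeta>) / of_real u ^ (2 * s)) + exp \<zeta> * h u \<zeta>) \<and>
           norm (g u \<zeta>) + norm (h u \<zeta>) \<le> K / u ^ (2 * M))"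
    using ex by (elim exE) (rule that)
  have K: "K > 0" "u0 > 0" using gh0 by blast+
  note W = conjunct2[OF conjunct2[OF gh0]]
  obtain CA where CA: "CA \<ge> 0" "\<And>s z. s < M \<Longrightarrow> norm z \<le> R \<Longrightarrow> norm (A s z) \<le> CA"
  proof -
    obtain c where "\<And>s. c s \<ge> 0 \<and> (\<forall>z. norm z \<le> R \<longrightarrow> norm (A s z) \<le> c s)"
      using analytic_bounded_on_cball[OF Aan assms(3)] by metis
    then show thesis
      by (intro that[of "\<Sum>s<M. c s"]) (auto intro!: sum_nonneg intro: order_trans[OF _ member_le_sum])
  qed
  obtain CB where CB: "CB \<ge> 0" "\<And>s z. s < M \<Longrightarrow> norm z \<le> R \<Longrightarrow> norm (B s z) \<le> CB * norm z"
  proof -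
    obtain c where c: "\<And>s. c s \<ge> 0 \<and> (\<forall>z. norm z \<le> R \<longrightarrow> norm (B s z) \<le> c s * norm z)"
      using analytic_vanishing_linear_bound[OF Ban assms(3) B0] by metis
    have "norm (B s z) \<le> (\<Sum>s<M. c s) * norm z" if "s < M" "norm z \<le> R" for s z
    proof -
      have "norm (B s z) \<le> c s * norm z" using c that by blast
      also have "\<dots> \<le> (\<Sum>s<M. c s) * norm z" using c that by (intro mult_right_mono member_le_sum) auto
      finally show ?thesis .
    qed
    then show thesis using c by (intro that[of "\<Sum>s<M. c s"]) (auto intro!: sum_nonneg)
  qed
  \<comment> \<open>The last entry ensures \<open>\<sigma> \<le> ln (u R)\<close>.\<close>
  define u1 where "u1 = max (max u0 1) (exp \<sigma> / R)"
  define c0 where "c0 = K * C * (1 + R) ^ P"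
  define K' where "K' = real M * CA + real M * CB + 2 * c0"
  have c0: "c0 > 0" using K C assms(2) by (simp add: c0_def)
  have K': "K' > 0" using c0 CA CB by (simp add: K'_def add_nonneg_pos)
  define good where "good u \<zeta> g h \<longleftrightarrow> W\<^sub>2 u \<zeta> =
             exp \<zeta> * bessel_K \<mu> (of_real (ln u) + \<zeta>) *
               ((\<Sum>s<N. A s (exp \<zeta>) / of_real u ^ (2 * s)) + g)
             - exp \<zeta> / of_real u * bessel_K (\<mu> + 1) (of_real (ln u) + \<zeta>) *
               ((\<Sum>s<N. B s (exp \<zeta>) / of_real u ^ (2 * s)) + exp \<zeta> * h) \<and>
           norm g + norm h \<le> K' / u ^ (2 * N)" for u \<zeta> g h
  have main: "\<exists>g h. good u \<zeta> g h"
    if u: "u1 \<le> u" and \<zeta>: "\<zeta> \<in> surface_cdisc R" for u \<zeta>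
  proof -
    have u': "u0 \<le> u" "1 \<le> u" "exp \<sigma> / R \<le> u" "0 < u" using u by (auto simp: u1_def)
    let ?l = "of_real (ln u) :: complex"
    define SA where "SA n z = (\<Sum>s<n. A s z / of_real u ^ (2 * s))" for n z
    define SB where "SB n z = (\<Sum>s<n. B s z / of_real u ^ (2 * s))" for n z
    have SAm: "SA n (- z) = SA n z" and SBm: "SB n (- z) = - SB n z" if "norm z < R0" for n z
      using that by (simp_all add: SA_def SB_def Aev Bod sum_negf)
    have SAh: "SA n holomorphic_on ball 0 R0" and SBh: "SB n holomorphic_on ball 0 R0" for n
      unfolding SA_def SB_def using Aan Ban u'(4)
      by (auto intro!: holomorphic_intros simp: analytic_on_open)
    have eu: "exp (?l + \<zeta>) = of_real u * exp \<zeta>" for \<zeta>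
      using u'(4) by (simp add: exp_add exp_of_real)
    define G where "G z = (of_real u)\<^sup>2 + f z" for z
    have Gh: "G holomorphic_on ball 0 R0" unfolding G_def
      using assms(4) by (intro holomorphic_intros) (simp add: analytic_on_open)
    have Ge: "G (- z) = G z" if "norm z < R0" for z using assms(5) that by (simp add: G_def)
    define V where "V \<zeta> = exp (- \<zeta>) * W\<^sub>2 u \<zeta>" for \<zeta>
    obtain V1 where V: "\<And>\<zeta>. Re \<zeta> < ln R0 \<Longrightarrow> (V has_field_derivative V1 \<zeta>) (at \<zeta>)"
      and V1: "\<And>\<zeta>. Re \<zeta> < ln R0 \<Longrightarrow> (V1 has_field_derivative (\<mu>\<^sup>2 + (exp \<zeta>)\<^sup>2 * G (exp \<zeta>)) * V \<zeta>) (at \<zeta>)"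
      using ode_solution_chart[OF assms(9)[rule_format, OF u'(4)] R0] unfolding V_def G_def by blast
    define J where "J \<zeta> = V (\<zeta> + ?w) - exp (- (?w * \<mu>)) * V \<zeta>" for \<zeta>
    have Js: "J (\<zeta> + ?w) = exp (?w * \<mu>) * J \<zeta>" if "Re \<zeta> < ln R0" for \<zeta>
      using solution_defect_recessive(1)[OF assms(1) R0 Gh Ge V V1 that] unfolding J_def .
    obtain b Mb where Jb: "\<And>\<zeta>. Re \<zeta> \<le> b \<Longrightarrow> norm (J \<zeta>) \<le> Mb * exp (Re (\<mu> * \<zeta>))"
      using solution_defect_recessive(2)[OF assms(1) R0 Gh Ge V V1] unfolding J_def by blast
    \<comment> \<open>\<open>E\<close> is the error after \<open>M\<close> terms, divided by \<open>z\<close>.  Its half-turn defect \<open>Q\<close> is the defect of the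
      solution plus \<open>\<i> \<pi>\<close> times the expansion with \<open>K\<^sub>\<mu>, - K\<^sub>\<mu>\<^sub>+\<^sub>1\<close> replaced by \<open>I\<^sub>\<mu>, I\<^sub>\<mu>\<^sub>+\<^sub>1\<close>, by the parity of the coefficients.\<close>
    define E where "E \<zeta> = V \<zeta> - (bessel_K \<mu> (?l + \<zeta>) * SA M (exp \<zeta>) - bessel_K (\<mu> + 1) (?l + \<zeta>) / of_real u * SB M (exp \<zeta>))" for \<zeta>
    define Q where "Q \<zeta> = J \<zeta> + ?w * (bessel_I \<mu> (?l + \<zeta>) * SA M (exp \<zeta>) + bessel_I (\<mu> + 1) (?l + \<zeta>) / of_real u * SB M (exp \<zeta>))" for \<zeta>
    define \<epsilon> where "\<epsilon> = K / u ^ (2 * M)"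
    have \<epsilon>: "0 \<le> \<epsilon>" using K u' by (simp add: \<epsilon>_def)
    have Es: "E (\<zeta> + ?w) = exp (- (?w * \<mu>)) * E \<zeta> + Q \<zeta>" if z: "Re \<zeta> < ln R0" for \<zeta>
    proof -
      have n: "norm (exp \<zeta>) < R0" using z R0 by (simp only: norm_exp_less_iff)
      have as: "?l + (\<zeta> + ?w) = (?l + \<zeta>) + ?w" by (simp only: add.assoc)
      show ?thesis
        unfolding E_def Q_def J_def as bessel_K_shift exp_shift_i_pi exp_i_pi_add_one SAm[OF n] SBm[OF n]
        by (simp add: divide_inverse algebra_simps)
    qed
    have Qs: "Q (\<zeta> + ?w) = exp (?w * \<mu>) * Q \<zeta>" if z: "Re \<zeta> < ln R0" for \<zeta>
    proof -
      have n: "norm (exp \<zeta>) < R0" using z R0 by (simp only: norm_exp_less_iff)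
      have as: "?l + (\<zeta> + ?w) = (?l + \<zeta>) + ?w" by (simp only: add.assoc)
      show ?thesis
        unfolding Q_def Js[OF z] as bessel_I_shift exp_shift_i_pi exp_i_pi_add_one SAm[OF n] SBm[OF n]
        by (simp add: field_simps)
    qed
    have lnuR: "ln (u * R) = ln u + ln R" "ln (u * R0) = ln u + ln R0" using u' assms by (simp_all add: ln_mult)
    obtain C1 where C1: "C1 > 0" "\<And>s. Re s \<le> 0 \<Longrightarrow> norm (bessel_I \<mu> s) \<le> C1 * exp (Re (\<mu> * s))"
      using bessel_I_small[of \<mu>] by blast
    obtain C2 where C2: "C2 > 0" "\<And>s. Re s \<le> 0 \<Longrightarrow> norm (bessel_I (\<mu> + 1) s) \<le> C2 * exp (Re ((\<mu> + 1) * s))"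
      using bessel_I_small[of "\<mu> + 1"] by blast
    obtain D1 where D1: "D1 \<ge> 0" "\<And>z. norm z \<le> R \<Longrightarrow> norm (SA M z) \<le> D1"
      using analytic_bounded_on_cball[of "SA M" R0 R] SAh assms(3) by (auto simp: analytic_on_open)
    obtain D2 where D2: "D2 \<ge> 0" "\<And>z. norm z \<le> R \<Longrightarrow> norm (SB M z) \<le> D2"
      using analytic_bounded_on_cball[of "SB M" R0 R] SBh assms(3) by (auto simp: analytic_on_open)
    define a where "a = min (b + ln u) (min 0 (ln R + ln u))"
    define Mc where "Mc = \<bar>Mb\<bar> * exp (- (Re \<mu> * ln u)) + pi * (C1 * D1 + C2 * D2)"
    have "error_term \<mu> (ln (u * R)) (ln (u * R0)) \<epsilon> a Mc (\<lambda>s. E (s - ?l)) (\<lambda>s. Q (s - ?l))"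
    proof
      show "ln (u * R) < ln (u * R0)" using assms u' by simp
      show "0 \<le> \<epsilon>" by (rule \<epsilon>)
      fix s :: complex
      have sw: "s + ?w - ?l = (s - ?l) + ?w" by simp
      show "E (s + ?w - ?l) = exp (- (?w * \<mu>)) * E (s - ?l) + Q (s - ?l)" if "Re s < ln (u * R0)"
        unfolding sw by (rule Es) (use that lnuR in simp)
      show "Q (s + ?w - ?l) = exp (?w * \<mu>) * Q (s - ?l)" if "Re s < ln (u * R0)"
        unfolding sw by (rule Qs) (use that lnuR in simp)
      show "norm (Q (s - ?l)) \<le> Mc * exp (Re (\<mu> * s))" if sa: "Re s \<le> a"
      proof -
        have s: "Re s \<le> 0" "Re (s - ?l) \<le> b" "Re (s - ?l) \<le> ln R" using sa by (auto simp: a_def)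
        have n: "norm (exp (s - ?l)) \<le> R" using s(3) assms(2) by (simp only: norm_exp_le_iff)
        have j1: "norm (J (s - ?l)) \<le> (\<bar>Mb\<bar> * exp (- (Re \<mu> * ln u))) * exp (Re (\<mu> * s))"
        proof -
          have "norm (J (s - ?l)) \<le> Mb * exp (Re (\<mu> * (s - ?l)))" by (rule Jb[OF s(2)])
          also have "\<dots> \<le> \<bar>Mb\<bar> * exp (Re (\<mu> * (s - ?l)))" by (intro mult_right_mono) auto
          also have "exp (Re (\<mu> * (s - ?l))) = exp (- (Re \<mu> * ln u)) * exp (Re (\<mu> * s))"
            unfolding exp_add[symmetric] by (simp add: algebra_simps)
          finally show ?thesis by (simp only: mult.assoc)
        qed
        have i1: "norm (bessel_I \<mu> s * SA M (exp (s - ?l))) \<le> (C1 * D1) * exp (Re (\<mu> * s))"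
        proof -
          have "norm (bessel_I \<mu> s * SA M (exp (s - ?l))) \<le> (C1 * exp (Re (\<mu> * s))) * D1"
            unfolding norm_mult by (intro mult_mono C1(2) s D1(2) n) (use C1(1) in auto)
          then show ?thesis by (simp only: mult_ac)
        qed
        have i2: "norm (bessel_I (\<mu> + 1) s / of_real u * SB M (exp (s - ?l))) \<le> (C2 * D2) * exp (Re (\<mu> * s))"
        proof -
          have "norm (bessel_I (\<mu> + 1) s / of_real u) \<le> norm (bessel_I (\<mu> + 1) s) / 1"
            unfolding norm_divide norm_of_real using u' by (intro divide_left_mono) auto
          also have "\<dots> \<le> C2 * exp (Re ((\<mu> + 1) * s))" using C2(2)[OF s(1)] by simp
          also have "\<dots> \<le> C2 * exp (Re (\<mu> * s))" using C2(1) s(1) by (simp add: algebra_simps)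
          finally have "norm (bessel_I (\<mu> + 1) s / of_real u) \<le> C2 * exp (Re (\<mu> * s))" .
          then have "norm (bessel_I (\<mu> + 1) s / of_real u * SB M (exp (s - ?l))) \<le> (C2 * exp (Re (\<mu> * s))) * D2"
            unfolding norm_mult[of _ "SB M _"] by (intro mult_mono D2(2) n) (use C2(1) in auto)
          then show ?thesis by (simp only: mult_ac)
        qed
        have ls: "?l + (s - ?l) = s" by simp
        have "norm (Q (s - ?l)) \<le> norm (J (s - ?l)) + norm (?w * (bessel_I \<mu> s * SA M (exp (s - ?l)) + bessel_I (\<mu> + 1) s / of_real u * SB M (exp (s - ?l))))"
          unfolding Q_def ls by (rule norm_triangle_ineq)
        also have "norm (?w * (bessel_I \<mu> s * SA M (exp (s - ?l)) + bessel_I (\<mu> + 1) s / of_real u * SB M (exp (s - ?l))))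
          \<le> pi * ((C1 * D1) * exp (Re (\<mu> * s)) + (C2 * D2) * exp (Re (\<mu> * s)))"
          unfolding norm_mult[of ?w] using order_trans[OF norm_triangle_ineq add_mono[OF i1 i2]]
          by (simp add: norm_mult)
        finally show ?thesis using j1 by (simp add: Mc_def algebra_simps)
      qed
      show "norm (E (s - ?l)) \<le> \<epsilon> * K_size \<mu> s" if s: "Re s \<le> ln (u * R)" "\<bar>Im s\<bar> \<le> pi"
      proof -
        let ?z = "s - ?l"
        have ls: "?l + ?z = s" by simp
        have n: "norm (exp ?z) \<le> R" using s assms(2) by (simp only: norm_exp_le_iff) (simp add: lnuR)
        have "\<bar>Im ?z\<bar> \<le> 3 / 2 * pi - \<delta>\<^sub>0" using s assms(8) by simp
        then have "?z \<in> surface_sector R (3 / 2 * pi - \<delta>\<^sub>0)" using n by (simp only: surface_sector_def mem_Collect_eq)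
        note Wz = bspec[OF mp[OF spec[OF W, of u] u'(1)] this]
        have es: "exp s = of_real u * exp ?z" using eu[of ?z] unfolding ls .
        have "V ?z = exp (- ?z) * (exp ?z * (bessel_K \<mu> s * (SA M (exp ?z) + g u ?z)
           - bessel_K (\<mu> + 1) s / of_real u * (SB M (exp ?z) + exp ?z * h u ?z)))"
          unfolding V_def conjunct1[OF Wz] ls SA_def[symmetric] SB_def[symmetric] by (simp add: right_diff_distrib mult.assoc)
        also have "\<dots> = bessel_K \<mu> s * (SA M (exp ?z) + g u ?z)
           - bessel_K (\<mu> + 1) s / of_real u * (SB M (exp ?z) + exp ?z * h u ?z)"
          by (simp only: mult.assoc[symmetric] exp_add[symmetric]) simp
        finally have "E ?z = bessel_K \<mu> s * g u ?z - (exp s * bessel_K (\<mu> + 1) s) / (of_real u)\<^sup>2 * h u ?z"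
          unfolding E_def ls es using u'(4) by (simp add: field_simps power2_eq_square)
        then have "norm (E ?z) \<le> norm (bessel_K \<mu> s) * norm (g u ?z) + norm (exp s * bessel_K (\<mu> + 1) s) / u\<^sup>2 * norm (h u ?z)"
          using norm_triangle_ineq4[of "bessel_K \<mu> s * g u ?z" "(exp s * bessel_K (\<mu> + 1) s) / (of_real u)\<^sup>2 * h u ?z"]
          by (simp add: norm_mult norm_divide norm_power)
        also have "\<dots> \<le> norm (bessel_K \<mu> s) * (norm (g u ?z) + norm (h u ?z)) + norm (exp s * bessel_K (\<mu> + 1) s) * (norm (g u ?z) + norm (h u ?z))"
        proof (intro add_mono mult_mono)
          have "1 \<le> u\<^sup>2" using u' by (simp add: one_le_power)
          then have "norm (exp s * bessel_K (\<mu> + 1) s) / u\<^sup>2 \<le> norm (exp s * bessel_K (\<mu> + 1) s) / 1"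
            by (intro divide_left_mono) auto
          then show "norm (exp s * bessel_K (\<mu> + 1) s) / u\<^sup>2 \<le> norm (exp s * bessel_K (\<mu> + 1) s)" by simp
        qed auto
        also have "\<dots> = (norm (g u ?z) + norm (h u ?z)) * K_size \<mu> s" by (simp add: K_size_def algebra_simps)
        also have "\<dots> \<le> \<epsilon> * K_size \<mu> s"
          unfolding \<epsilon>_def by (intro mult_right_mono K_size_nonneg conjunct2[OF Wz])
        finally show ?thesis .
      qed
    next
      show "(\<lambda>s. Q (s - ?l)) holomorphic_on {s. Re s < ln (u * R0)}"
      proof -
        let ?L = "{\<zeta>. Re \<zeta> < ln R0}"
        have V_hol: "V holomorphic_on ?L"
          using V by (auto simp: holomorphic_on_open open_halfspace_Re_lt)
        have e: "exp \<zeta> \<in> ball 0 R0" if "\<zeta> \<in> ?L" for \<zeta>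
          using that R0 by (simp only: mem_ball_0 mem_Collect_eq norm_exp_less_iff)
        have Vs: "(\<lambda>\<zeta>. V (\<zeta> + ?w)) holomorphic_on ?L"
          by (rule holomorphic_on_compose_gen[OF _ V_hol, of "\<lambda>\<zeta>. \<zeta> + ?w", unfolded o_def]) (auto intro!: holomorphic_intros)
        have SAe: "(\<lambda>\<zeta>. SA M (exp \<zeta>)) holomorphic_on ?L"
          by (rule holomorphic_on_compose_gen[OF _ SAh, of exp, unfolded o_def]) (use e in \<open>auto intro!: holomorphic_intros\<close>)
        have SBe: "(\<lambda>\<zeta>. SB M (exp \<zeta>)) holomorphic_on ?L"
          by (rule holomorphic_on_compose_gen[OF _ SBh, of exp, unfolded o_def]) (use e in \<open>auto intro!: holomorphic_intros\<close>)
        have "Q holomorphic_on ?L" unfolding Q_def J_def using u'(4)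
          by (intro holomorphic_intros V_hol Vs SAe SBe) auto
        then show ?thesis
          by (rule holomorphic_on_compose_gen[of "\<lambda>s. s - ?l", unfolded o_def, rotated])
             (auto intro!: holomorphic_intros simp: lnuR)
      qed
    qed
    moreover have "\<sigma> \<le> ln (u * R)"
    proof -
      have "exp \<sigma> \<le> u * R" using u'(3) assms(2) by (simp add: field_simps)
      then show ?thesis using u' assms(2) by (simp add: ln_ge_iff)
    qed
    moreover have \<zeta>R: "norm (exp \<zeta>) \<le> R" using \<zeta> by (simp only: surface_cdisc_def mem_Collect_eq)
    then have "Re (?l + \<zeta>) \<le> ln (u * R)"
      using assms(2) by (simp only: norm_exp_le_iff) (simp add: lnuR)
    ultimately have "norm (E (?l + \<zeta> - ?l)) \<le> \<epsilon> * (C * (1 + exp (ln (u * R))) ^ P) * K_size \<mu> (?l + \<zeta>)"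
      using est by blast
    then have "norm (E \<zeta>) \<le> \<epsilon> * (C * (1 + u * R) ^ P) * K_size \<mu> (?l + \<zeta>)"
      using u' assms(2) by simp
    also have "\<dots> \<le> c0 / u ^ (2 * N + 2) * K_size \<mu> (?l + \<zeta>)"
    proof (intro mult_right_mono K_size_nonneg)
      have "(1 + u * R) ^ P \<le> (u * (1 + R)) ^ P"
        using u' assms(2) by (intro power_mono) (auto simp: algebra_simps)
      then have "\<epsilon> * (C * (1 + u * R) ^ P) \<le> \<epsilon> * (C * (u * (1 + R)) ^ P)"
        using C by (intro mult_left_mono \<epsilon>) auto
      also have "\<dots> = c0 * u ^ P / u ^ (2 * M)" by (simp add: \<epsilon>_def c0_def power_mult_distrib)
      also have "\<dots> = c0 / u ^ (2 * N + 2 + P)"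
      proof -
        have "u ^ (2 * M) = u ^ P * u ^ (2 * N + 2 + P)" unfolding power_add[symmetric] by (simp add: M_def algebra_simps)
        then show ?thesis using u'(4) by simp
      qed
      also have "\<dots> \<le> c0 / u ^ (2 * N + 2)"
        using c0 u' by (intro divide_left_mono power_increasing mult_pos_pos zero_less_power) auto
      finally show "\<epsilon> * (C * (1 + u * R) ^ P) \<le> c0 / u ^ (2 * N + 2)" .
    qed
    finally have Eb: "norm (E \<zeta>) \<le> c0 / u ^ (2 * N + 2) * K_size \<mu> (?l + \<zeta>)" .
    \<comment> \<open>One factor \<open>u\<^sup>2\<close> is spent on passing from \<open>z K\<^sub>\<mu>\<^sub>+\<^sub>1\<close> at \<open>u z\<close> to the weight \<open>(z/u) K\<^sub>\<mu>\<^sub>+\<^sub>1\<close> of the claim.\<close>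
    define k0 where "k0 = bessel_K \<mu> (?l + \<zeta>)"
    define k1 where "k1 = bessel_K (\<mu> + 1) (?l + \<zeta>)"
    define q where "q = c0 / u ^ (2 * N)"
    have q: "q \<ge> 0" using c0 u' by (simp add: q_def)
    have "norm (E \<zeta>) \<le> q * (norm k0 + norm (exp \<zeta> / of_real u * k1))"
    proof -
      have "K_size \<mu> (?l + \<zeta>) = norm k0 + u * norm (exp \<zeta> * k1)"
        using u'(4) by (simp add: K_size_def eu k0_def k1_def norm_mult)
      also have "\<dots> \<le> u\<^sup>2 * norm k0 + u * norm (exp \<zeta> * k1)"
        using u' by (simp add: mult_le_cancel_right1 one_le_power)
      also have "\<dots> = u\<^sup>2 * (norm k0 + norm (exp \<zeta> / of_real u * k1))"
        using u'(4) by (simp add: norm_mult norm_divide field_simps power2_eq_square)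
      finally have "c0 / u ^ (2 * N + 2) * K_size \<mu> (?l + \<zeta>)
        \<le> c0 / u ^ (2 * N + 2) * (u\<^sup>2 * (norm k0 + norm (exp \<zeta> / of_real u * k1)))"
        using c0 u' by (intro mult_left_mono) auto
      also have "\<dots> = q * (norm k0 + norm (exp \<zeta> / of_real u * k1))"
      proof -
        have "c0 / (y * v) * (v * x) = c0 / y * x" if "v \<noteq> 0" "y \<noteq> 0" for v x y :: real
          using that by simp
        then show ?thesis unfolding q_def power_add using u'(4) by simp
      qed
      finally show ?thesis using Eb by simp
    qed
    from split_error[OF this q] obtain g1 h1
      where gh: "E \<zeta> = k0 * g1 - exp \<zeta> / of_real u * k1 * h1" "norm g1 + norm h1 \<le> 2 * q" by blast
    \<comment> \<open>The terms with index from \<open>N\<close> to \<open>M - 1\<close> are moved into the remainders.\<close>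
    define tA where "tA = (\<Sum>s\<in>{N..<M}. A s (exp \<zeta>) / of_real u ^ (2 * s))"
    define tB where "tB = (\<Sum>s\<in>{N..<M}. B s (exp \<zeta>) / exp \<zeta> / of_real u ^ (2 * s))"
    have NM: "{..<M} = {..<N} \<union> {N..<M}" "{..<N} \<inter> {N..<M} = {}" by (auto simp: M_def)
    have sA: "SA M (exp \<zeta>) = SA N (exp \<zeta>) + tA"
      unfolding SA_def tA_def NM(1) by (rule sum.union_disjoint) (auto simp: NM(2))
    have "SB M (exp \<zeta>) = SB N (exp \<zeta>) + (\<Sum>s\<in>{N..<M}. B s (exp \<zeta>) / of_real u ^ (2 * s))"
      unfolding SB_def NM(1) by (rule sum.union_disjoint) (auto simp: NM(2))
    also have "(\<Sum>s\<in>{N..<M}. B s (exp \<zeta>) / of_real u ^ (2 * s)) = exp \<zeta> * tB"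
      unfolding tB_def sum_distrib_left by (intro sum.cong) auto
    finally have sB: "SB M (exp \<zeta>) = SB N (exp \<zeta>) + exp \<zeta> * tB" .
    have tail: "norm (\<Sum>s\<in>{N..<M}. F s / of_real u ^ (2 * s)) \<le> real M * c / u ^ (2 * N)"
      if "\<And>s. s < M \<Longrightarrow> norm (F s) \<le> c" "0 \<le> c" for F :: "nat \<Rightarrow> complex" and c
    proof -
      have "norm (\<Sum>s\<in>{N..<M}. F s / of_real u ^ (2 * s)) \<le> (\<Sum>s\<in>{N..<M}. c / u ^ (2 * N))"
      proof (rule sum_norm_le)
        fix s assume s: "s \<in> {N..<M}"
        have "norm (F s / of_real u ^ (2 * s)) = norm (F s) / u ^ (2 * s)"
          using u'(4) by (simp add: norm_divide norm_power)
        also have "\<dots> \<le> c / u ^ (2 * N)"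
          using that s u' by (intro frac_le power_increasing) auto
        finally show "norm (F s / of_real u ^ (2 * s)) \<le> c / u ^ (2 * N)" .
      qed
      also have "\<dots> = real (M - N) * (c / u ^ (2 * N))" by simp
      also have "\<dots> \<le> real M * (c / u ^ (2 * N))" using that u' by (intro mult_right_mono) auto
      finally show ?thesis by simp
    qed
    have tAb: "norm tA \<le> real M * CA / u ^ (2 * N)"
      unfolding tA_def using \<zeta>R by (intro tail CA) auto
    have tBb: "norm tB \<le> real M * CB / u ^ (2 * N)"
      unfolding tB_def
    proof (intro tail CB(1))
      fix s assume "s < M"
      then have "norm (B s (exp \<zeta>)) \<le> CB * norm (exp \<zeta>)" using \<zeta>R by (intro CB)
      then show "norm (B s (exp \<zeta>) / exp \<zeta>) \<le> CB" by (simp add: norm_divide pos_divide_le_eq)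
    qed
    have "W\<^sub>2 u \<zeta> = exp \<zeta> * V \<zeta>" by (simp add: V_def mult.assoc[symmetric] exp_add[symmetric])
    also have "V \<zeta> = E \<zeta> + (k0 * SA M (exp \<zeta>) - k1 / of_real u * SB M (exp \<zeta>))"
      by (simp add: E_def k0_def k1_def)
    also have "exp \<zeta> * \<dots> = exp \<zeta> * k0 * (SA N (exp \<zeta>) + (tA + g1)) - exp \<zeta> / of_real u * k1 * (SB N (exp \<zeta>) + exp \<zeta> * (tB + h1))"
      unfolding gh(1) sA sB using u'(4) by (simp add: field_simps)
    finally have eqn: "W\<^sub>2 u \<zeta> = exp \<zeta> * k0 * (SA N (exp \<zeta>) + (tA + g1)) - exp \<zeta> / of_real u * k1 * (SB N (exp \<zeta>) + exp \<zeta> * (tB + h1))" .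
    have "norm (tA + g1) + norm (tB + h1) \<le> norm tA + norm tB + (norm g1 + norm h1)"
      using norm_triangle_ineq[of tA g1] norm_triangle_ineq[of tB h1] by linarith
    also have "\<dots> \<le> real M * CA / u ^ (2 * N) + real M * CB / u ^ (2 * N) + 2 * q"
      using tAb tBb gh(2) by linarith
    also have "\<dots> = K' / u ^ (2 * N)" by (simp add: K'_def q_def add_divide_distrib)
    finally have "good u \<zeta> (tA + g1) (tB + h1)"
      unfolding good_def k0_def[symmetric] k1_def[symmetric] SA_def[symmetric] SB_def[symmetric]
      using eqn by (intro conjI)
    then show ?thesis by blast
  qed
  define p where "p u \<zeta> = (SOME p. good u \<zeta> (fst p) (snd p))" for u \<zeta>
  have p: "good u \<zeta> (fst (p u \<zeta>)) (snd (p u \<zeta>))" if u: "u1 \<le> u" "\<zeta> \<in> surface_cdisc R" for u \<zeta>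
  proof -
    obtain g h where "good u \<zeta> g h" using main[OF u] by blast
    then have "good u \<zeta> (fst (g, h)) (snd (g, h))" by simp
    then show ?thesis unfolding p_def by (rule someI)
  qed
  have u1: "u1 > 0" using K by (simp add: u1_def)
  show "\<exists>(g :: real \<Rightarrow> complex \<Rightarrow> complex) (h :: real \<Rightarrow> complex \<Rightarrow> complex) (K :: real) (u0 :: real).
        K > 0 \<and> u0 > 0 \<and>
        (\<forall>u\<ge>u0. \<forall>\<zeta>\<in>surface_cdisc R.
           W\<^sub>2 u \<zeta> =
             exp \<zeta> * bessel_K \<mu> (of_real (ln u) + \<zeta>) *
               ((\<Sum>s<N. A s (exp \<zeta>) / of_real u ^ (2 * s)) + g u \<zeta>)
             - exp \<zeta> / of_real u * bessel_K (\<mu> + 1) (of_real (ln u) + \<zeta>) *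
               ((\<Sum>s<N. B s (exp \<zeta>) / of_real u ^ (2 * s)) + exp \<zeta> * h u \<zeta>) \<and>
           norm (g u \<zeta>) + norm (h u \<zeta>) \<le> K / u ^ (2 * N))"
  proof (rule exI[of _ "\<lambda>u \<zeta>. fst (p u \<zeta>)"], rule exI[of _ "\<lambda>u \<zeta>. snd (p u \<zeta>)"],
      rule exI[of _ K'], rule exI[of _ u1], intro conjI[OF K' conjI[OF u1]] allI impI ballI)
    fix u \<zeta> assume "u1 \<le> u" "\<zeta> \<in> surface_cdisc R"
    from p[OF this, unfolded good_def]
    show "W\<^sub>2 u \<zeta> =
             exp \<zeta> * bessel_K \<mu> (of_real (ln u) + \<zeta>) *
               ((\<Sum>s<N. A s (exp \<zeta>) / of_real u ^ (2 * s)) + fst (p u \<zeta>))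
             - exp \<zeta> / of_real u * bessel_K (\<mu> + 1) (of_real (ln u) + \<zeta>) *
               ((\<Sum>s<N. B s (exp \<zeta>) / of_real u ^ (2 * s)) + exp \<zeta> * snd (p u \<zeta>)) \<and>
           norm (fst (p u \<zeta>)) + norm (snd (p u \<zeta>)) \<le> K' / u ^ (2 * N)" .
  qed
qed

end
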